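(* Let $n\ge4$. There are exactly $2^n-1$ equivalence classes of differentiable $(\mathsf R^n,\mathsf R)$-knots.
   Context: The (closed) long ray $\mathsf R$ is the set $W(\omega_1)\times[0,1)$, where $W(\omega_1)$ is the set of ordinals $<\omega_1$, with the lexicographic order and the order topology; it is a non-metrizable $1$-manifold with boundary point $0=(0,0)$. A $C^\infty$ structure on $\mathsf R$ is fixed, given by a fixed maximal atlas $\{U_j,\psi_j\}$ of charts $\psi_j:U_j\to\mathbb R$ with $0\in U_j$ for all $j$; $\mathsf R^n$ carries the $n$-th power structure, with atlas $\{(U_j)^n,(\psi_j,\dots,\psi_j)\}$. Let $\mathsf R'=(\{-1\}\times[0,1))\sqcup\mathsf R$ with the order topology (every element of $\{-1\}\times[0,1)$ precedes every element of $\mathsf R$), so $\mathsf R\subset\mathsf R'$. A differentiable $(\mathsf R^n,\mathsf R)$-knot is a smooth embedding $\mathsf R\to\mathsf R^n$ (homeomorphism onto its image, $C^\infty$, with nowhere vanishing derivative in charts). An isotopy $\phi_t$ ($t\in[0,1]$) of a space $Y$ is a continuous map $Y\times[0,1]\to Y$, $(y,t)\mapsto\phi_t(y)$, with every $\phi_t$ a homeomorphism of $Y$. Two $(\mathsf R^n,\mathsf R)$-knots $f,g$ are equivalent if there is an isotopy $\phi_t$ of $(\mathsf R')^n$ with $\phi_0=\mathrm{id}$ and $\phi_1\circ f=g$. *)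

theory Defs
  imports "HOL-Analysis.Analysis" "HOL-Library.Option_ord" "HOL-Library.Countable_Set_Type"
begin

section \<open>The countable ordinals\<close>

text \<open>
  The relation \<^term>\<open>cardSuc natLeq\<close> is an initial well-order of the first uncountable
  cardinality, hence of order type $\omega_1$; the lemmas below record the two properties that
  characterise this order type.
\<close>

lemma Well_order_cardSuc_natLeq: "Well_order (cardSuc natLeq)"
  by (rule cardSuc_Well_order[OF natLeq_Card_order])

lemma Field_cardSuc_natLeq_nonempty: "Field (cardSuc natLeq) \<noteq> {}"
  by (simp add: Field_cardSuc_not_empty natLeq_Card_order)

typedef omega1 = "Field (cardSuc natLeq)"
  using Field_cardSuc_natLeq_nonempty by blast

setup_lifting type_definition_omega1

instantiation omega1 :: wellorder
begin

lift_definition less_eq_omega1 :: "omega1 \<Rightarrow> omega1 \<Rightarrow> bool"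
  is "\<lambda>a b. (a, b) \<in> cardSuc natLeq" .

definition less_omega1 :: "omega1 \<Rightarrow> omega1 \<Rightarrow> bool" where
  "less_omega1 a b \<longleftrightarrow> a \<le> b \<and> \<not> b \<le> a"

instance
proof
  let ?r = "cardSuc natLeq"
  have wo: "wo_rel ?r"
    using Well_order_cardSuc_natLeq by (simp add: wo_rel_def)
  fix a b c :: omega1 and P :: "omega1 \<Rightarrow> bool"
  show "a < b \<longleftrightarrow> a \<le> b \<and> \<not> b \<le> a"
    by (rule less_omega1_def)
  show "a \<le> a"
    by transfer (use wo_rel.REFL[OF wo] in \<open>auto simp: refl_on_def\<close>)
  show "a \<le> c" if "a \<le> b" "b \<le> c"
    using that by transfer (use wo_rel.TRANS[OF wo] in \<open>auto dest: transD\<close>)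
  show antisym: "a = b" if "a \<le> b" "b \<le> a" for a b :: omega1
    using that by transfer (use wo_rel.ANTISYM[OF wo] in \<open>auto dest: antisymD\<close>)
  show "a \<le> b \<or> b \<le> a"
    by transfer (use wo_rel.TOTALS[OF wo] in auto)
  show "P a" if step: "\<And>x. (\<And>y. y < x \<Longrightarrow> P y) \<Longrightarrow> P x"
  proof -
    have "wf (?r - Id)" by (rule wo_rel.WF[OF wo])
    then have "wf (inv_image (?r - Id) Rep_omega1)" by (rule wf_inv_image)
    then show ?thesis
    proof (induction a rule: wf_induct_rule)
      case (less x)
      show ?case
      proof (rule step)
        fix y assume "y < x"
        then have "(Rep_omega1 y, Rep_omega1 x) \<in> ?r" "y \<noteq> x"
          by (auto simp: less_omega1_def less_eq_omega1.rep_eq)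
        then show "P y"
          using less by (auto simp: Rep_omega1_inject)
      qed
    qed
  qed
qed

end

unbundle cardinal_syntax

lemma uncountable_omega1: "uncountable (UNIV :: omega1 set)"
proof
  assume "countable (UNIV :: omega1 set)"
  then have "countable (range Rep_omega1)" by blast
  then have "countable (Field (cardSuc natLeq))"
    by (simp add: type_definition.Rep_range[OF type_definition_omega1])
  then have "|Field (cardSuc natLeq)| \<le>o natLeq"
    by (simp add: countable_card_le_natLeq)
  moreover have "natLeq <o |Field (cardSuc natLeq)|"
    by (meson cardSuc_Card_order cardSuc_greater card_of_Field_ordIso natLeq_Card_order
        ordIso_symmetric ordLess_ordIso_trans)
  ultimately show False
    using not_ordLess_ordLeq by blast
qed

lemma countable_lessThan_omega1: "countable {..<a :: omega1}"
proof -
  let ?r = "cardSuc natLeq"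
  have "|underS ?r (Rep_omega1 a)| <o ?r"
    by (rule card_of_underS[OF cardSuc_Card_order[OF natLeq_Card_order] Rep_omega1])
  then have "|underS ?r (Rep_omega1 a)| \<le>o natLeq"
    using cardSuc_ordLess_ordLeq[OF natLeq_Card_order] card_of_Card_order
    by (meson cardSuc_ordLeq_ordLess natLeq_Card_order)
  then have "countable (underS ?r (Rep_omega1 a))"
    by (simp add: countable_card_le_natLeq)
  moreover have "Rep_omega1 ` {..<a} \<subseteq> underS ?r (Rep_omega1 a)"
    by (auto simp: underS_def less_omega1_def less_eq_omega1.rep_eq)
  ultimately have "countable (Rep_omega1 ` {..<a})"
    using countable_subset by blast
  then show ?thesis
    by (rule countable_image_inj_on) (simp add: inj_on_def Rep_omega1_inject)
qed

unbundle no cardinal_syntax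

section \<open>Long rays\<close>

text \<open>
  A copy of the product \<open>'a \<times> [0,1)\<close>. A separate type is needed because pairs already carry the
  product topology, whereas here the topology is that of the lexicographic order.
\<close>

typedef 'a ray = "UNIV \<times> {0..<1} :: ('a \<times> real) set"
  by (rule exI[of _ "(undefined, 0)"]) simp

setup_lifting type_definition_ray

instantiation ray :: (linorder) linorder
begin

lift_definition less_eq_ray :: "'a ray \<Rightarrow> 'a ray \<Rightarrow> bool"
  is "\<lambda>(a, r) (b, s). a < b \<or> a = b \<and> r \<le> s" .

lift_definition less_ray :: "'a ray \<Rightarrow> 'a ray \<Rightarrow> bool"
  is "\<lambda>(a, r) (b, s). a < b \<or> a = b \<and> r < s" .

instance
  by intro_classes (transfer; force)+

end

instantiation ray :: (linorder) linorder_topology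
begin

definition open_ray :: "'a ray set \<Rightarrow> bool" where
  "open_ray = generate_topology (range (\<lambda>a. {..<a}) \<union> range (\<lambda>a. {a<..}))"

instance
  by intro_classes (rule open_ray_def)

end

type_synonym long_ray = "omega1 ray"

definition origin :: long_ray where
  "origin = Abs_ray (LEAST \<alpha>. True, 0)"

lemma origin_le: "origin \<le> x"
proof -
  have "(LEAST \<alpha>. True) \<le> fst (Rep_ray x)"
    by (simp add: Least_le)
  moreover have "0 \<le> snd (Rep_ray x)"
    using Rep_ray[of x] by auto
  ultimately show ?thesis
    by (auto simp: origin_def less_eq_ray.rep_eq Abs_ray_inverse case_prod_unfold)
qed

text \<open>
  The extended ray $\mathsf R'$: the new least index \<^const>\<open>None\<close> plays the role of $-1$, and
  the indices \<open>Some \<alpha>\<close> make up the copy of $\mathsf R$ in $\mathsf R'$.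
\<close>

type_synonym extended_ray = "omega1 option ray"

definition extend :: "long_ray \<Rightarrow> extended_ray" where
  "extend x = (case Rep_ray x of (\<alpha>, r) \<Rightarrow> Abs_ray (Some \<alpha>, r))"

section \<open>Smooth structures on the long ray\<close>

text \<open>
  Smoothness of a function of one real variable on a set \<open>S\<close>: \<open>D k\<close> is the \<open>k\<close>-th derivative,
  taken within \<open>S\<close>, thus one-sided at an end point of \<open>S\<close> belonging to \<open>S\<close> (the chart value of
  the boundary point). All sets \<open>S\<close> to which this is applied are without isolated points.
\<close>

definition smooth_on :: "real set \<Rightarrow> (real \<Rightarrow> 'b::real_normed_vector) \<Rightarrow> bool" where
  "smooth_on S h \<longleftrightarrow>
     (\<exists>D. D 0 = h \<and> (\<forall>k. \<forall>x\<in>S. (D k has_vector_derivative D (Suc k) x) (at x within S)))"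

text \<open>
  A chart is a pair of a domain and a map; the values of the map outside the domain are irrelevant.
  A chart is a homeomorphism onto its image in the reals, which near the value of
  \<^const>\<open>origin\<close> is a half-open interval. Maximality of an atlas is meant among the atlases all
  of whose domains contain \<^const>\<open>origin\<close>.
\<close>

type_synonym chart = "long_ray set \<times> (long_ray \<Rightarrow> real)"

definition is_chart :: "chart \<Rightarrow> bool" where
  "is_chart = (\<lambda>(U, \<psi>). open U \<and> origin \<in> U \<and> (\<exists>\<theta>. homeomorphism U (\<psi> ` U) \<psi> \<theta>))"

definition compatible :: "chart \<Rightarrow> chart \<Rightarrow> bool" where
  "compatible = (\<lambda>(U, \<psi>) (V, \<eta>).
     smooth_on (\<psi> ` (U \<inter> V)) (\<eta> \<circ> the_inv_into U \<psi>) \<and>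
     smooth_on (\<eta> ` (U \<inter> V)) (\<psi> \<circ> the_inv_into V \<eta>))"

definition smooth_atlas :: "chart set \<Rightarrow> bool" where
  "smooth_atlas A \<longleftrightarrow>
     (\<forall>c\<in>A. is_chart c) \<and> (\<Union>(U, \<psi>)\<in>A. U) = UNIV \<and> (\<forall>c\<in>A. \<forall>d\<in>A. compatible c d)"

definition maximal_smooth_atlas :: "chart set \<Rightarrow> bool" where
  "maximal_smooth_atlas A \<longleftrightarrow> smooth_atlas A \<and> (\<forall>B. smooth_atlas B \<and> A \<subseteq> B \<longrightarrow> B = A)"

section \<open>Knots\<close>

text \<open>
  The target $\mathsf R^n$ carries the charts $(V^n, (\eta,\dots,\eta))$ for $(V,\eta)$ in the
  atlas; these cover $\mathsf R^n$ because all domains \<open>V\<close> contain \<^const>\<open>origin\<close> and the atlas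
  is maximal, so finitely many points always lie in a common \<open>V\<close>. Then \<open>local_expr\<close> is the expression of \<open>f\<close> in the charts $(U,\psi)$ and
  $(V^n, (\eta,\dots,\eta))$, defined on \<open>local_dom\<close>.
\<close>

definition local_dom ::
  "chart \<Rightarrow> chart \<Rightarrow> (long_ray \<Rightarrow> long_ray ^ 'n) \<Rightarrow> real set" where
  "local_dom = (\<lambda>(U, \<psi>) (V, \<eta>) f. \<psi> ` {x \<in> U. \<forall>i. f x $ i \<in> V})"

definition local_expr ::
  "chart \<Rightarrow> chart \<Rightarrow> (long_ray \<Rightarrow> long_ray ^ 'n) \<Rightarrow> real \<Rightarrow> real ^ 'n" where
  "local_expr = (\<lambda>(U, \<psi>) (V, \<eta>) f s. \<chi> i. \<eta> (f (the_inv_into U \<psi> s) $ i))"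

definition smooth_knot :: "chart set \<Rightarrow> (long_ray \<Rightarrow> long_ray ^ 'n) \<Rightarrow> bool" where
  "smooth_knot A f \<longleftrightarrow>
     (\<exists>g. homeomorphism UNIV (range f) f g) \<and>
     (\<forall>c\<in>A. \<forall>d\<in>A.
        smooth_on (local_dom c d f) (local_expr c d f) \<and>
        (\<forall>s\<in>local_dom c d f.
           vector_derivative (local_expr c d f) (at s within local_dom c d f) \<noteq> 0))"

definition isotopy :: "(real \<Rightarrow> 'a::topological_space \<Rightarrow> 'a) \<Rightarrow> bool" where
  "isotopy \<phi> \<longleftrightarrow>
     continuous_on (UNIV \<times> {0..1}) (\<lambda>(y, t). \<phi> t y) \<and>
     (\<forall>t\<in>{0..1}. \<exists>g. homeomorphism UNIV UNIV (\<phi> t) g)"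

definition extend_vec :: "long_ray ^ 'n \<Rightarrow> extended_ray ^ 'n" where
  "extend_vec x = (\<chi> i. extend (x $ i))"

definition knot_equiv ::
  "(long_ray \<Rightarrow> long_ray ^ 'n) \<Rightarrow> (long_ray \<Rightarrow> long_ray ^ 'n) \<Rightarrow> bool" where
  "knot_equiv f g \<longleftrightarrow>
     (\<exists>\<phi> :: real \<Rightarrow> extended_ray ^ 'n \<Rightarrow> extended_ray ^ 'n.
        isotopy \<phi> \<and> \<phi> 0 = id \<and> \<phi> 1 \<circ> (extend_vec \<circ> f) = extend_vec \<circ> g)"

end

theory Submission
  imports Defs
begin

text \<open>
  An unbounded coordinate of a knot has a closed unbounded set of fixed points. At a limit of fixed
  points smoothness forces its derivative to be 1, so it increases near every such limit, hence (a
  failure of monotonicity beyond every bound would accumulate at one of them) from some point on;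
  a bounded coordinate is eventually constant. The tail of the knot is therefore straightened by an
  isotopy acting on each coordinate separately. What remains is a compact arc in a box with
  linear coordinates that are locally bi-Lipschitz with respect to the charts. As \<open>n \<ge> 4\<close>, some
  direction is parallel to no chord of the arc, and two shears straighten it. So the
  nonempty set of unbounded coordinates determines the class of the knot; conversely, boundedness of
  a coordinate is an open and closed condition along an isotopy.
\<close>

section \<open>Order topology of long rays\<close>

text \<open>The collar of \<open>extended_ray\<close> is what makes room: the open interval from
  \<open>bottom\<close> to \<open>extend b\<close> is order isomorphic to the real line, so the box
  in which an arc is straightened becomes a full Euclidean space, whose compactly supported
  isotopies extend by the identity. Without the collar every stage would have to preserve the
  boundary faces. The bound 4 is a dimension count: multiples of chords of an arc depend on three
  parameters, two points and a factor, and so form a negligible set from dimension 4 on.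
  Negligibility survives locally Lipschitz maps. Hence coordinates on initial segments need only be
  Lipschitz comparable with the charts, and these can be glued by continuing one chart after
  another, whereas smooth gluing would call for interpolation. Two facts about length enter:
  countably many points have a common upper bound, and countably many closed unbounded sets meet.
  The first makes thresholds chosen for rationals, coordinates or times uniform; the second forces
  one of two disjoint closed sets to be bounded, so that continuous functions settle.\<close>

lemma Rep_ray_bounds: "0 \<le> snd (Rep_ray x)" "snd (Rep_ray x) < 1"
  using Rep_ray[of x] by auto

lemma Rep_ray_Abs: "0 \<le> r \<Longrightarrow> r < 1 \<Longrightarrow> Rep_ray (Abs_ray (a, r)) = (a, r)"
  by (rule Abs_ray_inverse) auto

lemma less_eq_ray_iff:
  "x \<le> y \<longleftrightarrow> fst (Rep_ray x) < fst (Rep_ray y) \<or>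
     fst (Rep_ray x) = fst (Rep_ray y) \<and> snd (Rep_ray x) \<le> snd (Rep_ray y)"
  by (auto simp: less_eq_ray.rep_eq case_prod_unfold)

lemma less_ray_iff:
  "x < y \<longleftrightarrow> fst (Rep_ray x) < fst (Rep_ray y) \<or>
     fst (Rep_ray x) = fst (Rep_ray y) \<and> snd (Rep_ray x) < snd (Rep_ray y)"
  by (auto simp: less_ray.rep_eq case_prod_unfold)

text \<open>The least index occurring in \<open>X\<close> exists because indices are well-ordered;
  over it, the infimum of the real parts \<open>R\<close> is taken. It stays below 1 since it is at
  most the real part of an actual element, so the pair is again a point of the ray.\<close>

lemma ray_glb_exists:
  fixes X :: "'a::wellorder ray set"
  assumes "X \<noteq> {}"
  shows "\<exists>z. (\<forall>x\<in>X. z \<le> x) \<and> (\<forall>w. (\<forall>x\<in>X. w \<le> x) \<longrightarrow> w \<le> z)"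
proof -
  define a where "a = (LEAST a. \<exists>x\<in>X. fst (Rep_ray x) = a)"
  define R where "R = {r. \<exists>x\<in>X. Rep_ray x = (a, r)}"
  have "\<exists>x\<in>X. fst (Rep_ray x) = a"
    unfolding a_def by (rule LeastI_ex) (use assms in blast)
  then obtain x0 where x0: "x0 \<in> X" "fst (Rep_ray x0) = a" by blast
  have a_le: "a \<le> fst (Rep_ray x)" if "x \<in> X" for x
    unfolding a_def by (rule Least_le) (use that in blast)
  have r0: "snd (Rep_ray x0) \<in> R" using x0 by (auto simp: R_def prod_eq_iff)
  have Rnn: "0 \<le> r" if rR: "r \<in> R" for r
  proof -
    obtain x where "Rep_ray x = (a, r)" using rR by (auto simp: R_def)
    then show ?thesis using Rep_ray_bounds(1)[of x] by simp
  qed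
  have bdd: "bdd_below R" by (rule bdd_belowI[OF Rnn])
  have lo: "0 \<le> Inf R" using r0 Rnn by (intro cInf_greatest) auto
  have "Inf R \<le> snd (Rep_ray x0)" using r0 bdd by (rule cInf_lower)
  then have up: "Inf R < 1" using Rep_ray_bounds(2)[of x0] by linarith
  define z where "z = Abs_ray (a, Inf R)"
  have Rz: "Rep_ray z = (a, Inf R)" unfolding z_def using lo up by (rule Rep_ray_Abs)
  have "z \<le> x" if "x \<in> X" for x
  proof (cases "fst (Rep_ray x) = a")
    case True
    then have "snd (Rep_ray x) \<in> R" using that by (auto simp: R_def prod_eq_iff)
    then show ?thesis using True Rz cInf_lower[OF _ bdd] by (auto simp: less_eq_ray_iff)
  next
    case False
    then show ?thesis using a_le[OF that] Rz by (auto simp: less_eq_ray_iff)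
  qed
  moreover have "w \<le> z" if w: "\<forall>x\<in>X. w \<le> x" for w
  proof (cases "fst (Rep_ray w) = a")
    case True
    have "snd (Rep_ray w) \<le> Inf R"
    proof (rule cInf_greatest)
      show "R \<noteq> {}" using r0 by blast
      fix r assume "r \<in> R"
      then obtain x where x: "x \<in> X" "Rep_ray x = (a, r)" unfolding R_def by blast
      then have "w \<le> x" using w by blast
      then show "snd (Rep_ray w) \<le> r" using x True by (simp add: less_eq_ray_iff)
    qed
    then show ?thesis using True Rz by (auto simp: less_eq_ray_iff)
  next
    case False
    have "w \<le> x0" using w x0 by blast
    then show ?thesis using False Rz x0 by (auto simp: less_eq_ray_iff)
  qed
  ultimately show ?thesis by blast
qed

text \<open>\<open>Sup\<close> is reduced to the \<open>Inf\<close> of the upper bounds, so that the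
  well-ordering of the indices has to be exploited only once.\<close>

instantiation ray :: (wellorder) conditionally_complete_linorder
begin

definition inf_ray :: "'a ray \<Rightarrow> 'a ray \<Rightarrow> 'a ray" where "inf_ray = min"
definition sup_ray :: "'a ray \<Rightarrow> 'a ray \<Rightarrow> 'a ray" where "sup_ray = max"
definition Inf_ray :: "'a ray set \<Rightarrow> 'a ray" where
  "Inf_ray X = (SOME z. (\<forall>x\<in>X. z \<le> x) \<and> (\<forall>w. (\<forall>x\<in>X. w \<le> x) \<longrightarrow> w \<le> z))"
definition Sup_ray :: "'a ray set \<Rightarrow> 'a ray" where
  "Sup_ray X = Inf {b. \<forall>x\<in>X. x \<le> b}"

instance
proof
  have I: "(\<forall>x\<in>X. Inf X \<le> x) \<and> (\<forall>w. (\<forall>x\<in>X. w \<le> x) \<longrightarrow> w \<le> Inf X)"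
    if "X \<noteq> {}" for X :: "'a ray set"
    unfolding Inf_ray_def by (rule someI_ex[OF ray_glb_exists[OF that]])
  fix x y z :: "'a ray" and X :: "'a ray set"
  show "inf x y \<le> x" "inf x y \<le> y" "x \<le> sup x y" "y \<le> sup x y"
    by (auto simp: inf_ray_def sup_ray_def)
  show "x \<le> y \<Longrightarrow> x \<le> z \<Longrightarrow> x \<le> inf y z" "y \<le> x \<Longrightarrow> z \<le> x \<Longrightarrow> sup y z \<le> x"
    by (auto simp: inf_ray_def sup_ray_def)
  show "Inf X \<le> x" if "x \<in> X" "bdd_below X" using I[of X] that by blast
  show "z \<le> Inf X" if "X \<noteq> {}" "\<And>x. x \<in> X \<Longrightarrow> z \<le> x" using I[of X] that by blast
  show "x \<le> Sup X" if "x \<in> X" "bdd_above X"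
  proof -
    from that(2) obtain u where "\<forall>x\<in>X. x \<le> u" by (auto simp: bdd_above_def)
    then have ne: "{b. \<forall>x\<in>X. x \<le> b} \<noteq> {}" by blast
    show ?thesis unfolding Sup_ray_def using I[OF ne] that(1) by blast
  qed
  show "Sup X \<le> z" if "X \<noteq> {}" "\<And>x. x \<in> X \<Longrightarrow> x \<le> z"
  proof -
    have ne: "{b. \<forall>x\<in>X. x \<le> b} \<noteq> {}" using that by blast
    show ?thesis unfolding Sup_ray_def using I[OF ne] that(2) by blast
  qed
qed

end

text \<open>Density on top of completeness makes intervals connected and gives the intermediate
  value theorem on rays.\<close>

instance ray :: (wellorder) linear_continuum_topology
proof
  fix x y :: "'a ray"
  show "\<exists>z. x < z \<and> z < y" if "x < y"
  proof (cases "fst (Rep_ray x) = fst (Rep_ray y)")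
    case True
    define r where "r = (snd (Rep_ray x) + snd (Rep_ray y)) / 2"
    have "snd (Rep_ray x) < snd (Rep_ray y)" using that True by (auto simp: less_ray_iff)
    then have "0 \<le> r" "r < 1" "snd (Rep_ray x) < r" "r < snd (Rep_ray y)"
      using Rep_ray_bounds[of x] Rep_ray_bounds[of y] by (auto simp: r_def)
    then show ?thesis using True
      by (intro exI[of _ "Abs_ray (fst (Rep_ray x), r)"]) (auto simp: less_ray_iff Rep_ray_Abs)
  next
    case False
    \<comment> \<open>Real parts never reach 1, so the midpoint with 1 lies strictly above
      \<open>x\<close> in its own fibre, hence below \<open>y\<close>.\<close>
    define r where "r = (snd (Rep_ray x) + 1) / 2"
    have "0 \<le> r" "r < 1" "snd (Rep_ray x) < r"
      using Rep_ray_bounds[of x] by (auto simp: r_def)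
    then show ?thesis using False that
      by (intro exI[of _ "Abs_ray (fst (Rep_ray x), r)"]) (auto simp: less_ray_iff Rep_ray_Abs)
  qed
next
  have "Abs_ray (undefined, 0) \<noteq> (Abs_ray (undefined, 1/2) :: 'a ray)"
  proof
    assume "Abs_ray (undefined, 0) = (Abs_ray (undefined, 1/2) :: 'a ray)"
    then have "Rep_ray (Abs_ray (undefined, 0) :: 'a ray) = Rep_ray (Abs_ray (undefined, 1/2))"
      by simp
    then show False by (simp add: Rep_ray_Abs)
  qed
  then show "\<exists>a b::'a ray. a \<noteq> b" by blast
qed

text \<open>The index sets of both rays, \<open>omega1\<close> and \<open>omega1 option\<close>,
  share these properties of the first uncountable ordinal; the class lets one proof serve the long
  ray and the extended ray.\<close>

class omega_one = wellorder +
  assumes countable_initial_segment: "countable {..<a}"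
    and uncountable_carrier: "uncountable (UNIV :: 'a set)"

instance omega1 :: omega_one
  by standard (rule countable_lessThan_omega1 uncountable_omega1)+

instance option :: (omega_one) omega_one
proof
  fix a :: "'a option"
  have "{..<a} \<subseteq> insert None (Some ` {..<the a})"
  proof
    fix x assume "x \<in> {..<a}"
    then show "x \<in> insert None (Some ` {..<the a})" by (cases x; cases a) auto
  qed
  then show "countable {..<a}"
    by (rule countable_subset) (simp add: countable_initial_segment)
  show "uncountable (UNIV :: 'a option set)"
  proof
    assume "countable (UNIV :: 'a option set)"
    then have "countable (Some ` (UNIV :: 'a set))" by (rule countable_subset[rotated]) simp
    then have "countable (UNIV :: 'a set)" by (rule countable_image_inj_on) (simp add: inj_on_def)
    then show False using uncountable_carrier by blast
  qed
qed

text \<open>The indices up to some point of \<open>S\<close> form a countable union of countable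
  sets, so an index above all of them remains; the first point of its fibre is the bound.\<close>

lemma countable_strictly_bounded:
  fixes S :: "'a::omega_one ray set"
  assumes "countable S"
  shows "\<exists>b. \<forall>x\<in>S. x < b"
proof -
  have c: "countable (\<Union>x\<in>S. {..fst (Rep_ray x)})"
  proof (rule countable_UN[OF assms])
    fix x :: "'a ray"
    have "{..fst (Rep_ray x)} = insert (fst (Rep_ray x)) {..<fst (Rep_ray x)}" by auto
    then show "countable {..fst (Rep_ray x)}" by (simp add: countable_initial_segment)
  qed
  have "(\<Union>x\<in>S. {..fst (Rep_ray x)}) \<noteq> UNIV"
  proof
    assume "(\<Union>x\<in>S. {..fst (Rep_ray x)}) = UNIV"
    with c have "countable (UNIV :: 'a set)" by simp
    then show False using uncountable_carrier by blast
  qed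
  then obtain a where "a \<notin> (\<Union>x\<in>S. {..fst (Rep_ray x)})" by auto
  then have "\<forall>x\<in>S. fst (Rep_ray x) < a" by (meson UN_I atMost_iff not_le)
  then show ?thesis
    by (intro exI[of _ "Abs_ray (a, 0)"]) (auto simp: less_ray_iff Rep_ray_Abs)
qed

instance ray :: (omega_one) no_top
proof
  fix x :: "'a ray"
  show "\<exists>y. x < y" using countable_strictly_bounded[of "{x}"] by auto
qed

text \<open>A sequence has countable range, hence is bounded, and an increasing bounded sequence
  tends to its supremum.\<close>

lemma strict_seq_converges:
  fixes x :: "nat \<Rightarrow> 'a::omega_one ray"
  assumes "\<And>n. x n < x (Suc n)"
  obtains l where "x \<longlonglongrightarrow> l" "\<And>n. x n < l"
proof -
  have inc: "incseq x" using assms by (intro incseq_SucI) (simp add: less_imp_le)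
  obtain b where b: "\<forall>y\<in>range x. y < b" using countable_strictly_bounded[of "range x"] by auto
  then have bdd: "bdd_above (range x)" by (auto intro!: bdd_aboveI less_imp_le)
  have "x \<longlonglongrightarrow> (SUP n. x n)"
  proof (rule order_tendstoI)
    fix a assume "a < (SUP n. x n)"
    then obtain n where "a < x n" using less_cSUP_iff[OF _ bdd] by auto
    then have "\<forall>m\<ge>n. a < x m" using inc by (meson incseqD less_le_trans)
    then show "\<forall>\<^sub>F n in sequentially. a < x n" by (auto simp: eventually_sequentially)
  next
    fix a assume "(SUP n. x n) < a"
    then show "\<forall>\<^sub>F n in sequentially. x n < a"
      using cSUP_upper[OF _ bdd] by (intro always_eventually allI) (meson UNIV_I le_less_trans)
  qed
  moreover have "x n < (SUP n. x n)" for n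
    using assms[of n] cSUP_upper[OF _ bdd, of "Suc n"] by (meson UNIV_I less_le_trans)
  ultimately show ?thesis by (rule that)
qed

section \<open>Closed unbounded sets and compact segments\<close>

definition unbounded :: "'a::ord set \<Rightarrow> bool" where
  "unbounded S \<longleftrightarrow> (\<forall>b. \<exists>x\<in>S. b < x)"

lemma unboundedI: "(\<And>b. \<exists>x\<in>S. b < x) \<Longrightarrow> unbounded S"
  by (simp add: unbounded_def)

lemma unboundedD: "unbounded S \<Longrightarrow> \<exists>x\<in>S. b < x"
  by (simp add: unbounded_def)

lemma unbounded_mono: "unbounded S \<Longrightarrow> S \<subseteq> T \<Longrightarrow> unbounded T"
  unfolding unbounded_def by blast

lemma not_unboundedD: "\<not> unbounded S \<Longrightarrow> \<exists>b. \<forall>x\<in>S. x \<le> b" for S :: "'a::linorder set"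
  unfolding unbounded_def by (auto simp: not_less)

text \<open>A strictly increasing sequence meeting each of the sets infinitely often converges to a
  common point.\<close>

lemma club_Inter:
  fixes C :: "nat \<Rightarrow> 'a::omega_one ray set"
  assumes "\<And>k. closed (C k)" and "\<And>k. unbounded (C k)"
  shows "unbounded (\<Inter>k. C k)"
proof (rule unboundedI)
  fix b
  have "\<exists>y. y \<in> C k \<and> x < y" for k x using unboundedD[OF assms(2)[of k], of x] by blast
  then obtain nx where nx: "\<And>k x. nx k x \<in> C k \<and> x < nx k x" by metis
  \<comment> \<open>Decoding \<open>n\<close> as a pair and using its first component visits each
    \<open>k\<close> infinitely often: the terms numbered \<open>Suc (prod_encode (k, j))\<close>
    all lie in \<open>C k\<close>.\<close>
  define x where "x = rec_nat b (\<lambda>n y. nx (fst (prod_decode n)) y)"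
  have xS: "x (Suc n) = nx (fst (prod_decode n)) (x n)" for n by (simp add: x_def)
  have "x n < x (Suc n)" for n using nx xS by simp
  then obtain l where l: "x \<longlonglongrightarrow> l" "\<And>n. x n < l" by (rule strict_seq_converges) blast
  have "l \<in> C k" for k
  proof -
    define r where "r j = Suc (prod_encode (k, j))" for j
    have "j \<le> r j" for j using le_prod_encode_2[of j k] by (simp add: r_def)
    then have "filterlim r at_top sequentially"
      by (intro filterlim_at_top_mono[OF filterlim_ident]) auto
    then have "(\<lambda>j. x (r j)) \<longlonglongrightarrow> l" using filterlim_compose[OF l(1)] by blast
    moreover have "x (r j) \<in> C k" for j using nx xS by (simp add: r_def)
    ultimately show ?thesis by (meson assms(1) closed_sequentially)
  qed
  moreover have "b < l" using l(2)[of 0] by (simp add: x_def)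
  ultimately show "\<exists>x\<in>(\<Inter>k. C k). b < x" by blast
qed

lemma club_Int:
  fixes C D :: "'a::omega_one ray set"
  assumes "closed C" "closed D" "unbounded C" "unbounded D"
  shows "unbounded (C \<inter> D)"
proof -
  define E where "E k = (if k = 0 then C else D)" for k :: nat
  have "unbounded (\<Inter>k. E k)"
    by (rule club_Inter) (use assms in \<open>auto simp: E_def\<close>)
  moreover have "(\<Inter>k. E k) \<subseteq> E 0 \<inter> E 1" by blast
  ultimately show ?thesis by (auto simp: E_def elim: unbounded_mono)
qed

lemma club_INT_finite:
  fixes C :: "'i \<Rightarrow> 'a::omega_one ray set"
  assumes "finite I" "\<And>i. i \<in> I \<Longrightarrow> closed (C i)" "\<And>i. i \<in> I \<Longrightarrow> unbounded (C i)"
  shows "unbounded (\<Inter>i\<in>I. C i)"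
  using assms
proof (induction I rule: finite_induct)
  case empty
  then show ?case using gt_ex by (auto simp: unbounded_def)
next
  case (insert i I)
  have "unbounded (C i \<inter> (\<Inter>i\<in>I. C i))"
    by (rule club_Int) (use insert in auto)
  then show ?case by simp
qed

text \<open>The supremum \<open>s\<close> of the points reachable by a finite subcover is itself
  reachable, and if it were below \<open>b\<close>, the member of the cover containing
  \<open>s\<close> would reach further.\<close>

lemma compact_Icc_ray: "compact {a..b :: 'a::wellorder ray}"
proof (cases "a \<le> b")
  case True
  show ?thesis
  proof (rule compactI)
    fix \<C> :: "'a ray set set"
    assume op: "\<forall>t\<in>\<C>. open t" and cov: "{a..b} \<subseteq> \<Union>\<C>"
    define P where "P x \<longleftrightarrow> (\<exists>\<D>\<subseteq>\<C>. finite \<D> \<and> {a..x} \<subseteq> \<Union>\<D>)" for x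
    have Pa: "P a"
    proof -
      obtain t where "t \<in> \<C>" "a \<in> t" using cov True by auto
      then show ?thesis unfolding P_def by (intro exI[of _ "{t}"]) auto
    qed
    define s where "s = Sup {x. a \<le> x \<and> x \<le> b \<and> P x}"
    let ?X = "{x. a \<le> x \<and> x \<le> b \<and> P x}"
    have bdd: "bdd_above ?X" by (rule bdd_aboveI[of _ b]) auto
    have aX: "a \<in> ?X" using True Pa by auto
    have s: "a \<le> s" "s \<le> b" unfolding s_def
      by (auto intro!: cSup_upper bdd aX cSup_least simp: True Pa)
    obtain t where t: "t \<in> \<C>" "s \<in> t" using cov s by (meson UnionE atLeastAtMost_iff subset_iff)
    have ext: "P y" if Px: "P x" and xy: "{x..y} \<subseteq> t" for x y
    proof -
      obtain \<D> where D: "\<D> \<subseteq> \<C>" "finite \<D>" "{a..x} \<subseteq> \<Union>\<D>" using Px by (auto simp: P_def)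
      have "{a..y} \<subseteq> {a..x} \<union> {x..y}" by auto
      then have "{a..y} \<subseteq> \<Union>(insert t \<D>)" using D xy by auto
      then show ?thesis unfolding P_def using D t by (intro exI[of _ "insert t \<D>"]) auto
    qed
    have Ps: "P s"
    proof (cases "s = a")
      case False
      then have "a < s" using s by simp
      then obtain l where l: "l < s" "{l<..s} \<subseteq> t" using open_left[of t s a] op t by blast
      then obtain x where x: "x \<in> ?X" "l < x" using less_cSup_iff[OF _ bdd] aX unfolding s_def by blast
      have "{x..s} \<subseteq> {l<..s}" using x(2) by auto
      then show ?thesis using ext[of x] x(1) l(2) by blast
    qed (use Pa in simp)
    have "s = b"
    proof (rule ccontr)
      assume "s \<noteq> b"
      then have "s < b" using s by simp
      then obtain u where u: "s < u" "{s..<u} \<subseteq> t" using open_right[of t s b] op t by blast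
      obtain v where v: "s < v" "v < min u b" using dense[of s "min u b"] u \<open>s < b\<close> by auto
      have "{s..v} \<subseteq> {s..<u}" using v by auto
      then have "P v" using ext[OF Ps] u by blast
      then have "v \<in> ?X" using v s by auto
      then have "v \<le> s" unfolding s_def by (rule cSup_upper[OF _ bdd])
      then show False using v by simp
    qed
    with Ps show "\<exists>\<D>\<subseteq>\<C>. finite \<D> \<and> {a..b} \<subseteq> \<Union>\<D>" by (simp add: P_def)
  qed
qed simp

lemma continuous_bounded_segment:
  fixes f :: "'a::wellorder ray \<Rightarrow> 'b::linorder_topology"
  assumes "continuous_on {a..b} f"
  shows "\<exists>c. \<forall>x\<in>{a..b}. f x \<le> c"
proof (cases "a \<le> b")
  case True
  have "compact (f ` {a..b})" by (rule compact_continuous_image[OF assms compact_Icc_ray])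
  moreover have "f ` {a..b} \<noteq> {}" using True by auto
  ultimately obtain s where "\<forall>t\<in>f ` {a..b}. t \<le> s" using compact_attains_sup by blast
  then show ?thesis by blast
qed auto

section \<open>Smooth charts\<close>

lemma smooth_on_subset: "smooth_on S h \<Longrightarrow> T \<subseteq> S \<Longrightarrow> smooth_on T h"
  unfolding smooth_on_def by (elim exE conjE) (blast intro: has_vector_derivative_within_subset)

lemma smooth_on_cong:
  assumes "smooth_on S h" "\<And>x. x \<in> S \<Longrightarrow> h' x = h x"
  shows "smooth_on S h'"
proof -
  obtain D where D: "D 0 = h" "\<And>k x. x \<in> S \<Longrightarrow> (D k has_vector_derivative D (Suc k) x) (at x within S)"
    using assms(1) unfolding smooth_on_def by blast
  define E where "E k = (if k = 0 then h' else D k)" for k :: nat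
  have "(E k has_vector_derivative E (Suc k) x) (at x within S)" if x: "x \<in> S" for k x
  proof (rule has_vector_derivative_transform[OF x])
    show "E k y = D k y" if "y \<in> S" for y using that D(1) assms(2) by (simp add: E_def)
    show "(D k has_vector_derivative E (Suc k) x) (at x within S)" using D(2)[OF x] by (simp add: E_def)
  qed
  moreover have "E 0 = h'" by (simp add: E_def)
  ultimately show ?thesis unfolding smooth_on_def by blast
qed

text \<open>A derivative within a set depends only on the set near the point, and near a point of
  \<open>T1\<close> the set \<open>S\<close> coincides with \<open>S \<inter> T1\<close>; so the two
  sequences of derivatives can be pasted.\<close>

lemma smooth_on_glue:
  assumes "open T1" "open T2" "S \<subseteq> T1 \<union> T2" "S \<inter> T1 \<inter> T2 = {}"
    and "smooth_on (S \<inter> T1) h" "smooth_on (S \<inter> T2) h"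
  shows "smooth_on S h"
proof -
  obtain D1 where D1: "D1 0 = h"
    "\<And>k x. x \<in> S \<inter> T1 \<Longrightarrow> (D1 k has_vector_derivative D1 (Suc k) x) (at x within S \<inter> T1)"
    using assms(5) unfolding smooth_on_def by blast
  obtain D2 where D2: "D2 0 = h"
    "\<And>k x. x \<in> S \<inter> T2 \<Longrightarrow> (D2 k has_vector_derivative D2 (Suc k) x) (at x within S \<inter> T2)"
    using assms(6) unfolding smooth_on_def by blast
  define D where "D k x = (if x \<in> T1 then D1 k x else D2 k x)" for k x
  have "(D k has_vector_derivative D (Suc k) x) (at x within S)" if x: "x \<in> S" for k x
  proof (cases "x \<in> T1")
    case True
    then have xT: "x \<in> S \<inter> T1" using x by simp
    have "(D k has_vector_derivative D (Suc k) x) (at x within S \<inter> T1)"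
      by (rule has_vector_derivative_transform[OF xT, of _ "D1 k"]) (use D1(2)[OF xT] True in \<open>auto simp: D_def\<close>)
    moreover have "at x within S \<inter> T1 = at x within S"
      by (rule at_within_nhd[OF True assms(1)]) auto
    ultimately show ?thesis by simp
  next
    case False
    then have xT: "x \<in> S \<inter> T2" and x2: "x \<in> T2" using x assms(3) by auto
    have "(D k has_vector_derivative D (Suc k) x) (at x within S \<inter> T2)"
      by (rule has_vector_derivative_transform[OF xT, of _ "D2 k"])
         (use D2(2)[OF xT] False assms(4) in \<open>auto simp: D_def\<close>)
    moreover have "at x within S \<inter> T2 = at x within S"
      by (rule at_within_nhd[OF x2 assms(2)]) auto
    ultimately show ?thesis by simp
  qed
  moreover have "D 0 = h" using D1 D2 by (auto simp: D_def)
  ultimately show ?thesis unfolding smooth_on_def by blast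
qed

lemma smooth_on_translate:
  assumes "smooth_on S h"
  shows "smooth_on ((\<lambda>x. x + c) ` S) (\<lambda>x. h (x - c))"
proof -
  obtain D where D: "D 0 = h" "\<And>k x. x \<in> S \<Longrightarrow> (D k has_vector_derivative D (Suc k) x) (at x within S)"
    using assms unfolding smooth_on_def by blast
  have "((\<lambda>x. D k (x - c)) has_vector_derivative D (Suc k) (x - c)) (at x within (\<lambda>x. x + c) ` S)"
    if "x \<in> (\<lambda>x. x + c) ` S" for k x
  proof -
    have im: "(\<lambda>x. x - c) ` (\<lambda>x. x + c) ` S = S" by force
    have 1: "((\<lambda>x. x - c) has_vector_derivative 1) (at x within (\<lambda>x. x + c) ` S)"
      by (auto intro!: derivative_eq_intros)
    have "x - c \<in> S" using that by auto
    then have 2: "(D k has_vector_derivative D (Suc k) (x - c)) (at (x - c) within (\<lambda>x. x - c) ` (\<lambda>x. x + c) ` S)"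
      unfolding im by (rule D(2))
    show ?thesis using vector_diff_chain_within[OF 1 2] by (simp add: comp_def)
  qed
  then show ?thesis unfolding smooth_on_def
    by (intro exI[of _ "\<lambda>k x. D k (x - c)"]) (use D(1) in auto)
qed

lemma smooth_on_affine:
  assumes "smooth_on S (h :: real \<Rightarrow> real)"
  shows "smooth_on S (\<lambda>x. h x *\<^sub>R e + c)"
proof -
  obtain D where D: "D 0 = h" "\<And>k x. x \<in> S \<Longrightarrow> (D k has_vector_derivative D (Suc k) x) (at x within S)"
    using assms unfolding smooth_on_def by blast
  define E where "E k x = D k x *\<^sub>R e + (if k = 0 then c else 0)" for k :: nat and x
  have "(E k has_vector_derivative E (Suc k) x) (at x within S)" if x: "x \<in> S" for k x
  proof -
    have "((\<lambda>x. D k x *\<^sub>R e) has_vector_derivative D (Suc k) x *\<^sub>R e) (at x within S)"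
      by (rule bounded_linear.has_vector_derivative[OF bounded_linear_scaleR_left D(2)[OF x]])
    from has_vector_derivative_add[OF this has_vector_derivative_const]
    show ?thesis by (simp add: E_def[abs_def])
  qed
  moreover have "E 0 = (\<lambda>x. h x *\<^sub>R e + c)" by (auto simp: E_def D(1))
  ultimately show ?thesis unfolding smooth_on_def by blast
qed

lemma smooth_on_ident: "smooth_on S (\<lambda>x. x :: real)"
proof -
  define D where "D k x = (if k = 0 then x else if k = 1 then 1 else 0)" for k :: nat and x :: real
  have "(D k has_vector_derivative D (Suc k) x) (at x within S)" for k x
    by (cases "k = 0"; cases "k = 1") (auto simp: D_def[abs_def] intro!: derivative_eq_intros)
  moreover have "D 0 = (\<lambda>x. x)" by (auto simp: D_def)
  ultimately show ?thesis unfolding smooth_on_def by blast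
qed

section \<open>Joining charts of a maximal atlas\<close>

lemma is_chartD:
  assumes "is_chart (U, \<psi>)"
  shows "open U" "origin \<in> U" "inj_on \<psi> U" "continuous_on U \<psi>"
    "continuous_on (\<psi> ` U) (the_inv_into U \<psi>)"
proof -
  obtain \<theta> where \<theta>: "homeomorphism U (\<psi> ` U) \<psi> \<theta>" using assms by (auto simp: is_chart_def)
  show "open U" "origin \<in> U" "continuous_on U \<psi>"
    using assms \<theta> by (auto simp: is_chart_def homeomorphism_def)
  show inj: "inj_on \<psi> U" by (rule inj_on_inverseI) (rule homeomorphism_apply1[OF \<theta>])
  have eq: "the_inv_into U \<psi> y = \<theta> y" if "y \<in> \<psi> ` U" for y
    using that the_inv_into_f_f[OF inj] homeomorphism_apply1[OF \<theta>] by auto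
  show "continuous_on (\<psi> ` U) (the_inv_into U \<psi>)"
    by (rule continuous_on_eq[OF homeomorphism_cont2[OF \<theta>]]) (simp add: eq)
qed

lemma compatible_sym: "compatible c d \<Longrightarrow> compatible d c"
  by (cases c; cases d) (simp add: compatible_def Int_commute)

text \<open>Holds because the inverse of a chart is continuous. It prepares
  \<open>smooth_on_glue\<close>, which wants pieces cut out by open sets of reals.\<close>

lemma chart_image_relatively_open:
  assumes "is_chart (U, \<psi>)" "open V"
  obtains T where "open T" "\<psi> ` (U \<inter> V) = \<psi> ` U \<inter> T"
proof -
  note c = is_chartD[OF assms(1)]
  obtain T where T: "open T" "T \<inter> \<psi> ` U = the_inv_into U \<psi> -` V \<inter> \<psi> ` U"
    using c(5) assms(2) unfolding continuous_on_open_invariant by blast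
  have "\<psi> ` (U \<inter> V) = \<psi> ` U \<inter> T"
  proof (intro equalityI subsetI)
    fix y assume "y \<in> \<psi> ` (U \<inter> V)"
    then obtain x where x: "y = \<psi> x" "x \<in> U" "x \<in> V" by blast
    then have "y \<in> the_inv_into U \<psi> -` V \<inter> \<psi> ` U" using the_inv_into_f_f[OF c(3) x(2)] by simp
    then show "y \<in> \<psi> ` U \<inter> T" unfolding T(2)[symmetric] by blast
  next
    fix y assume "y \<in> \<psi> ` U \<inter> T"
    then obtain x where x: "y = \<psi> x" "x \<in> U" and "y \<in> the_inv_into U \<psi> -` V"
      unfolding T(2)[symmetric] using T(2) by blast
    then have "x \<in> V" using the_inv_into_f_f[OF c(3) x(2)] by simp
    then show "y \<in> \<psi> ` (U \<inter> V)" using x by blast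
  qed
  with T(1) show ?thesis by (rule that)
qed

lemma separate_point_finite:
  fixes q :: "'a::t2_space"
  assumes "finite P" "q \<notin> P"
  obtains N1 N2 where "open N1" "open N2" "P \<subseteq> N1" "q \<in> N2" "N1 \<inter> N2 = {}"
proof -
  have "\<exists>N1 N2. open N1 \<and> open N2 \<and> P \<subseteq> N1 \<and> q \<in> N2 \<and> N1 \<inter> N2 = {}"
    using assms
  proof (induction P rule: finite_induct)
    case empty
    then show ?case by (intro exI[of _ "{}"] exI[of _ UNIV]) auto
  next
    case (insert p P)
    have q: "q \<notin> P" "p \<noteq> q" using insert.prems by blast+
    obtain N1 N2 where N: "open N1" "open N2" "P \<subseteq> N1" "q \<in> N2" "N1 \<inter> N2 = {}"
      using insert.IH[OF q(1)] by (elim exE conjE)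
    obtain M1 M2 where M: "open M1" "open M2" "p \<in> M1" "q \<in> M2" "M1 \<inter> M2 = {}"
      using hausdorff[OF q(2)] by (elim exE conjE)
    show ?case
      by (intro exI[of _ "N1 \<union> M1"] exI[of _ "N2 \<inter> M2"]) (use N M in auto)
  qed
  then show ?thesis using that by blast
qed

text \<open>Disjoint pieces of two charts of the atlas, moved apart in the reals, form another chart,
  which belongs to the atlas by maximality.\<close>

lemma union_chart:
  assumes A: "maximal_smooth_atlas A"
    and V: "(V, \<eta>) \<in> A" and U: "(U, \<psi>) \<in> A"
    and V1: "open V1" "V1 \<subseteq> V" "origin \<in> V1" "\<And>x. x \<in> V1 \<Longrightarrow> \<bar>\<eta> x\<bar> < M"
    and U1: "open U1" "U1 \<subseteq> U" "\<And>x. x \<in> U1 \<Longrightarrow> \<bar>\<psi> x\<bar> < m"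
    and disj: "V1 \<inter> U1 = {}"
  shows "\<exists>\<zeta>. (V1 \<union> U1, \<zeta>) \<in> A"
proof -
  have sa: "smooth_atlas A" using A by (simp add: maximal_smooth_atlas_def)
  have chV: "is_chart (V, \<eta>)" and chU: "is_chart (U, \<psi>)" using sa V U by (auto simp: smooth_atlas_def)
  note cV = is_chartD[OF chV] and cU = is_chartD[OF chU]
  \<comment> \<open>On \<open>V1\<close> the values of \<open>\<eta>\<close> stay below
    \<open>M\<close>; on \<open>U1\<close> those of \<open>\<psi> + c\<close> exceed
    \<open>M\<close> because \<open>\<psi> > - m\<close> there. So the point \<open>M\<close>
    separates the two images.\<close>
  define c where "c = M + m"
  define N where "N = V1 \<union> U1"
  define \<eta>' where "\<eta>' x = (if x \<in> V1 then \<eta> x else \<psi> x + c)" for x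
  have v: "\<eta>' x = \<eta> x" "\<eta> x < M" if "x \<in> V1" for x using that V1(4)[OF that] by (auto simp: \<eta>'_def)
  have u: "\<eta>' x = \<psi> x + c" "\<psi> x + c > M" if "x \<in> U1" for x
    using that U1(3)[OF that] disj by (auto simp: \<eta>'_def c_def)
  have inj: "inj_on \<eta>' N"
  proof (rule inj_onI)
    fix x y assume "x \<in> N" "y \<in> N" "\<eta>' x = \<eta>' y"
    then show "x = y"
      using v[of x] v[of y] u[of x] u[of y] inj_onD[OF cV(3), of x y] inj_onD[OF cU(3), of x y] V1(2) U1(2)
      unfolding N_def by (cases "x \<in> V1"; cases "y \<in> V1") auto
  qed
  have inv1: "the_inv_into N \<eta>' (\<eta> x) = x" if "x \<in> V1" for x
    using the_inv_into_f_f[OF inj, of x] v(1)[OF that] that by (simp add: N_def)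
  have inv2: "the_inv_into N \<eta>' (\<psi> x + c) = x" if "x \<in> U1" for x
    using the_inv_into_f_f[OF inj, of x] u(1)[OF that] that by (simp add: N_def)
  have iV: "the_inv_into V \<eta> (\<eta> x) = x" if "x \<in> V" for x using the_inv_into_f_f[OF cV(3) that] .
  have iU: "the_inv_into U \<psi> (\<psi> x) = x" if "x \<in> U" for x using the_inv_into_f_f[OF cU(3) that] .
  have imN: "\<eta>' ` (N \<inter> Z) = \<eta> ` (V1 \<inter> Z) \<union> (\<lambda>s. s + c) ` \<psi> ` (U1 \<inter> Z)" for Z
    unfolding N_def Int_Un_distrib2 image_Un image_image
    by (intro arg_cong2[of _ _ _ _ "(\<union>)"] image_cong refl) (simp_all add: v(1) u(1))
  have lo: "\<eta> ` (V1 \<inter> Z) \<subseteq> {..<M}" for Z using v(2) by blast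
  have hi: "(\<lambda>s. s + c) ` \<psi> ` (U1 \<inter> Z) \<subseteq> {M<..}" for Z using u(2) by blast
  have "{..<M} \<inter> {M<..} = {}" by auto
  note LH = lo hi this
  have im1: "\<eta>' ` (N \<inter> Z) \<inter> {..<M} = \<eta> ` (V1 \<inter> Z)" for Z
    unfolding imN using LH(1)[of Z] LH(2)[of Z] LH(3) by blast
  have im2: "\<eta>' ` (N \<inter> Z) \<inter> {M<..} = (\<lambda>s. s + c) ` \<psi> ` (U1 \<inter> Z)" for Z
    unfolding imN using LH(1)[of Z] LH(2)[of Z] LH(3) by blast
  have cover: "\<eta>' ` (N \<inter> Z) \<subseteq> {..<M} \<union> {M<..}" for Z
    unfolding imN using LH(1)[of Z] LH(2)[of Z] by blast
  have cont: "continuous_on N \<eta>'"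
    unfolding N_def
  proof (rule continuous_on_open_Un[OF V1(1) U1(1)])
    show "continuous_on V1 \<eta>'"
      by (rule continuous_on_eq[OF continuous_on_subset[OF cV(4) V1(2)]]) (simp add: v)
    have "continuous_on U1 (\<lambda>x. \<psi> x + c)"
      by (intro continuous_intros continuous_on_subset[OF cU(4) U1(2)])
    then show "continuous_on U1 \<eta>'" by (rule continuous_on_eq) (simp add: u)
  qed
  have cont_inv: "continuous_on (\<eta>' ` N) (the_inv_into N \<eta>')"
  proof -
    have 1: "continuous_on (\<eta>' ` N \<inter> {..<M}) (the_inv_into N \<eta>')"
    proof -
      have "continuous_on (\<eta> ` V1) (the_inv_into V \<eta>)"
        by (rule continuous_on_subset[OF cV(5)]) (use V1 in auto)
      then have "continuous_on (\<eta> ` V1) (the_inv_into N \<eta>')"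
        by (rule continuous_on_eq) (use inv1 iV V1(2) in auto)
      then show ?thesis using im1[of UNIV] by simp
    qed
    have 2: "continuous_on (\<eta>' ` N \<inter> {M<..}) (the_inv_into N \<eta>')"
    proof -
      have "continuous_on ((\<lambda>s. s + c) ` \<psi> ` U1) (\<lambda>s. the_inv_into U \<psi> (s - c))"
        by (rule continuous_on_compose2[OF cU(5)]) (use U1 in \<open>auto intro!: continuous_intros\<close>)
      then have "continuous_on ((\<lambda>s. s + c) ` \<psi> ` U1) (the_inv_into N \<eta>')"
        by (rule continuous_on_eq) (use inv2 iU U1(2) in auto)
      then show ?thesis using im2[of UNIV] by simp
    qed
    have eq: "\<eta>' ` N = (\<eta>' ` N \<inter> {..<M}) \<union> (\<eta>' ` N \<inter> {M<..})" using cover[of UNIV] by auto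
    show ?thesis
      by (subst eq, rule continuous_on_Un_local_open) (use 1 2 eq in \<open>auto intro!: openin_open_Int\<close>)
  qed
  have hom: "homeomorphism N (\<eta>' ` N) \<eta>' (the_inv_into N \<eta>')"
    using cont cont_inv the_inv_into_f_f[OF inj] by (auto simp: homeomorphism_def image_iff)
  have ch: "is_chart (N, \<eta>')"
    using hom V1 U1 by (auto simp: is_chart_def N_def)
  have comp: "compatible (N, \<eta>') (Z, \<zeta>)" if Z: "(Z, \<zeta>) \<in> A" for Z \<zeta>
  proof -
    have chZ: "is_chart (Z, \<zeta>)" using sa Z by (auto simp: smooth_atlas_def)
    note cZ = is_chartD[OF chZ]
    have iZ: "the_inv_into Z \<zeta> (\<zeta> x) = x" if "x \<in> Z" for x using the_inv_into_f_f[OF cZ(3) that] .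
    have "compatible (V, \<eta>) (Z, \<zeta>)" "compatible (U, \<psi>) (Z, \<zeta>)"
      using sa V U Z by (auto simp: smooth_atlas_def)
    then have sV: "smooth_on (\<eta> ` (V \<inter> Z)) (\<zeta> \<circ> the_inv_into V \<eta>)" "smooth_on (\<zeta> ` (V \<inter> Z)) (\<eta> \<circ> the_inv_into Z \<zeta>)"
      and sU: "smooth_on (\<psi> ` (U \<inter> Z)) (\<zeta> \<circ> the_inv_into U \<psi>)" "smooth_on (\<zeta> ` (U \<inter> Z)) (\<psi> \<circ> the_inv_into Z \<zeta>)"
      by (auto simp: compatible_def)
    have "smooth_on (\<eta>' ` (N \<inter> Z)) (\<zeta> \<circ> the_inv_into N \<eta>')"
    proof (rule smooth_on_glue[of "{..<M}" "{M<..}"])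
      have "smooth_on (\<eta> ` (V1 \<inter> Z)) (\<zeta> \<circ> the_inv_into V \<eta>)"
        by (rule smooth_on_subset[OF sV(1)]) (use V1(2) in auto)
      then have "smooth_on (\<eta> ` (V1 \<inter> Z)) (\<zeta> \<circ> the_inv_into N \<eta>')"
        by (rule smooth_on_cong) (use inv1 iV V1(2) in auto)
      then show "smooth_on (\<eta>' ` (N \<inter> Z) \<inter> {..<M}) (\<zeta> \<circ> the_inv_into N \<eta>')" by (simp add: im1)
      have "smooth_on ((\<lambda>s. s + c) ` \<psi> ` (U1 \<inter> Z)) (\<lambda>s. (\<zeta> \<circ> the_inv_into U \<psi>) (s - c))"
        by (rule smooth_on_translate[OF smooth_on_subset[OF sU(1)]]) (use U1(2) in auto)
      then have "smooth_on ((\<lambda>s. s + c) ` \<psi> ` (U1 \<inter> Z)) (\<zeta> \<circ> the_inv_into N \<eta>')"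
        by (rule smooth_on_cong) (use inv2 iU U1(2) in auto)
      then show "smooth_on (\<eta>' ` (N \<inter> Z) \<inter> {M<..}) (\<zeta> \<circ> the_inv_into N \<eta>')" by (simp add: im2)
    qed (use cover in auto)
    \<comment> \<open>Here the pieces lie in the image of \<open>\<zeta>\<close>, where they may be
      adjacent; being disjoint and relatively open is enough for gluing.\<close>
    moreover have "smooth_on (\<zeta> ` (N \<inter> Z)) (\<eta>' \<circ> the_inv_into Z \<zeta>)"
    proof -
      obtain T1 where T1: "open T1" "\<zeta> ` (Z \<inter> V1) = \<zeta> ` Z \<inter> T1"
        using chart_image_relatively_open[OF chZ V1(1)] .
      obtain T2 where T2: "open T2" "\<zeta> ` (Z \<inter> U1) = \<zeta> ` Z \<inter> T2"
        using chart_image_relatively_open[OF chZ U1(1)] .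
      have NZ: "\<zeta> ` (N \<inter> Z) = \<zeta> ` (Z \<inter> V1) \<union> \<zeta> ` (Z \<inter> U1)" by (auto simp: N_def)
      have d: "\<zeta> ` (Z \<inter> V1) \<inter> \<zeta> ` (Z \<inter> U1) = {}" using cZ(3) disj by (auto simp: inj_on_def)
      have S1: "\<zeta> ` (N \<inter> Z) \<inter> T1 = \<zeta> ` (Z \<inter> V1)" and S2: "\<zeta> ` (N \<inter> Z) \<inter> T2 = \<zeta> ` (Z \<inter> U1)"
        using NZ T1(2) T2(2) by blast+
      show ?thesis
      proof (rule smooth_on_glue[OF T1(1) T2(1)])
        show "\<zeta> ` (N \<inter> Z) \<subseteq> T1 \<union> T2" using NZ T1(2) T2(2) by blast
        show "\<zeta> ` (N \<inter> Z) \<inter> T1 \<inter> T2 = {}" using S1 S2 d by blast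
        have "smooth_on (\<zeta> ` (Z \<inter> V1)) (\<eta> \<circ> the_inv_into Z \<zeta>)"
          by (rule smooth_on_subset[OF sV(2)]) (use V1(2) in auto)
        then show "smooth_on (\<zeta> ` (N \<inter> Z) \<inter> T1) (\<eta>' \<circ> the_inv_into Z \<zeta>)"
          unfolding S1 by (rule smooth_on_cong) (auto simp: iZ v)
        have "smooth_on (\<zeta> ` (Z \<inter> U1)) (\<psi> \<circ> the_inv_into Z \<zeta>)"
          by (rule smooth_on_subset[OF sU(2)]) (use U1(2) in auto)
        from smooth_on_affine[OF this, of "1 :: real" c]
        show "smooth_on (\<zeta> ` (N \<inter> Z) \<inter> T2) (\<eta>' \<circ> the_inv_into Z \<zeta>)"
          unfolding S2 by (rule smooth_on_cong) (auto simp: iZ u)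
      qed
    qed
    ultimately show ?thesis by (simp add: compatible_def)
  qed
  \<comment> \<open>The new chart is not yet known to belong to \<open>A\<close>, so its
    compatibility with itself is checked separately.\<close>
  have "smooth_on (\<eta>' ` N) (\<eta>' \<circ> the_inv_into N \<eta>')"
    by (rule smooth_on_cong[OF smooth_on_ident]) (use the_inv_into_f_f[OF inj] in auto)
  then have self: "compatible (N, \<eta>') (N, \<eta>')" by (simp add: compatible_def)
  have "smooth_atlas (insert (N, \<eta>') A)"
    unfolding smooth_atlas_def
  proof (intro conjI ballI)
    show "(\<Union>(U, \<psi>)\<in>insert (N, \<eta>') A. U) = UNIV" using sa by (auto simp: smooth_atlas_def)
    show "is_chart k" if "k \<in> insert (N, \<eta>') A" for k
      using that sa ch by (auto simp: smooth_atlas_def)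
    have comp': "compatible (N, \<eta>') k" if "k \<in> A" for k using comp that by (cases k) auto
    show "compatible k l" if "k \<in> insert (N, \<eta>') A" "l \<in> insert (N, \<eta>') A" for k l
    proof (cases "k \<in> A \<and> l \<in> A")
      case True
      then show ?thesis using sa by (simp add: smooth_atlas_def)
    next
      case False
      then show ?thesis using that self comp' compatible_sym by (metis insertE)
    qed
  qed
  then have "insert (N, \<eta>') A = A" using A unfolding maximal_smooth_atlas_def by blast
  then show ?thesis unfolding N_def by blast
qed

text \<open>Makes the value of a knot, a point with finitely many coordinates, lie in the domain of
  a single product chart. The induction joins a chart for \<open>P\<close> with a small one around
  \<open>q\<close>; both are first cut down to disjoint open sets on which the chart values are
  bounded, as \<open>union_chart\<close> demands.\<close>

lemma common_chart:
  assumes A: "maximal_smooth_atlas A" and "finite P"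
  shows "\<exists>V \<eta>. (V, \<eta>) \<in> A \<and> P \<subseteq> V"
  using assms(2)
proof (induction P rule: finite_induct)
  case empty
  have "(\<Union>(U, \<psi>)\<in>A. U) = UNIV" using A by (simp add: maximal_smooth_atlas_def smooth_atlas_def)
  then have "A \<noteq> {}" by auto
  then show ?case by auto
next
  case (insert q P)
  then obtain V \<eta> where V: "(V, \<eta>) \<in> A" "P \<subseteq> V" by blast
  have sa: "smooth_atlas A" using A by (simp add: maximal_smooth_atlas_def)
  then have "(\<Union>(U, \<psi>)\<in>A. U) = UNIV" by (simp add: smooth_atlas_def)
  then obtain U \<psi> where U: "(U, \<psi>) \<in> A" "q \<in> U" by fast
  have chV: "is_chart (V, \<eta>)" and chU: "is_chart (U, \<psi>)" using sa V U by (auto simp: smooth_atlas_def)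
  note cV = is_chartD[OF chV] and cU = is_chartD[OF chU]
  show ?case
  \<comment> \<open>Every chart domain contains the origin, so a new piece is called for only at
    other points; the piece kept around \<open>P\<close> has to retain the origin.\<close>
  proof (cases "q \<in> insert origin P")
    case True
    then have "q \<in> V" using V cV by auto
    then show ?thesis using V by blast
  next
    case False
    then obtain N1 N2 where N: "open N1" "open N2" "insert origin P \<subseteq> N1" "q \<in> N2" "N1 \<inter> N2 = {}"
      using separate_point_finite[of "insert origin P" q] insert(1) by blast
    obtain M where M: "\<forall>x\<in>insert origin P. \<bar>\<eta> x\<bar> < M"
    proof
      show "\<forall>x\<in>insert origin P. \<bar>\<eta> x\<bar> < Max ((\<lambda>x. \<bar>\<eta> x\<bar>) ` insert origin P) + 1"
      proof
        fix x assume "x \<in> insert origin P"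
        then have "\<bar>\<eta> x\<bar> \<le> Max ((\<lambda>x. \<bar>\<eta> x\<bar>) ` insert origin P)"
          using insert(1) by (intro Max_ge) auto
        then show "\<bar>\<eta> x\<bar> < Max ((\<lambda>x. \<bar>\<eta> x\<bar>) ` insert origin P) + 1" by simp
      qed
    qed
    define V1 where "V1 = (V \<inter> \<eta> -` {-M<..<M}) \<inter> N1"
    define U1 where "U1 = (U \<inter> \<psi> -` {-(\<bar>\<psi> q\<bar> + 1)<..<\<bar>\<psi> q\<bar> + 1}) \<inter> N2"
    have PV1: "insert origin P \<subseteq> V1" using M N(3) V(2) cV(2) by (fastforce simp: V1_def abs_less_iff)
    have qU1: "q \<in> U1" using U(2) N(4) by (auto simp: U1_def)
    have "\<exists>\<zeta>. (V1 \<union> U1, \<zeta>) \<in> A"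
    proof (rule union_chart[OF A V(1) U(1)])
      show "open V1" unfolding V1_def
        by (intro open_Int continuous_open_preimage cV N) auto
      show "open U1" unfolding U1_def
        by (intro open_Int continuous_open_preimage cU N) auto
      show "\<bar>\<eta> x\<bar> < M" if "x \<in> V1" for x using that by (auto simp: V1_def)
      show "\<bar>\<psi> x\<bar> < \<bar>\<psi> q\<bar> + 1" if "x \<in> U1" for x using that by (auto simp: U1_def)
    qed (use PV1 N(5) in \<open>auto simp: V1_def U1_def\<close>)
    then show ?thesis using PV1 qU1 by blast
  qed
qed

section \<open>Coordinates on initial segments\<close>

text \<open>A pointwise comparison of increments that composes like a chain rule and, unlike
  smoothness, survives gluing at an end point. It holds trivially at points where \<open>S\<close>
  does not accumulate.\<close>

definition lip_at :: "'a::topological_space set \<Rightarrow> ('a \<Rightarrow> real) \<Rightarrow> ('a \<Rightarrow> real) \<Rightarrow> 'a \<Rightarrow> bool" where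
  "lip_at S h k x \<longleftrightarrow> (\<exists>L\<ge>0. \<forall>\<^sub>F y in at x within S. \<bar>h y - h x\<bar> \<le> L * \<bar>k y - k x\<bar>)"

lemma lip_atI: "0 \<le> L \<Longrightarrow> (\<forall>\<^sub>F y in at x within S. \<bar>h y - h x\<bar> \<le> L * \<bar>k y - k x\<bar>) \<Longrightarrow> lip_at S h k x"
  unfolding lip_at_def by blast

lemma lip_at_trans:
  assumes "lip_at S h k x" "lip_at S k l x"
  shows "lip_at S h l x"
proof -
  obtain L where L: "L \<ge> 0" "\<forall>\<^sub>F y in at x within S. \<bar>h y - h x\<bar> \<le> L * \<bar>k y - k x\<bar>"
    using assms(1) unfolding lip_at_def by blast
  obtain K where K: "K \<ge> 0" "\<forall>\<^sub>F y in at x within S. \<bar>k y - k x\<bar> \<le> K * \<bar>l y - l x\<bar>"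
    using assms(2) unfolding lip_at_def by blast
  have "\<forall>\<^sub>F y in at x within S. \<bar>h y - h x\<bar> \<le> (L * K) * \<bar>l y - l x\<bar>"
    using L(2) K(2)
  proof eventually_elim
    case (elim y)
    have "L * \<bar>k y - k x\<bar> \<le> L * (K * \<bar>l y - l x\<bar>)" using elim(2) L(1) by (rule mult_left_mono)
    then show ?case using elim(1) by simp
  qed
  then show ?thesis using L(1) K(1) by (intro lip_atI[of "L * K"]) simp_all
qed

lemma lip_at_subset: "lip_at S h k x \<Longrightarrow> T \<subseteq> S \<Longrightarrow> lip_at T h k x"
  unfolding lip_at_def by (meson at_le filter_leD)

lemma lip_at_Un:
  assumes "lip_at S h k x" "lip_at T h k x"
  shows "lip_at (S \<union> T) h k x"
proof -
  obtain L where L: "L \<ge> 0" "\<forall>\<^sub>F y in at x within S. \<bar>h y - h x\<bar> \<le> L * \<bar>k y - k x\<bar>"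
    using assms(1) unfolding lip_at_def by blast
  obtain K where K: "K \<ge> 0" "\<forall>\<^sub>F y in at x within T. \<bar>h y - h x\<bar> \<le> K * \<bar>k y - k x\<bar>"
    using assms(2) unfolding lip_at_def by blast
  have mono: "a \<le> max L K * \<bar>k y - k x\<bar>" if "a \<le> L * \<bar>k y - k x\<bar> \<or> a \<le> K * \<bar>k y - k x\<bar>" for a y
    using that mult_right_mono[of L "max L K" "\<bar>k y - k x\<bar>"] mult_right_mono[of K "max L K" "\<bar>k y - k x\<bar>"]
    by auto
  have "\<forall>\<^sub>F y in at x within S. \<bar>h y - h x\<bar> \<le> max L K * \<bar>k y - k x\<bar>"
    using L(2) by eventually_elim (rule mono, blast)
  moreover have "\<forall>\<^sub>F y in at x within T. \<bar>h y - h x\<bar> \<le> max L K * \<bar>k y - k x\<bar>"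
    using K(2) by eventually_elim (rule mono, blast)
  ultimately show ?thesis using L(1)
    by (intro lip_atI[of "max L K"]) (simp_all add: at_within_union eventually_sup)
qed

lemma lip_at_outside:
  assumes "closed S" "x \<notin> S"
  shows "lip_at S h k x"
proof -
  have "\<forall>\<^sub>F y in at x within S. False"
    unfolding eventually_at_topological using assms by (intro exI[of _ "- S"]) auto
  then have "\<forall>\<^sub>F y in at x within S. \<bar>h y - h x\<bar> \<le> 0 * \<bar>k y - k x\<bar>" by (rule eventually_mono) simp
  then show ?thesis by (rule lip_atI[rotated]) simp
qed

lemma lip_at_abs_eq:
  assumes "\<And>y. y \<in> S \<Longrightarrow> \<bar>h y - h x\<bar> = \<bar>k y - k x\<bar>"
  shows "lip_at S h k x" "lip_at S k h x"
proof -
  have "\<forall>\<^sub>F y in at x within S. y \<in> S" by (simp add: eventually_at_filter)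
  then have "\<forall>\<^sub>F y in at x within S. \<bar>h y - h x\<bar> \<le> 1 * \<bar>k y - k x\<bar>"
    "\<forall>\<^sub>F y in at x within S. \<bar>k y - k x\<bar> \<le> 1 * \<bar>h y - h x\<bar>"
    by (auto elim!: eventually_mono simp: assms)
  then show "lip_at S h k x" "lip_at S k h x" by (auto intro: lip_atI[of 1])
qed

lemma lip_at_cong:
  assumes "lip_at S h k x" "\<And>y. y \<in> S \<Longrightarrow> h' y = h y" "x \<in> S"
  shows "lip_at S h' k x"
  by (rule lip_at_trans[OF lip_at_abs_eq(1) assms(1)]) (use assms in simp)

lemma lip_at_cong2:
  assumes "lip_at S k h x" "\<And>y. y \<in> S \<Longrightarrow> h' y = h y" "x \<in> S"
  shows "lip_at S k h' x"
  by (rule lip_at_trans[OF assms(1) lip_at_abs_eq(1)]) (use assms in simp)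

lemma lip_at_tendsto:
  assumes "lip_at S h k x" "(k \<longlongrightarrow> k x) (at x within S)"
  shows "(h \<longlongrightarrow> h x) (at x within S)"
proof -
  obtain L where L: "L \<ge> 0" "\<forall>\<^sub>F y in at x within S. \<bar>h y - h x\<bar> \<le> L * \<bar>k y - k x\<bar>"
    using assms(1) unfolding lip_at_def by blast
  have "((\<lambda>y. k y - k x) \<longlongrightarrow> 0) (at x within S)" using assms(2) LIM_zero_iff by blast
  then have "((\<lambda>y. L * \<bar>k y - k x\<bar>) \<longlongrightarrow> 0) (at x within S)"
    by (intro tendsto_mult_right_zero tendsto_rabs_zero)
  then have "((\<lambda>y. h y - h x) \<longlongrightarrow> 0) (at x within S)"
    by (rule Lim_null_comparison[rotated]) (use L(2) in simp)
  then show ?thesis by (rule LIM_zero_cancel)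
qed

lemma has_vector_derivative_lipschitz:
  assumes "(g has_vector_derivative D) (at a within S)"
  shows "\<exists>L\<ge>0. \<forall>\<^sub>F s in at a within S. norm (g s - g a) \<le> L * \<bar>s - a\<bar>"
proof -
  have "\<forall>\<^sub>F s in at a within S. norm (g s - g a - (s - a) *\<^sub>R D) \<le> 1 * norm (s - a)"
    using assms unfolding has_vector_derivative_def has_derivative_within_alt2 by (meson zero_less_one)
  then have "\<forall>\<^sub>F s in at a within S. norm (g s - g a) \<le> (1 + norm D) * \<bar>s - a\<bar>"
  proof eventually_elim
    case (elim s)
    have "norm (g s - g a) \<le> norm (g s - g a - (s - a) *\<^sub>R D) + norm ((s - a) *\<^sub>R D)"
      by (metis diff_add_cancel norm_triangle_ineq)
    moreover have "norm ((s - a) *\<^sub>R D) = norm D * \<bar>s - a\<bar>" by simp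
    moreover have "norm (g s - g a - (s - a) *\<^sub>R D) \<le> \<bar>s - a\<bar>" using elim by simp
    ultimately have "norm (g s - g a) \<le> \<bar>s - a\<bar> + norm D * \<bar>s - a\<bar>" by linarith
    then show ?case by (simp add: algebra_simps)
  qed
  then show ?thesis by (intro exI[of _ "1 + norm D"]) simp
qed

section \<open>Coordinates assembled from charts\<close>

lemma atlas_chart: "maximal_smooth_atlas A \<Longrightarrow> c \<in> A \<Longrightarrow> is_chart c"
  by (auto simp: maximal_smooth_atlas_def smooth_atlas_def)

text \<open>For substituting a chart into a limit or an eventual estimate at
  \<open>\<psi> x\<close>; injectivity keeps \<open>\<psi> y\<close> different from
  \<open>\<psi> x\<close>, as the punctured filter requires.\<close>

lemma filterlim_chart:
  assumes ch: "is_chart (U, \<psi>)" and W: "open W" "W \<subseteq> U" "x \<in> W"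
  shows "filterlim \<psi> (at (\<psi> x) within \<psi> ` W) (at x)"
proof -
  note c = is_chartD[OF ch]
  have "isCont \<psi> x" using c(1,4) W continuous_on_eq_continuous_at by blast
  then have t: "(\<psi> \<longlongrightarrow> \<psi> x) (at x)" by (simp add: isCont_def)
  have "\<forall>\<^sub>F y in at x. y \<in> W" using W by (intro eventually_at_in_open') auto
  moreover have "\<forall>\<^sub>F y in at x. y \<noteq> x" by (simp add: eventually_at_filter)
  ultimately have "\<forall>\<^sub>F y in at x. \<psi> y \<in> \<psi> ` W \<and> \<psi> y \<noteq> \<psi> x"
  proof eventually_elim
    case (elim y)
    then show ?case using inj_onD[OF c(3), of y x] W by blast
  qed
  then show ?thesis using t by (simp add: filterlim_at)
qed

text \<open>The transition map between the charts is differentiable at \<open>\<psi> x\<close>,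
  hence Lipschitz at that point, and the estimate is pulled back along
  \<open>\<psi>\<close>.\<close>

lemma chart_lip_at:
  assumes A: "maximal_smooth_atlas A" and U: "(U, \<psi>) \<in> A" and V: "(V, \<eta>) \<in> A"
    and x: "x \<in> U" "x \<in> V"
  shows "lip_at S \<eta> \<psi> x"
proof -
  have chU: "is_chart (U, \<psi>)" and chV: "is_chart (V, \<eta>)" using atlas_chart[OF A] U V by auto
  note cU = is_chartD[OF chU] and cV = is_chartD[OF chV]
  have "compatible (U, \<psi>) (V, \<eta>)" using A U V by (auto simp: maximal_smooth_atlas_def smooth_atlas_def)
  then have "smooth_on (\<psi> ` (U \<inter> V)) (\<eta> \<circ> the_inv_into U \<psi>)" by (auto simp: compatible_def)
  then obtain D where D: "D 0 = \<eta> \<circ> the_inv_into U \<psi>"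
    "\<forall>k. \<forall>s\<in>\<psi> ` (U \<inter> V). (D k has_vector_derivative D (Suc k) s) (at s within \<psi> ` (U \<inter> V))"
    unfolding smooth_on_def by blast
  have "(\<eta> \<circ> the_inv_into U \<psi> has_vector_derivative D (Suc 0) (\<psi> x)) (at (\<psi> x) within \<psi> ` (U \<inter> V))"
    using D(2)[rule_format, of "\<psi> x" 0] D(1) x by simp
  from has_vector_derivative_lipschitz[OF this] obtain L where L: "L \<ge> 0"
    "\<forall>\<^sub>F s in at (\<psi> x) within \<psi> ` (U \<inter> V).
       norm ((\<eta> \<circ> the_inv_into U \<psi>) s - (\<eta> \<circ> the_inv_into U \<psi>) (\<psi> x)) \<le> L * \<bar>s - \<psi> x\<bar>"
    by blast
  have "filterlim \<psi> (at (\<psi> x) within \<psi> ` (U \<inter> V)) (at x)"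
    by (rule filterlim_chart[OF chU]) (use cU(1) cV(1) x in auto)
  from eventually_compose_filterlim[OF L(2) this]
  have "\<forall>\<^sub>F y in at x. norm ((\<eta> \<circ> the_inv_into U \<psi>) (\<psi> y) - (\<eta> \<circ> the_inv_into U \<psi>) (\<psi> x)) \<le> L * \<bar>\<psi> y - \<psi> x\<bar>" .
  moreover have "\<forall>\<^sub>F y in at x. y \<in> U" using cU(1) x by (intro eventually_at_in_open') auto
  ultimately have "\<forall>\<^sub>F y in at x. \<bar>\<eta> y - \<eta> x\<bar> \<le> L * \<bar>\<psi> y - \<psi> x\<bar>"
    by eventually_elim (simp add: the_inv_into_f_f[OF cU(3)] x)
  then have "lip_at UNIV \<eta> \<psi> x" using L(1) by (rule lip_atI[rotated])
  then show ?thesis by (rule lip_at_subset) simp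
qed

text \<open>A continuous injection on an interval is monotone in one direction or the other. The
  distance from the value at \<open>a\<close> is therefore an increasing coordinate with increments
  of the same size, whatever the orientation of the chart.\<close>

lemma injective_interval_additive:
  fixes \<psi> :: "'a::linear_continuum_topology \<Rightarrow> real"
  assumes "continuous_on {a..b} \<psi>" "inj_on \<psi> {a..b}" "a \<le> x" "x < y" "y \<le> b"
  shows "\<bar>\<psi> y - \<psi> a\<bar> - \<bar>\<psi> x - \<psi> a\<bar> = \<bar>\<psi> y - \<psi> x\<bar>" "\<bar>\<psi> y - \<psi> x\<bar> > 0"
proof -
  have "x \<in> {a..b}" "y \<in> {a..b}" using assms by auto
  then have ne: "\<psi> x \<noteq> \<psi> y" using inj_onD[OF assms(2)] assms(4) by blast
  then show "\<bar>\<psi> y - \<psi> x\<bar> > 0" by simp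
  show "\<bar>\<psi> y - \<psi> a\<bar> - \<bar>\<psi> x - \<psi> a\<bar> = \<bar>\<psi> y - \<psi> x\<bar>"
  proof (cases "a = x")
    case False
    then have "a < x" using assms by simp
    have "continuous_on {a..y} \<psi>" by (rule continuous_on_subset[OF assms(1)]) (use assms in auto)
    moreover have "inj_on \<psi> {a..y}" by (rule inj_on_subset[OF assms(2)]) (use assms in auto)
    ultimately show ?thesis
      using continuous_inj_imp_mono[OF \<open>a < x\<close> assms(4), of \<psi>] by auto
  qed simp
qed

text \<open>An increasing real coordinate on \<open>S\<close> that is bi-Lipschitz comparable, point
  by point, with the charts. Differentiability is not demanded, so that it can be continued from
  chart to chart.\<close>

definition chart_coordinate :: "chart set \<Rightarrow> long_ray set \<Rightarrow> (long_ray \<Rightarrow> real) \<Rightarrow> bool" where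
  "chart_coordinate A S h \<longleftrightarrow> strict_mono_on S h \<and>
     (\<forall>U \<psi> x. (U, \<psi>) \<in> A \<longrightarrow> x \<in> U \<longrightarrow> x \<in> S \<longrightarrow> lip_at S h \<psi> x \<and> lip_at S \<psi> h x)"

lemma chart_coordinate_extend:
  assumes A: "maximal_smooth_atlas A" and h: "chart_coordinate A {..a} h"
    and U: "(U, \<psi>) \<in> A" and ab: "a \<le> b" "{a..b} \<subseteq> U"
  shows "\<exists>h'. chart_coordinate A {..b} h'"
proof -
  have chU: "is_chart (U, \<psi>)" using atlas_chart[OF A U] .
  note cU = is_chartD[OF chU]
  define h' where "h' y = (if y \<le> a then h y else h a + \<bar>\<psi> y - \<psi> a\<bar>)" for y
  have h'lo: "h' y = h y" if "y \<le> a" for y using that by (simp add: h'_def)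
  have h'hi: "h' y = h a + \<bar>\<psi> y - \<psi> a\<bar>" if "a \<le> y" for y
    using that by (cases "y = a") (auto simp: h'_def)
  have cont: "continuous_on {a..b} \<psi>" and inj: "inj_on \<psi> {a..b}"
    using continuous_on_subset[OF cU(4) ab(2)] inj_on_subset[OF cU(3) ab(2)] by auto
  have step: "h' y - h' x = \<bar>\<psi> y - \<psi> x\<bar>" "h' x < h' y" if "a \<le> x" "x < y" "y \<le> b" for x y
  proof -
    have "a \<le> y" using that by simp
    then show "h' y - h' x = \<bar>\<psi> y - \<psi> x\<bar>"
      using injective_interval_additive(1)[OF cont inj that] that by (simp add: h'hi)
    then show "h' x < h' y" using injective_interval_additive(2)[OF cont inj that] by linarith
  qed
  have eq: "\<bar>h' y - h' x\<bar> = \<bar>\<psi> y - \<psi> x\<bar>" if "x \<in> {a..b}" "y \<in> {a..b}" for x y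
    using that step(1)[of x y] step(1)[of y x] by (cases x y rule: linorder_cases) auto
  have hmono: "strict_mono_on {..a} h" using h by (simp add: chart_coordinate_def)
  have "h' x < h' y" if "x < y" "y \<le> b" for x y
  proof -
    consider "y \<le> a" | "x \<le> a" "a < y" | "a < x" by (meson not_le)
    then show ?thesis
    proof cases
      case 1
      then show ?thesis using that strict_mono_onD[OF hmono, of x y] by (simp add: h'lo)
    next
      case 2
      have "h x \<le> h a" using 2 strict_mono_onD[OF hmono, of x a] by (cases "x = a") (auto simp: less_imp_le)
      moreover have "h' a < h' y" using 2 that by (intro step(2)) auto
      ultimately show ?thesis using 2 by (simp add: h'lo)
    next
      case 3
      then show ?thesis using that by (intro step(2)) auto
    qed
  qed
  then have mono: "strict_mono_on {..b} h'" by (intro strict_mono_onI) auto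
  \<comment> \<open>At the joint \<open>a\<close> both one-sided comparisons are available and
    combine; at any other point one of them is vacuous.\<close>
  have un: "{..b} = {..a} \<union> {a..b}" using ab(1) by auto
  have "lip_at {..b} h' \<eta> x \<and> lip_at {..b} \<eta> h' x" if V: "(V, \<eta>) \<in> A" "x \<in> V" "x \<le> b" for V \<eta> x
  proof -
    have lo: "lip_at {..a} h' \<eta> x \<and> lip_at {..a} \<eta> h' x"
    proof (cases "x \<le> a")
      case True
      have "lip_at {..a} h \<eta> x" "lip_at {..a} \<eta> h x"
        using h V(1,2) True unfolding chart_coordinate_def by auto
      then show ?thesis
        using lip_at_cong[of "{..a}" h \<eta> x h'] lip_at_cong2[of "{..a}" \<eta> h x h'] h'lo True by simp
    next
      case False
      then show ?thesis by (simp add: lip_at_outside)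
    qed
    have hi: "lip_at {a..b} h' \<eta> x \<and> lip_at {a..b} \<eta> h' x"
    proof (cases "a \<le> x")
      case True
      then have xab: "x \<in> {a..b}" "x \<in> U" using V(3) ab(2) by auto
      have "lip_at {a..b} h' \<psi> x" "lip_at {a..b} \<psi> h' x"
        by (rule lip_at_abs_eq, rule eq[OF xab(1)], assumption)+
      then show ?thesis
        using lip_at_trans[OF _ chart_lip_at[OF A V(1) U V(2) xab(2)]]
          lip_at_trans[OF chart_lip_at[OF A U V(1) xab(2) V(2)]] by simp
    next
      case False
      then show ?thesis by (simp add: lip_at_outside)
    qed
    show ?thesis unfolding un using lo hi by (simp add: lip_at_Un)
  qed
  then show ?thesis using mono unfolding chart_coordinate_def by auto
qed

text \<open>Let \<open>s\<close> be the infimum of the end points without a coordinate. A chart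
  around \<open>s\<close> contains a segment from some good \<open>a \<le> s\<close> to beyond
  \<open>s\<close>, and continuing the coordinate through it makes all points below some
  \<open>u > s\<close> good.\<close>

lemma chart_coordinate_exists:
  assumes A: "maximal_smooth_atlas A"
  shows "\<exists>h. chart_coordinate A {..b} h"
proof (rule ccontr)
  define G where "G = {b. \<exists>h. chart_coordinate A {..b} h}"
  assume "\<nexists>h. chart_coordinate A {..b} h"
  then have ne: "- G \<noteq> {}" by (auto simp: G_def)
  have bdd: "bdd_below (- G)" by (rule bdd_belowI[of _ origin]) (rule origin_le)
  define s where "s = Inf (- G)"
  have below: "y \<in> G" if "y < s" for y
    using that cInf_lower[OF _ bdd, of y] unfolding s_def by (meson ComplI not_le)
  \<comment> \<open>On a single point any function serves, as all increments vanish.\<close>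
  have o: "origin \<in> G"
  proof -
    have e: "{..origin} = {origin}" using origin_le by (auto intro: antisym)
    have "chart_coordinate A {..origin} (\<lambda>_. 0)"
      unfolding e chart_coordinate_def
      by (intro conjI allI impI lip_at_abs_eq(1)) (auto simp: strict_mono_on_def)
    then show ?thesis by (auto simp: G_def)
  qed
  obtain U \<psi> where U: "(U, \<psi>) \<in> A" "s \<in> U" using common_chart[OF A, of "{s}"] by auto
  have opU: "open U" using is_chartD(1)[OF atlas_chart[OF A U(1)]] .
  obtain s' where "s < s'" using gt_ex by blast
  then obtain u where u: "s < u" "{s..<u} \<subseteq> U" using open_right[OF opU U(2)] by blast
  obtain a where a: "a \<in> G" "a \<le> s" "{a..s} \<subseteq> U"
  proof (cases "s = origin")
    case True
    then show ?thesis using that[of origin] o U(2) by simp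
  next
    case False
    then have "origin < s" using origin_le[of s] by simp
    then obtain l where l: "l < s" "{l<..s} \<subseteq> U" using open_left[OF opU U(2)] by blast
    obtain a where "l < a" "a < s" using dense[OF l(1)] by blast
    then have "{a..s} \<subseteq> {l<..s}" by auto
    then show ?thesis using that[of a] below[OF \<open>a < s\<close>] \<open>a < s\<close> l(2) by simp
  qed
  have "c \<in> G" if "c < u" for c
  proof (cases "a \<le> c")
    case True
    have "{a..c} \<subseteq> {a..s} \<union> {s..<u}" using that by auto
    then have "{a..c} \<subseteq> U" using a(3) u(2) by blast
    moreover obtain h where "chart_coordinate A {..a} h" using a(1) by (auto simp: G_def)
    ultimately show ?thesis using chart_coordinate_extend[OF A _ U(1) True] by (auto simp: G_def)
  next
    case False
    then show ?thesis using below[of c] a(2) by simp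
  qed
  then have "u \<le> x" if "x \<in> - G" for x using that by (meson ComplD not_le)
  then have "u \<le> s" unfolding s_def using ne by (intro cInf_greatest)
  then show False using u(1) by simp
qed

lemma chart_coordinate_continuous:
  assumes A: "maximal_smooth_atlas A" and h: "chart_coordinate A S h"
  shows "continuous_on S h"
  unfolding continuous_on_def
proof
  fix x assume x: "x \<in> S"
  obtain U \<psi> where U: "(U, \<psi>) \<in> A" "x \<in> U" using common_chart[OF A, of "{x}"] by auto
  note cU = is_chartD[OF atlas_chart[OF A U(1)]]
  have "isCont \<psi> x" using cU(1,4) U(2) continuous_on_eq_continuous_at by blast
  then have "(\<psi> \<longlongrightarrow> \<psi> x) (at x within S)" using continuous_within_subset[of x UNIV \<psi> S]
    by (simp add: continuous_within)
  moreover have "lip_at S h \<psi> x" using h U x by (auto simp: chart_coordinate_def)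
  ultimately show "(h \<longlongrightarrow> h x) (at x within S)" using lip_at_tendsto by blast
qed

text \<open>The reciprocal of the distance to the value at \<open>b\<close> stretches the segment
  from \<open>origin\<close> to \<open>b\<close> over a closed half-line; the collar will supply the
  other half. The reciprocal remains comparable with \<open>h\<close>, since \<open>H - h\<close> is
  bounded by its value at \<open>origin\<close> and, near each point, bounded away from 0.\<close>

lemma unbounded_chart_coordinate:
  assumes A: "maximal_smooth_atlas A" and b: "origin < b"
  obtains k where "chart_coordinate A {..<b} k" "k ` {..<b} = {k origin..}"
proof -
  obtain h where h: "chart_coordinate A {..b} h" using chart_coordinate_exists[OF A] by blast
  have hmono: "strict_mono_on {..b} h" using h by (simp add: chart_coordinate_def)
  have hc: "continuous_on {..b} h" by (rule chart_coordinate_continuous[OF A h])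
  define H where "H = h b"
  define k where "k x = 1 / (H - h x)" for x
  have hless: "h x < h y" if "x < y" "y \<le> b" for x y using strict_mono_onD[OF hmono, of x y] that by auto
  have pos: "H - h x > 0" if "x < b" for x using hless[of x b] that by (simp add: H_def)
  have kmono: "strict_mono_on {..<b} k"
  proof (rule strict_mono_onI)
    fix x y assume "x \<in> {..<b}" "y \<in> {..<b}" "x < y"
    then show "k x < k y" using pos[of x] pos[of y] hless[of x y] by (auto simp: k_def intro!: divide_strict_left_mono)
  qed
  have diff: "\<bar>k y - k x\<bar> = \<bar>h y - h x\<bar> / ((H - h y) * (H - h x))" if "x < b" "y < b" for x y
  proof -
    have "k y - k x = (h y - h x) / ((H - h y) * (H - h x))"
      using pos[OF that(1)] pos[OF that(2)] by (simp add: k_def field_simps)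
    then show ?thesis using pos[OF that(1)] pos[OF that(2)] by (simp add: abs_mult)
  qed
  have kh: "lip_at {..<b} k h x \<and> lip_at {..<b} h k x" if xb: "x < b" for x
  proof
    \<comment> \<open>Points near \<open>x\<close> lie below \<open>m\<close>, where
      \<open>H - h\<close> is at least the positive number \<open>H - h m\<close>.\<close>
    obtain m where m: "x < m" "m < b" using dense[OF xb] by blast
    have in': "\<forall>\<^sub>F y in at x within {..<b}. y < m \<and> y < b"
      unfolding eventually_at_topological using m by (intro exI[of _ "{..<m}"]) auto
    show "lip_at {..<b} k h x"
    proof (rule lip_atI)
      show "0 \<le> 1 / ((H - h m) * (H - h m))" using pos[OF m(2)] by simp
      show "\<forall>\<^sub>F y in at x within {..<b}. \<bar>k y - k x\<bar> \<le> 1 / ((H - h m) * (H - h m)) * \<bar>h y - h x\<bar>"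
        using in'
      proof eventually_elim
        case (elim y)
        have "H - h m \<le> H - h y" "H - h m \<le> H - h x" using hless[of y m] hless[of x m] elim m by (auto simp: less_imp_le)
        then have le: "(H - h m) * (H - h m) \<le> (H - h y) * (H - h x)"
          using pos[OF m(2)] by (intro mult_mono) auto
        have "y < b" using elim by blast
        then have prod_pos: "0 < (H - h y) * (H - h x) * ((H - h m) * (H - h m))"
          by (intro mult_pos_pos pos xb m(2))
        have "\<bar>h y - h x\<bar> / ((H - h y) * (H - h x)) \<le> \<bar>h y - h x\<bar> / ((H - h m) * (H - h m))"
          using divide_left_mono[OF le abs_ge_zero prod_pos] .
        then show ?case using diff[of x y] elim xb by simp
      qed
    qed
    show "lip_at {..<b} h k x"
    proof (rule lip_atI)
      show "0 \<le> (H - h origin) * (H - h origin)" by simp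
      show "\<forall>\<^sub>F y in at x within {..<b}. \<bar>h y - h x\<bar> \<le> (H - h origin) * (H - h origin) * \<bar>k y - k x\<bar>"
        using in'
      proof eventually_elim
        case (elim y)
        have le: "h origin \<le> h z" if "z < b" for z
          using that hless[of origin z] origin_le[of z] by (cases "z = origin") (auto simp: less_imp_le)
        have p: "H - h y > 0" "H - h x > 0" using pos elim xb by auto
        have "(H - h y) * (H - h x) \<le> (H - h origin) * (H - h origin)"
          using le[of y] le[of x] elim xb p by (intro mult_mono) auto
        then have "(H - h y) * (H - h x) * \<bar>k y - k x\<bar> \<le> (H - h origin) * (H - h origin) * \<bar>k y - k x\<bar>"
          by (rule mult_right_mono) simp
        moreover have "(H - h y) * (H - h x) * \<bar>k y - k x\<bar> = \<bar>h y - h x\<bar>"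
          using diff[of x y] elim xb p by simp
        ultimately show ?case by simp
      qed
    qed
  qed
  have "lip_at {..<b} k \<psi> x \<and> lip_at {..<b} \<psi> k x" if U: "(U, \<psi>) \<in> A" "x \<in> U" "x \<in> {..<b}" for U \<psi> x
  proof -
    have lb: "{..<b} \<subseteq> {..b}" by auto
    have "lip_at {..b} h \<psi> x \<and> lip_at {..b} \<psi> h x"
      using h U unfolding chart_coordinate_def by auto
    then have "lip_at {..<b} h \<psi> x \<and> lip_at {..<b} \<psi> h x"
      using lip_at_subset[OF _ lb, of h \<psi> x] lip_at_subset[OF _ lb, of \<psi> h x] by blast
    moreover have "lip_at {..<b} k h x \<and> lip_at {..<b} h k x" using kh U(3) by simp
    ultimately show ?thesis by (meson lip_at_trans)
  qed
  then have 1: "chart_coordinate A {..<b} k" using kmono by (simp add: chart_coordinate_def)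
  have 2: "k ` {..<b} = {k origin..}"
  proof (intro equalityI subsetI)
    fix v assume "v \<in> k ` {..<b}"
    then obtain x where x: "v = k x" "x < b" by auto
    then show "v \<in> {k origin..}"
      using strict_mono_onD[OF kmono, of origin x] origin_le[of x] b by (cases "x = origin") (auto simp: less_imp_le)
  next
    fix v assume v: "v \<in> {k origin..}"
    have k0: "k origin > 0" using pos[OF b] by (simp add: k_def)
    then have v0: "v > 0" using v by auto
    have "1 / v \<le> 1 / k origin" using v k0 by (simp add: frac_le)
    then have "h origin \<le> H - 1 / v" using pos[OF b] by (simp add: k_def)
    moreover have "H - 1 / v \<le> h b" using v0 by (simp add: H_def)
    moreover have "continuous_on {origin..b} h" by (rule continuous_on_subset[OF hc]) auto
    ultimately obtain x where x: "x \<le> b" "h x = H - 1 / v" using IVT'[of h origin "H - 1 / v" b] origin_le[of b] by blast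
    have "x \<noteq> b" using x v0 by (auto simp: H_def)
    then have "x < b" using x by simp
    moreover have "k x = v" using x v0 by (simp add: k_def)
    ultimately show "v \<in> k ` {..<b}" by auto
  qed
  show ?thesis by (rule that[OF 1 2])
qed

section \<open>Straightening arcs in Euclidean space\<close>

text \<open>Injectivity is all that has to be checked for the stages: with compact support it
  already makes them homeomorphisms.\<close>

definition compact_isotopy :: "(real \<Rightarrow> 'a::euclidean_space \<Rightarrow> 'a) \<Rightarrow> bool" where
  "compact_isotopy \<phi> \<longleftrightarrow>
     continuous_on (UNIV \<times> {0..1}) (\<lambda>(y, t). \<phi> t y) \<and>
     (\<forall>t\<in>{0..1}. inj (\<phi> t)) \<and> \<phi> 0 = id \<and>
     (\<exists>K. compact K \<and> (\<forall>t\<in>{0..1}. \<forall>y. y \<notin> K \<longrightarrow> \<phi> t y = y))"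

lemma compact_isotopy_continuous:
  assumes "compact_isotopy \<phi>" "t \<in> {0..1}"
  shows "continuous_on UNIV (\<phi> t)"
proof -
  have "continuous_on UNIV ((\<lambda>(y, t). \<phi> t y) \<circ> (\<lambda>y. (y, t)))"
    using assms unfolding compact_isotopy_def
    by (intro continuous_on_compose) (auto intro!: continuous_intros elim!: continuous_on_subset)
  then show ?thesis by (simp add: comp_def)
qed

text \<open>The range is open by invariance of domain, and closed as the union of a compact image
  and the complement of an open ball; by connectedness it is the whole space.\<close>

lemma compact_isotopy_homeomorphism:
  fixes \<phi> :: "real \<Rightarrow> 'a::euclidean_space \<Rightarrow> 'a"
  assumes "compact_isotopy \<phi>" "t \<in> {0..1}"
  shows "\<exists>g. homeomorphism UNIV UNIV (\<phi> t) g"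
proof -
  have cont: "continuous_on UNIV (\<phi> t)" by (rule compact_isotopy_continuous[OF assms])
  have inj: "inj (\<phi> t)" using assms by (auto simp: compact_isotopy_def)
  obtain K where K: "compact K" "\<And>y. y \<notin> K \<Longrightarrow> \<phi> t y = y"
    using assms unfolding compact_isotopy_def by blast
  obtain r where r: "K \<subseteq> ball 0 r" using bounded_subset_ballD[OF compact_imp_bounded[OF K(1)]] by blast
  have "range (\<phi> t) = \<phi> t ` cball 0 r \<union> - ball 0 r"
  proof -
    have *: "\<phi> t y = y" if "y \<notin> ball 0 r" for y using that r K by blast
    then have "\<phi> t y \<in> \<phi> t ` cball 0 r \<union> - ball 0 r" for y by (cases "y \<in> ball 0 r") auto
    moreover have "- ball 0 r \<subseteq> range (\<phi> t)" using * by (metis ComplD rangeI subsetI)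
    ultimately show ?thesis by blast
  qed
  moreover have "closed (\<phi> t ` cball 0 r)"
    by (intro compact_imp_closed compact_continuous_image continuous_on_subset[OF cont]) auto
  ultimately have "closed (range (\<phi> t))" by (simp add: closed_Un closed_Compl)
  moreover have "open (range (\<phi> t))" by (rule invariance_of_domain[OF cont]) (use inj in auto)
  ultimately have "range (\<phi> t) = UNIV" using clopen by blast
  then show ?thesis
    using invariance_of_domain_homeomorphism[of UNIV "\<phi> t"] cont inj by (metis open_UNIV order_refl)
qed

lemma compact_isotopy_comp:
  assumes \<phi>: "compact_isotopy \<phi>" and \<psi>: "compact_isotopy \<psi>"
  shows "compact_isotopy (\<lambda>t. \<psi> t \<circ> \<phi> t)"
proof -
  have "continuous_on (UNIV \<times> {0..1}) ((\<lambda>(y, t). \<psi> t y) \<circ> (\<lambda>z. ((\<lambda>(y, t). \<phi> t y) z, snd z)))"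
    using assms unfolding compact_isotopy_def
    by (intro continuous_on_compose continuous_on_Pair continuous_on_snd continuous_on_id)
       (auto elim!: continuous_on_subset)
  then have "continuous_on (UNIV \<times> {0..1}) (\<lambda>(y, t). (\<psi> t \<circ> \<phi> t) y)"
    by (simp add: comp_def case_prod_unfold)
  moreover obtain K L where "compact K" "\<forall>t\<in>{0..1}. \<forall>y. y \<notin> K \<longrightarrow> \<phi> t y = y"
    "compact L" "\<forall>t\<in>{0..1}. \<forall>y. y \<notin> L \<longrightarrow> \<psi> t y = y"
    using assms unfolding compact_isotopy_def by blast
  then have "\<exists>K. compact K \<and> (\<forall>t\<in>{0..1}. \<forall>y. y \<notin> K \<longrightarrow> (\<psi> t \<circ> \<phi> t) y = y)"
    by (intro exI[of _ "K \<union> L"]) auto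
  ultimately show ?thesis
    using assms unfolding compact_isotopy_def by (auto intro: inj_compose)
qed

text \<open>A displacement that depends only on a quantity \<open>Q\<close> which it preserves stays injective when
  it is cut off by a function whose Lipschitz constant is small compared with the displacement.\<close>

lemma shear_isotopy:
  fixes Q :: "'a::euclidean_space \<Rightarrow> 'b::euclidean_space" and G :: "'b \<Rightarrow> 'a"
  assumes Q: "bounded_linear Q" and G: "continuous_on UNIV G" and M: "\<And>z. norm (G z) \<le> M"
    and QG: "\<And>z. Q (G z) = 0"
  obtains \<phi> where "compact_isotopy \<phi>" "\<And>x. norm x \<le> R \<Longrightarrow> \<phi> 1 x = x + G (Q x)"
    "\<And>t x. G (Q x) = 0 \<Longrightarrow> \<phi> t x = x"
proof -
  have M0: "0 \<le> M" using M[of 0] norm_ge_zero order_trans by blast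
  \<comment> \<open>Equal to 1 on the ball of radius \<open>R\<close> and to 0 from radius
    \<open>R + M + 1\<close> on. The slope \<open>1 / (M + 1)\<close> times the displacement bound
    \<open>M\<close> is below 1, which is what injectivity rests on.\<close>
  define cut where "cut x = max 0 (min 1 ((R + M + 1 - norm x) / (M + 1)))" for x :: 'a
  define \<phi> where "\<phi> t x = x + (t * cut x) *\<^sub>R G (Q x)" for t x
  have cQ: "continuous_on S Q" for S by (rule linear_continuous_on[OF Q])
  have lip: "\<bar>cut x - cut y\<bar> \<le> norm (x - y) / (M + 1)" for x y
  proof -
    have "\<bar>cut x - cut y\<bar> \<le> \<bar>(R + M + 1 - norm x) / (M + 1) - (R + M + 1 - norm y) / (M + 1)\<bar>"
      unfolding cut_def by linarith
    also have "\<dots> = \<bar>norm x - norm y\<bar> / (M + 1)"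
      using M0 by (simp add: diff_divide_distrib[symmetric] abs_minus_commute)
    also have "\<dots> \<le> norm (x - y) / (M + 1)"
      using M0 by (intro divide_right_mono norm_triangle_ineq3) auto
    finally show ?thesis .
  qed
  have inj: "inj (\<phi> t)" if t: "t \<in> {0..1}" for t
  proof (rule injI)
    fix x y assume eq: "\<phi> t x = \<phi> t y"
    \<comment> \<open>\<open>Q\<close> annihilates the displacement, so points with equal images
      have equal \<open>Q\<close> and hence the same vector \<open>G (Q x)\<close>; their
      displacements can differ only through the cut-off.\<close>
    have "Q (\<phi> t x) = Q x" for x
      by (simp add: \<phi>_def linear_simps[OF Q] QG)
    then have Qxy: "Q x = Q y" using eq by metis
    have "x - y = (t * (cut y - cut x)) *\<^sub>R G (Q x)"
      using eq Qxy by (simp add: \<phi>_def algebra_simps)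
    then have "norm (x - y) = \<bar>t\<bar> * \<bar>cut x - cut y\<bar> * norm (G (Q x))"
      by (metis abs_minus_commute abs_mult norm_scaleR)
    also have "\<dots> \<le> 1 * (norm (x - y) / (M + 1)) * M"
      using t M M0 lip by (intro mult_mono) auto
    finally have "norm (x - y) * (M + 1) \<le> norm (x - y) * M"
      using M0 by (simp add: field_simps)
    then have "norm (x - y) \<le> 0" by (simp add: algebra_simps)
    then show "x = y" by simp
  qed
  have "continuous_on (UNIV \<times> {0..1}) (\<lambda>z. \<phi> (snd z) (fst z))"
    unfolding \<phi>_def cut_def using M0
    by (intro continuous_intros continuous_on_compose2[OF G] continuous_on_compose2[OF cQ]) auto
  then have "continuous_on (UNIV \<times> {0..1}) (\<lambda>(y, t). \<phi> t y)" by (simp add: case_prod_unfold)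
  moreover have "\<phi> t y = y" if "y \<notin> cball 0 (R + M + 1)" for t y
    using that M0 by (simp add: \<phi>_def cut_def max_def min_def field_simps)
  then have "\<exists>K. compact K \<and> (\<forall>t\<in>{0..1}. \<forall>y. y \<notin> K \<longrightarrow> \<phi> t y = y)"
    by (intro exI[of _ "cball 0 (R + M + 1)"]) auto
  moreover have "\<phi> 0 = id" by (auto simp: \<phi>_def)
  ultimately have "compact_isotopy \<phi>" using inj by (auto simp: compact_isotopy_def)
  moreover have "\<phi> 1 x = x + G (Q x)" if "norm x \<le> R" for x
  proof -
    have "1 \<le> (R + M + 1 - norm x) / (M + 1)" using that M0 by (simp add: field_simps)
    then show ?thesis by (simp add: \<phi>_def cut_def)
  qed
  moreover have "\<phi> t x = x" if "G (Q x) = 0" for t x using that by (simp add: \<phi>_def)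
  ultimately show ?thesis by (rule that)
qed

text \<open>The set is the image of a three-parameter set under
  \<open>(r, s, t) \<mapsto> r *\<^sub>R (E s - E t)\<close>, which is Lipschitz near each
  parameter. A dummy fourth parameter 0 puts the parameters into a hyperplane of a four-dimensional
  space, and locally Lipschitz maps into dimension at least 4 preserve negligibility.\<close>

lemma negligible_chords:
  fixes E :: "real \<Rightarrow> 'a::euclidean_space"
  assumes dim: "DIM('a) \<ge> 4"
    and lip: "\<And>s. s \<in> S \<Longrightarrow> \<exists>B. \<exists>\<delta>>0. \<forall>s'\<in>S. \<bar>s' - s\<bar> < \<delta> \<longrightarrow> norm (E s' - E s) \<le> B * \<bar>s' - s\<bar>"
  shows "negligible {r *\<^sub>R (E s - E t) |r s t. s \<in> S \<and> t \<in> S}"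
proof -
  let ?T = "{x :: real \<times> real \<times> real \<times> real. snd (snd (snd x)) = 0 \<and> fst (snd x) \<in> S \<and> fst (snd (snd x)) \<in> S}"
  define f where "f x = fst x *\<^sub>R (E (fst (snd x)) - E (fst (snd (snd x))))" for x :: "real \<times> real \<times> real \<times> real"
  have "negligible {x :: real \<times> real \<times> real \<times> real. (0, 0, 0, 1) \<bullet> x = 0}"
    by (rule negligible_hyperplane) (simp add: zero_prod_def)
  then have negT: "negligible ?T" by (rule negligible_subset) (auto simp: inner_prod_def)
  have "negligible (f ` ?T)"
  proof (rule negligible_locally_Lipschitz_image[OF _ negT])
    show "DIM(real \<times> real \<times> real \<times> real) \<le> DIM('a)" using dim by simp
    fix x :: "real \<times> real \<times> real \<times> real" assume "x \<in> ?T"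
    then obtain r s t where x: "x = (r, s, t, 0)" "s \<in> S" "t \<in> S" by (cases x) auto
    obtain B \<delta> where B: "\<delta> > 0" "\<And>s'. s' \<in> S \<Longrightarrow> \<bar>s' - s\<bar> < \<delta> \<Longrightarrow> norm (E s' - E s) \<le> B * \<bar>s' - s\<bar>"
      using lip[OF x(2)] by blast
    obtain C \<epsilon> where C: "\<epsilon> > 0" "\<And>s'. s' \<in> S \<Longrightarrow> \<bar>s' - t\<bar> < \<epsilon> \<Longrightarrow> norm (E s' - E t) \<le> C * \<bar>s' - t\<bar>"
      using lip[OF x(3)] by blast
    \<comment> \<open>Radius at most 1 bounds the varied factor by \<open>\<bar>r\<bar> + 1\<close>;
      \<open>K\<close> collects the contributions of varying \<open>s\<close>, \<open>t\<close> and
      \<open>r\<close> in turn.\<close>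
    define \<eta> where "\<eta> = min 1 (min \<delta> \<epsilon>)"
    define K where "K = (\<bar>r\<bar> + 1) * (\<bar>B\<bar> + \<bar>C\<bar>) + norm (E s - E t)"
    show "\<exists>U K. open U \<and> x \<in> U \<and> (\<forall>y\<in>?T \<inter> U. norm (f y - f x) \<le> K * norm (y - x))"
    proof (intro exI conjI ballI)
      show "open (ball x \<eta>)" by simp
      show "x \<in> ball x \<eta>" using B C by (simp add: \<eta>_def)
      fix y assume y: "y \<in> ?T \<inter> ball x \<eta>"
      then obtain r' s' t' where yy: "y = (r', s', t', 0)" "s' \<in> S" "t' \<in> S" by (cases y) auto
      have n1: "\<bar>r' - r\<bar> \<le> norm (y - x)" using norm_fst_le[of "fst (y - x)" "snd (y - x)"] yy x by auto
      have n2: "\<bar>s' - s\<bar> \<le> norm (y - x)"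
        using order_trans[OF norm_fst_le[of "s' - s" "(t' - t, 0 :: real)"]
            norm_snd_le[of "(s' - s, t' - t, 0 :: real)" "r' - r"]] yy x by auto
      have n3: "\<bar>t' - t\<bar> \<le> norm (y - x)"
        using order_trans[OF order_trans[OF norm_fst_le[of "t' - t" "0 :: real"]
            norm_snd_le[of "(t' - t, 0 :: real)" "s' - s"]]
            norm_snd_le[of "(s' - s, t' - t, 0 :: real)" "r' - r"]] yy x by auto
      have nx: "norm (y - x) < \<eta>" using y by (simp add: dist_norm norm_minus_commute)
      have b1: "norm (E s' - E s) \<le> \<bar>B\<bar> * norm (y - x)"
      proof -
        have "norm (E s' - E s) \<le> B * \<bar>s' - s\<bar>" using B yy n2 nx by (simp add: \<eta>_def)
        also have "\<dots> \<le> \<bar>B\<bar> * norm (y - x)" using n2 by (intro mult_mono) auto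
        finally show ?thesis .
      qed
      have b2: "norm (E t' - E t) \<le> \<bar>C\<bar> * norm (y - x)"
      proof -
        have "norm (E t' - E t) \<le> C * \<bar>t' - t\<bar>" using C yy n3 nx by (simp add: \<eta>_def)
        also have "\<dots> \<le> \<bar>C\<bar> * norm (y - x)" using n3 by (intro mult_mono) auto
        finally show ?thesis .
      qed
      have r': "\<bar>r'\<bar> \<le> \<bar>r\<bar> + 1" using n1 nx unfolding \<eta>_def by linarith
      have "f y - f x = r' *\<^sub>R (E s' - E s) - r' *\<^sub>R (E t' - E t) + (r' - r) *\<^sub>R (E s - E t)"
        by (simp add: f_def x yy algebra_simps)
      also have "norm \<dots> \<le> norm (r' *\<^sub>R (E s' - E s)) + norm (r' *\<^sub>R (E t' - E t)) + norm ((r' - r) *\<^sub>R (E s - E t))"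
        by (meson add_mono norm_triangle_ineq norm_triangle_ineq4 order_refl order_trans)
      also have "\<dots> = \<bar>r'\<bar> * norm (E s' - E s) + \<bar>r'\<bar> * norm (E t' - E t) + \<bar>r' - r\<bar> * norm (E s - E t)"
        by simp
      also have "\<dots> \<le> (\<bar>r\<bar> + 1) * (\<bar>B\<bar> * norm (y - x)) + (\<bar>r\<bar> + 1) * (\<bar>C\<bar> * norm (y - x))
          + norm (y - x) * norm (E s - E t)"
        using r' b1 b2 n1 by (intro add_mono mult_mono) auto
      also have "\<dots> = K * norm (y - x)" by (simp add: K_def algebra_simps)
      finally show "norm (f y - f x) \<le> K * norm (y - x)" .
    qed
  qed
  moreover have "{r *\<^sub>R (E s - E t) |r s t. s \<in> S \<and> t \<in> S} \<subseteq> f ` ?T"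
  proof
    fix z assume "z \<in> {r *\<^sub>R (E s - E t) |r s t. s \<in> S \<and> t \<in> S}"
    then obtain r s t where "z = r *\<^sub>R (E s - E t)" "s \<in> S" "t \<in> S" by blast
    then show "z \<in> f ` ?T" by (intro image_eqI[of _ _ "(r, s, t, 0)"]) (auto simp: f_def)
  qed
  ultimately show ?thesis by (rule negligible_subset)
qed

text \<open>A direction \<open>v\<close> parallel to no chord lets the arc be first pushed along \<open>v\<close> to have the
  heights of the straight arc, and then, level by level, be moved onto it (Klee's trick).\<close>

lemma straighten_arc:
  fixes F :: "real \<Rightarrow> 'a::euclidean_space" and p e :: 'a
  assumes dim: "DIM('a) \<ge> 4" and s0: "s0 \<le> d" and e: "e \<noteq> 0"
    and inj: "inj_on F {s0..d}" and Fd: "F d = p + d *\<^sub>R e"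
    and tail: "\<And>s s'. s0 \<le> s \<Longrightarrow> s < d \<Longrightarrow> d \<le> s' \<Longrightarrow> F s \<noteq> p + s' *\<^sub>R e"
    and lip: "\<And>s. s \<in> {s0..d} \<Longrightarrow>
      \<exists>B. \<exists>\<delta>>0. \<forall>s'\<in>{s0..d}. \<bar>s' - s\<bar> < \<delta> \<longrightarrow> norm (F s' - F s) \<le> B * \<bar>s' - s\<bar>"
  obtains \<phi> where "compact_isotopy \<phi>" "\<And>s. s \<in> {s0..d} \<Longrightarrow> \<phi> 1 (F s) = p + s *\<^sub>R e"
    "\<And>s. d \<le> s \<Longrightarrow> \<phi> 1 (p + s *\<^sub>R e) = p + s *\<^sub>R e"
proof -
  define S where "S s = p + s *\<^sub>R e" for s
  \<comment> \<open>The arc is continued by the straight ray on which it ends, so that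
    \<open>v\<close> also avoids chords between arc and ray; otherwise the first shear might have to
    move an arc point and fix a ray point with the same projection.\<close>
  define E where "E s = (if s \<le> d then F s else S s)" for s
  have Ed: "E s = S s" if "d \<le> s" for s using that Fd by (auto simp: E_def S_def)
  have lipE: "\<exists>B. \<exists>\<delta>>0. \<forall>s'\<in>{s0..}. \<bar>s' - s\<bar> < \<delta> \<longrightarrow> norm (E s' - E s) \<le> B * \<bar>s' - s\<bar>"
    if s: "s \<in> {s0..}" for s
  proof -
    have right: "norm (E s' - E s) \<le> norm e * \<bar>s' - s\<bar>" if "d \<le> s" "d \<le> s'" for s'
      using that by (simp add: Ed S_def scaleR_diff_left[symmetric] abs_minus_commute)
    show ?thesis
    proof (cases "s \<le> d")
      case True
      then obtain B \<delta> where B: "\<delta> > 0"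
        "\<And>s'. s' \<in> {s0..d} \<Longrightarrow> \<bar>s' - s\<bar> < \<delta> \<Longrightarrow> norm (F s' - F s) \<le> B * \<bar>s' - s\<bar>"
        using lip[of s] s by (metis atLeastAtMost_iff atLeast_iff)
      define \<epsilon> where "\<epsilon> = (if s < d then min \<delta> (d - s) else \<delta>)"
      have "norm (E s' - E s) \<le> max B (norm e) * \<bar>s' - s\<bar>" if "s' \<in> {s0..}" "\<bar>s' - s\<bar> < \<epsilon>" for s'
      proof (cases "s' \<le> d")
        case sd: True
        have "norm (E s' - E s) \<le> B * \<bar>s' - s\<bar>"
          using that True sd B s by (auto simp: E_def \<epsilon>_def split: if_splits)
        then show ?thesis by (meson abs_ge_zero max.cobounded1 mult_right_mono order_trans)
      next
        case False
        then have "s = d" using that True by (auto simp: \<epsilon>_def split: if_splits)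
        then have "norm (E s' - E s) \<le> norm e * \<bar>s' - s\<bar>" using False by (intro right) auto
        then show ?thesis by (meson abs_ge_zero max.cobounded2 mult_right_mono order_trans)
      qed
      moreover have "\<epsilon> > 0" using B by (auto simp: \<epsilon>_def)
      ultimately show ?thesis by blast
    next
      case False
      then have "\<forall>s'\<in>{s0..}. \<bar>s' - s\<bar> < s - d \<longrightarrow> norm (E s' - E s) \<le> norm e * \<bar>s' - s\<bar>"
        by (auto intro!: right)
      moreover have "s - d > 0" using False by simp
      ultimately show ?thesis by blast
    qed
  qed
  have contF: "continuous_on {s0..d} F"
  proof (rule continuous_onI)
    fix s and \<epsilon> :: real assume s: "s \<in> {s0..d}" and \<epsilon>: "0 < \<epsilon>"
    obtain B \<delta> where B: "\<delta> > 0"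
      "\<And>s'. s' \<in> {s0..d} \<Longrightarrow> \<bar>s' - s\<bar> < \<delta> \<Longrightarrow> norm (F s' - F s) \<le> B * \<bar>s' - s\<bar>"
      using lip[OF s] by blast
    have "dist (F s') (F s) \<le> \<epsilon>" if "s' \<in> {s0..d}" "dist s' s < min \<delta> (\<epsilon> / (\<bar>B\<bar> + 1))" for s'
    proof -
      have "norm (F s' - F s) \<le> B * \<bar>s' - s\<bar>" using that B by (simp add: dist_real_def)
      also have "\<dots> \<le> (\<bar>B\<bar> + 1) * \<bar>s' - s\<bar>" by (intro mult_right_mono) auto
      also have "\<dots> \<le> (\<bar>B\<bar> + 1) * (\<epsilon> / (\<bar>B\<bar> + 1))"
        using that by (intro mult_left_mono) (auto simp: dist_real_def)
      also have "\<dots> = \<epsilon>" by simp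
      finally show ?thesis by (simp add: dist_norm)
    qed
    moreover have "min \<delta> (\<epsilon> / (\<bar>B\<bar> + 1)) > 0" using B \<epsilon> by simp
    ultimately show "\<exists>\<delta>>0. \<forall>s'\<in>{s0..d}. dist s' s < \<delta> \<longrightarrow> dist (F s') (F s) \<le> \<epsilon>" by blast
  qed
  have Sinj: "S s = S s' \<longleftrightarrow> s = s'" for s s' using e by (simp add: S_def)
  have injE: "s = t" if "E s = E t" "s0 \<le> s" "s0 \<le> t" for s t
    using that inj tail Sinj
    by (cases "s < d"; cases "t < d") (fastforce simp: E_def S_def inj_on_def Fd not_less split: if_splits)+
  \<comment> \<open>With a chord all its multiples belong to \<open>N\<close>, so that a vector
    outside \<open>N\<close> yields a projection that is injective on the arc and the ray
    together.\<close>
  define N where "N = {r *\<^sub>R (E s - E t) |r s t. s \<in> {s0..} \<and> t \<in> {s0..}}"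
  have "negligible N" unfolding N_def by (rule negligible_chords[OF dim lipE])
  \<comment> \<open>Excluding vectors orthogonal to \<open>e\<close> makes the height along
    \<open>v\<close> strictly monotone on the straight ray, which the second shear relies
    on.\<close>
  moreover have "negligible {v. e \<bullet> v = 0}" using e by (intro negligible_hyperplane) auto
  ultimately have "N \<union> {v. e \<bullet> v = 0} \<noteq> UNIV"
    using non_negligible_UNIV negligible_Un by metis
  then obtain v0 where v0: "v0 \<notin> N" "e \<bullet> v0 \<noteq> 0" by auto
  have Nneg: "- v \<in> N" if v: "v \<in> N" for v
  proof -
    obtain r s t where "v = r *\<^sub>R (E s - E t)" "s \<in> {s0..}" "t \<in> {s0..}" using v unfolding N_def by blast
    then show ?thesis unfolding N_def by (intro CollectI exI[of _ "- r"] exI[of _ s] exI[of _ t]) simp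
  qed
  define v where "v = (if e \<bullet> v0 > 0 then v0 else - v0)"
  have v: "v \<notin> N" "e \<bullet> v > 0"
    using v0 Nneg[of "- v0"] by (auto simp: v_def inner_minus_right)
  then have vv: "v \<bullet> v > 0" by auto
  \<comment> \<open>\<open>l\<close> is the height in direction \<open>v\<close> and
    \<open>P\<close> the orthogonal projection along \<open>v\<close>: every \<open>x\<close> is
    \<open>P x + l x *\<^sub>R v\<close>.\<close>
  define l where "l x = (v \<bullet> x) / (v \<bullet> v)" for x
  define P where "P x = x - l x *\<^sub>R v" for x
  have bl_l: "bounded_linear l"
    unfolding l_def by (rule bounded_linear_compose[OF bounded_linear_divide bounded_linear_inner_right])
  have bl_P: "bounded_linear P"
    unfolding P_def
    by (intro bounded_linear_sub bounded_linear_ident bounded_linear_compose[OF bounded_linear_scaleR_left bl_l])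
  note lin = linear_simps[OF bl_l] linear_simps[OF bl_P]
  have lv: "l v = 1" using vv by (simp add: l_def)
  have Pv: "P v = 0" by (simp add: P_def lv)
  have lP: "l (P x) = 0" for x by (simp add: P_def lin lv)
  have le: "l e > 0" using v vv by (simp add: l_def inner_commute)
  have PE: "s = t" if "P (E s) = P (E t)" "s0 \<le> s" "s0 \<le> t" for s t
  proof (rule ccontr)
    assume "s \<noteq> t"
    define c where "c = l (E s) - l (E t)"
    have eq: "E s - E t = c *\<^sub>R v" using that(1) by (simp add: P_def c_def algebra_simps)
    have "c \<noteq> 0" using eq injE that \<open>s \<noteq> t\<close> by auto
    then have "v = (1 / c) *\<^sub>R (E s - E t)" by (simp add: eq)
    then show False using v(1) that unfolding N_def by blast
  qed
  have contl: "continuous_on A l" and contP: "continuous_on A P" for A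
    by (intro linear_continuous_on bl_l bl_P)+
  have contS: "continuous_on A S" for A unfolding S_def by (intro continuous_intros)
  \<comment> \<open>\<open>A\<close> and \<open>Z\<close> are the shadows of the arc and of the ray;
    they meet only in the shadow of the common end point.\<close>
  define A where "A = (P \<circ> F) ` {s0..d}"
  define Z where "Z = (\<lambda>s. P (S s)) ` {d..}"
  have contPF: "continuous_on {s0..d} (P \<circ> F)"
    by (intro continuous_on_compose contF contP)
  have injPF: "inj_on (P \<circ> F) {s0..d}"
    using PE by (auto simp: inj_on_def E_def)
  obtain h where h: "homeomorphism {s0..d} A (P \<circ> F) h"
    unfolding A_def using homeomorphism_compact[OF _ contPF refl injPF] by auto
  have compA: "compact A" unfolding A_def by (intro compact_continuous_image contPF) simp
  have closedZ: "closed Z"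
  proof -
    have PSinj: "P e \<noteq> 0"
    proof
      assume "P e = 0"
      then have "P (E (d + 1)) = P (E d)" by (simp add: Ed S_def lin)
      then show False using PE[of "d + 1" d] s0 by auto
    qed
    have "Z = (\<lambda>y. P p + y) ` ((\<lambda>s. s *\<^sub>R P e) ` {d..})"
      by (auto simp: Z_def S_def lin image_iff)
    moreover have "closed ((\<lambda>s. s *\<^sub>R P e) ` {d..})"
      by (rule closed_injective_linear_image) (use PSinj in \<open>auto simp: inj_on_def linear_scaleR_left\<close>)
    ultimately show ?thesis by (simp add: closed_translation)
  qed
  \<comment> \<open>Over the shadow of an arc point, the vertical displacement that brings it to the
    height of the target with the same parameter; over \<open>Z\<close> it vanishes, so that the ray
    stays put. Tietze's theorem extends it from \<open>A \<union> Z\<close> to the whole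
    space.\<close>
  define q where "q z = (if z \<in> A then l (S (h z)) - l (F (h z)) else 0)" for z
  have hPF: "h (P (F s)) = s" if "s \<in> {s0..d}" for s
    using homeomorphism_apply1[OF h that] by simp
  have qA: "q (P (F s)) = l (S s) - l (F s)" if "s \<in> {s0..d}" for s
    using that hPF[OF that] by (auto simp: q_def A_def)
  have AZ: "z = P (F d)" if "z \<in> A" "z \<in> Z" for z
  proof -
    obtain s where s: "z = P (F s)" "s \<in> {s0..d}" using \<open>z \<in> A\<close> by (auto simp: A_def)
    obtain s' where s': "z = P (S s')" "d \<le> s'" using \<open>z \<in> Z\<close> by (auto simp: Z_def)
    note ss = s s'
    then have "P (E s) = P (E s')" by (simp add: E_def) (use Ed[of s'] in \<open>auto simp: E_def\<close>)
    then have "s = s'" using PE ss s0 by auto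
    then show ?thesis using ss by auto
  qed
  have qZ: "q z = 0" if "z \<in> Z" for z
  proof (cases "z \<in> A")
    case True
    then have "z = P (F d)" using AZ that by blast
    then show ?thesis using qA[of d] s0 Fd by (simp add: S_def)
  qed (simp add: q_def)
  have cq: "continuous_on (A \<union> Z) q"
  proof (rule continuous_on_closed_Un)
    have ch: "continuous_on A h" "h ` A = {s0..d}" using h by (auto simp: homeomorphism_def)
    have "continuous_on A (\<lambda>z. l (S (h z)) - l (F (h z)))"
      by (intro continuous_on_diff continuous_on_compose2[OF contl] continuous_on_compose2[OF contS]
          continuous_on_compose2[OF contF] ch) (use ch in auto)
    then show "continuous_on A q" by (rule continuous_on_eq) (simp add: q_def)
    have "continuous_on Z (\<lambda>z. 0 :: real)" by simp
    then show "continuous_on Z q" by (rule continuous_on_eq) (simp add: qZ)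
  qed (use compA closedZ in \<open>auto intro: compact_imp_closed\<close>)
  obtain C where C: "\<And>z. z \<in> A \<Longrightarrow> norm (q z) \<le> C"
  proof -
    have "compact (q ` A)" by (rule compact_continuous_image[OF continuous_on_subset[OF cq] compA]) auto
    then show ?thesis using that by (meson bounded_iff compact_imp_bounded image_eqI)
  qed
  obtain \<Lambda> where L: "continuous_on UNIV \<Lambda>" "\<And>z. z \<in> A \<union> Z \<Longrightarrow> \<Lambda> z = q z" "\<And>z. norm (\<Lambda> z) \<le> max C 0"
  proof (rule Tietze[OF cq, of UNIV "max C 0"])
    show "closedin (top_of_set UNIV) (A \<union> Z)"
      using compA closedZ by (auto intro: compact_imp_closed)
    show "norm (q z) \<le> max C 0" if "z \<in> A \<union> Z" for z
      using that C[of z] qZ[of z] by (auto simp: le_max_iff_disj)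
  qed (auto intro: that)
  have "bounded (F ` {s0..d})"
    by (intro compact_imp_bounded compact_continuous_image contF) simp
  then obtain R where R: "\<forall>s\<in>{s0..d}. norm (F s) \<le> R" by (auto simp: bounded_iff)
  obtain \<phi>1 where \<phi>1: "compact_isotopy \<phi>1" "\<And>x. norm x \<le> R \<Longrightarrow> \<phi>1 1 x = x + \<Lambda> (P x) *\<^sub>R v"
    "\<And>t x. \<Lambda> (P x) *\<^sub>R v = 0 \<Longrightarrow> \<phi>1 t x = x"
  proof (rule shear_isotopy[of P "\<lambda>z. \<Lambda> z *\<^sub>R v" "max C 0 * norm v" R])
    show "continuous_on UNIV (\<lambda>z. \<Lambda> z *\<^sub>R v)" using L by (intro continuous_intros)
    show "norm (\<Lambda> z *\<^sub>R v) \<le> max C 0 * norm v" for z using L by (auto intro: mult_right_mono)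
    show "P (\<Lambda> z *\<^sub>R v) = 0" for z by (simp add: lin Pv)
  qed (use bl_P in \<open>auto intro: that\<close>)
  define F1 where "F1 s = P (F s) + l (S s) *\<^sub>R v" for s
  have F1: "\<phi>1 1 (F s) = F1 s" if "s \<in> {s0..d}" for s
  proof -
    have "P (F s) \<in> A" using that by (auto simp: A_def)
    then have "\<phi>1 1 (F s) = F s + (l (S s) - l (F s)) *\<^sub>R v"
      using \<phi>1(2)[OF bspec[OF R that]] L(2) qA[OF that] by simp
    then show ?thesis by (simp add: F1_def P_def algebra_simps)
  qed
  have S1: "\<phi>1 1 (S s) = S s" if "d \<le> s" for s
  proof -
    have "P (S s) \<in> Z" using that by (auto simp: Z_def)
    then have "\<Lambda> (P (S s)) = 0" using L(2) qZ by auto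
    then show ?thesis using \<phi>1(3) by simp
  qed
  \<comment> \<open>The parameter at which the straight line has height \<open>u\<close>, clamped to
    \<open>{s0..d}\<close>. The clamping makes \<open>D\<close> bounded, and zero from the height of
    \<open>S d\<close> on, so that the ray is fixed.\<close>
  define \<sigma> where "\<sigma> u = max s0 (min d ((u - l p) / l e))" for u
  define D where "D u = P (S (\<sigma> u)) - P (F (\<sigma> u))" for u
  have \<sigma>in: "\<sigma> u \<in> {s0..d}" for u using s0 by (auto simp: \<sigma>_def)
  have \<sigma>l: "\<sigma> (l (S s)) = max s0 (min d s)" for s
    using le by (simp add: \<sigma>_def S_def lin)
  have contD: "continuous_on UNIV D"
    unfolding D_def
    by (intro continuous_on_diff continuous_on_compose2[OF contP] continuous_on_compose2[OF contS]
        continuous_on_compose2[OF contF]) (use \<sigma>in le in \<open>auto simp: \<sigma>_def intro!: continuous_intros\<close>)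
  obtain M where M: "\<And>u. norm (D u) \<le> M"
  proof -
    have "compact ((\<lambda>s. P (S s) - P (F s)) ` {s0..d})"
      by (intro compact_continuous_image continuous_on_diff continuous_on_compose2[OF contP] contS contF) auto
    then obtain M where "\<And>s. s \<in> {s0..d} \<Longrightarrow> norm (P (S s) - P (F s)) \<le> M"
      by (meson bounded_iff compact_imp_bounded image_eqI)
    then have "norm (D u) \<le> M" for u unfolding D_def using \<sigma>in by blast
    then show ?thesis by (rule that)
  qed
  have "bounded (F1 ` {s0..d})"
    unfolding F1_def by (intro compact_imp_bounded compact_continuous_image continuous_intros
        continuous_on_compose2[OF contP] continuous_on_compose2[OF contl] contS contF) auto
  then obtain R2 where R2: "\<forall>s\<in>{s0..d}. norm (F1 s) \<le> R2" by (auto simp: bounded_iff)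
  obtain \<phi>2 where \<phi>2: "compact_isotopy \<phi>2" "\<And>x. norm x \<le> R2 \<Longrightarrow> \<phi>2 1 x = x + D (l x)"
    "\<And>t x. D (l x) = 0 \<Longrightarrow> \<phi>2 t x = x"
    by (rule shear_isotopy[of l D M R2]) (use bl_l contD M in \<open>auto simp: D_def lin lP intro: that\<close>)
  \<comment> \<open>After the first shear \<open>F1 s\<close> has height \<open>l (S s)\<close>, so
    each level contains at most one point of the moved arc, and a translation depending on the
    height alone finishes.\<close>
  have F2: "\<phi>2 1 (F1 s) = S s" if "s \<in> {s0..d}" for s
  proof -
    have "l (F1 s) = l (S s)" by (simp add: F1_def lin lP lv)
    then have "D (l (F1 s)) = P (S s) - P (F s)" using that by (simp add: D_def \<sigma>l)
    then show ?thesis using \<phi>2(2)[OF bspec[OF R2 that]] by (simp add: F1_def P_def)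
  qed
  have S2: "\<phi>2 1 (S s) = S s" if "d \<le> s" for s
  proof -
    have "\<sigma> (l (S s)) = d" using that s0 by (simp add: \<sigma>l)
    then have "D (l (S s)) = 0" using Fd by (simp add: D_def) (simp add: S_def)
    then show ?thesis by (rule \<phi>2(3))
  qed
  show ?thesis
  proof (rule that[of "\<lambda>t. \<phi>2 t \<circ> \<phi>1 t"])
    show "compact_isotopy (\<lambda>t. \<phi>2 t \<circ> \<phi>1 t)" by (rule compact_isotopy_comp[OF \<phi>1(1) \<phi>2(1)])
  qed (use F1 S1 F2 S2 in \<open>auto simp: S_def\<close>)
qed

section \<open>Isotopies of the extended ray and its powers\<close>

definition bottom :: extended_ray where "bottom = Abs_ray (None, 0)"

lemma Rep_extend: "Rep_ray (extend x) = (Some (fst (Rep_ray x)), snd (Rep_ray x))"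
  by (simp add: extend_def case_prod_unfold Rep_ray_Abs Rep_ray_bounds)

lemma extend_less_iff [simp]: "extend x < extend y \<longleftrightarrow> x < y"
  by (simp add: less_ray_iff Rep_extend)

lemma extend_le_iff [simp]: "extend x \<le> extend y \<longleftrightarrow> x \<le> y"
  by (simp add: less_eq_ray_iff Rep_extend)

lemma extend_eq_iff [simp]: "extend x = extend y \<longleftrightarrow> x = y"
  by (simp add: order.eq_iff)

lemma extended_ray_cases:
  obtains (Extend) x where "y = extend x" | (Collar) r where "0 \<le> r" "r < 1" "y = Abs_ray (None, r)"
proof (cases "fst (Rep_ray y)")
  case None
  then have "y = Abs_ray (None, snd (Rep_ray y))" by (metis Rep_ray_inverse prod.collapse)
  then show ?thesis using Collar Rep_ray_bounds by blast
next
  case (Some a)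
  have "Rep_ray y = Rep_ray (extend (Abs_ray (a, snd (Rep_ray y))))"
    using Some by (simp add: Rep_extend Rep_ray_Abs Rep_ray_bounds prod_eq_iff)
  then show ?thesis using Extend Rep_ray_inject by blast
qed

lemma collar_less_extend: "0 \<le> r \<Longrightarrow> r < 1 \<Longrightarrow> Abs_ray (None, r) < extend x"
  by (simp add: less_ray_iff Rep_extend Rep_ray_Abs)

lemma collar_less_iff: "0 \<le> r \<Longrightarrow> r < 1 \<Longrightarrow> 0 \<le> s \<Longrightarrow> s < 1 \<Longrightarrow>
    (Abs_ray (None, r) :: extended_ray) < Abs_ray (None, s) \<longleftrightarrow> r < s"
  by (simp add: less_ray_iff Rep_ray_Abs)

lemma bottom_le [simp]: "bottom \<le> y"
  using Rep_ray_bounds[of y] by (simp add: less_eq_ray_iff bottom_def Rep_ray_Abs) (metis less_eq_option_None not_le order.not_eq_order_implies_strict)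

lemma bottom_less_extend [simp]: "bottom < extend x"
  by (simp add: bottom_def collar_less_extend)

text \<open>A bound in the collar is passed by all values or by none, so the order-topological
  criterion has content only for bounds in the copy of the long ray.\<close>

lemma continuous_extend: "continuous_on S extend"
  unfolding continuous_on_def
proof (intro ballI order_tendstoI)
  fix x and a :: extended_ray
  show "\<forall>\<^sub>F y in at x within S. a < extend y" if "a < extend x"
  proof (cases a rule: extended_ray_cases)
    case (Extend b)
    then have "\<forall>\<^sub>F y in at x within S. b < y"
      unfolding eventually_at_topological using that by (intro exI[of _ "{b<..}"]) auto
    then show ?thesis using Extend by simp
  next
    case (Collar r)
    then show ?thesis by (simp add: collar_less_extend)
  qed
  show "\<forall>\<^sub>F y in at x within S. extend y < a" if "extend x < a"
  proof (cases a rule: extended_ray_cases)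
    case (Extend b)
    then have "\<forall>\<^sub>F y in at x within S. y < b"
      unfolding eventually_at_topological using that by (intro exI[of _ "{..<b}"]) auto
    then show ?thesis using Extend by simp
  next
    case (Collar r)
    then show ?thesis using that collar_less_extend[of r x] by simp
  qed
qed

lemma extend_cofinal: "\<exists>b. y < extend b \<and> origin < b"
proof (cases y rule: extended_ray_cases)
  case (Extend x)
  obtain b where "max x origin < b" using gt_ex by blast
  then show ?thesis using Extend by auto
next
  case (Collar r)
  obtain b where "origin < b" using gt_ex by blast
  then show ?thesis using Collar collar_less_extend by blast
qed

text \<open>For order topologies an increasing map with open image is continuous, and the same
  applies to its inverse.\<close>

lemma strict_mono_on_homeomorphism:
  fixes f :: "'a::linear_continuum_topology \<Rightarrow> 'b::linear_continuum_topology"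
  assumes "strict_mono_on S f" "open S" "open (f ` S)"
  shows "homeomorphism S (f ` S) f (the_inv_into S f)"
proof -
  have inj: "inj_on f S" by (rule strict_mono_on_imp_inj_on[OF assms(1)])
  note inv = the_inv_into_f_f[OF inj]
  have mono: "f x \<le> f y" if "x \<in> S" "y \<in> S" "x \<le> y" for x y
    using strict_mono_onD[OF assms(1), of x y] that by (cases "x = y") (auto simp: less_imp_le)
  have im: "the_inv_into S f ` f ` S = S"
    using inv by (auto simp: image_iff)
  have "the_inv_into S f u \<le> the_inv_into S f v" if uv: "u \<in> f ` S" "v \<in> f ` S" "u \<le> v" for u v
  proof -
    obtain x y where xy: "u = f x" "v = f y" "x \<in> S" "y \<in> S" using uv by blast
    have "x \<le> y" using strict_mono_onD[OF assms(1), of y x] xy uv(3) by (metis leD leI)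
    then show ?thesis using xy inv by simp
  qed
  then have "continuous_on (f ` S) (the_inv_into S f)"
    by (intro continuous_onI_mono) (simp_all add: im assms(2))
  moreover have "continuous_on S f" by (rule continuous_onI_mono[OF assms(3) mono])
  ultimately show ?thesis by (simp add: homeomorphism_def im inv)
qed

text \<open>The collar takes up the missing half-line: \<open>1 - 1 / r\<close> increases from minus
  infinity towards 0 as \<open>r\<close> runs through the open unit interval, so the values fill
  everything below \<open>k origin\<close>. The point \<open>bottom\<close>, where the formula would
  use \<open>1 / 0 = 0\<close>, is left out.\<close>

lemma line_coordinate:
  assumes k: "chart_coordinate A {..<b} k" "k ` {..<b} = {k origin..}" and b: "origin < b"
  obtains K where "strict_mono_on {bottom<..<extend b} K" "K ` {bottom<..<extend b} = UNIV"
    "\<And>x. x < b \<Longrightarrow> K (extend x) = k x"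
proof -
  define K where "K y = (case Rep_ray y of (None, r) \<Rightarrow> k origin + 1 - 1 / r
      | (Some a, r) \<Rightarrow> k (Abs_ray (a, r)))" for y :: extended_ray
  have Kx: "K (extend x) = k x" for x by (simp add: K_def Rep_extend Rep_ray_inverse)
  have Kr: "K (Abs_ray (None, r)) = k origin + 1 - 1 / r" if "0 \<le> r" "r < 1" for r
    using that by (simp add: K_def Rep_ray_Abs)
  have kmono: "strict_mono_on {..<b} k" using k(1) by (simp add: chart_coordinate_def)
  have k0: "k origin \<le> k x" if "x < b" for x using k(2) that by blast
  have "strict_mono_on {bottom<..<extend b} K"
  proof (rule strict_mono_onI)
    fix x y assume xy: "x \<in> {bottom<..<extend b}" "y \<in> {bottom<..<extend b}" "x < y"
    show "K x < K y"
    proof (cases x rule: extended_ray_cases)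
      case x: (Extend x')
      show ?thesis
      proof (cases y rule: extended_ray_cases)
        case (Extend y')
        then show ?thesis using x xy strict_mono_onD[OF kmono, of x' y'] by (simp add: Kx)
      next
        case (Collar r)
        then show ?thesis using x xy collar_less_extend[of r x'] by simp
      qed
    next
      case x: (Collar r)
      have r: "0 < r" using xy(1) x by (simp add: bottom_def collar_less_iff)
      show ?thesis
      proof (cases y rule: extended_ray_cases)
        case (Extend y')
        have "1 < 1 / r" using r x by simp
        then show ?thesis using k0[of y'] xy Extend x by (simp add: Kx Kr)
      next
        case (Collar s)
        then have "r < s" using xy(3) x by (simp add: collar_less_iff)
        then have "1 / s < 1 / r" using r by (simp add: frac_less2)
        then show ?thesis using x Collar by (simp add: Kr)
      qed
    qed
  qed
  moreover have "K ` {bottom<..<extend b} = UNIV"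
  proof (intro equalityI subsetI UNIV_I)
    fix v :: real
    show "v \<in> K ` {bottom<..<extend b}"
    proof (cases "v < k origin")
      case True
      define r where "r = 1 / (k origin + 1 - v)"
      have r: "0 < r" "r < 1" using True by (auto simp: r_def)
      have "K (Abs_ray (None, r)) = v" using r by (simp add: Kr) (simp add: r_def)
      moreover have "Abs_ray (None, r) \<in> {bottom<..<extend b}"
        using r by (simp add: bottom_def collar_less_iff collar_less_extend)
      ultimately show ?thesis by blast
    next
      case False
      then have "v \<in> k ` {..<b}" using k(2) by simp
      then obtain x where "x < b" "v = k x" by blast
      then show ?thesis by (intro image_eqI[of _ _ "extend x"]) (simp_all add: Kx)
    qed
  qed
  ultimately show ?thesis using Kx by (rule that)
qed

section \<open>Isotopies of products and isotopies carried over from Euclidean space\<close>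

lemma isotopyI:
  assumes "continuous_on (UNIV \<times> {0..1}) (\<lambda>(y, t). \<phi> t y)"
    and "\<And>t. t \<in> {0..1} \<Longrightarrow> \<exists>g. homeomorphism UNIV UNIV (\<phi> t) g"
  shows "isotopy \<phi>"
  using assms by (simp add: isotopy_def)

lemma isotopy_pi:
  fixes \<phi> :: "'n::finite \<Rightarrow> real \<Rightarrow> 'a::topological_space \<Rightarrow> 'a"
  assumes "\<And>i. isotopy (\<phi> i)"
  shows "isotopy (\<lambda>t y. \<chi> i. \<phi> i t (y $ i))"
proof (rule isotopyI)
  have "continuous_on (UNIV \<times> {0..1}) (\<lambda>p. \<phi> i (snd p) (fst p $ i))" for i
  proof -
    have "continuous_on (UNIV \<times> {0..1}) (\<lambda>(y, t). \<phi> i t y)" using assms by (simp add: isotopy_def)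
    then have "continuous_on (UNIV \<times> {0..1}) (\<lambda>p. (\<lambda>(y, t). \<phi> i t y) (fst p $ i, snd p))"
      by (rule continuous_on_compose2) (auto intro!: continuous_intros)
    then show ?thesis by simp
  qed
  then have "continuous_on (UNIV \<times> {0..1}) (\<lambda>p. \<chi> i. \<phi> i (snd p) (fst p $ i))"
    by (rule continuous_on_vec_lambda)
  then show "continuous_on (UNIV \<times> {0..1}) (\<lambda>(y, t). \<chi> i. \<phi> i t (y $ i))"
    by (simp add: case_prod_unfold)
  fix t :: real assume "t \<in> {0..1}"
  then have "\<forall>i. \<exists>g. homeomorphism UNIV UNIV (\<phi> i t) g" using assms by (simp add: isotopy_def)
  then obtain g where g: "\<And>i. homeomorphism UNIV UNIV (\<phi> i t) (g i)" by metis
  have c: "continuous_on UNIV (\<lambda>y. \<chi> i. f i (y $ i))" if "\<And>i. continuous_on UNIV (f i)"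
    for f :: "'n \<Rightarrow> 'a \<Rightarrow> 'a"
  proof (rule continuous_on_vec_lambda)
    show "continuous_on UNIV (\<lambda>y. f i (y $ i))" for i
      by (rule continuous_on_compose2[OF that]) (auto intro!: continuous_intros)
  qed
  have "homeomorphism UNIV UNIV (\<lambda>y. \<chi> i. \<phi> i t (y $ i)) (\<lambda>y. \<chi> i. g i (y $ i))"
  proof (rule homeomorphismI)
    show "continuous_on UNIV (\<lambda>y. \<chi> i. \<phi> i t (y $ i))" "continuous_on UNIV (\<lambda>y. \<chi> i. g i (y $ i))"
      by (rule c, rule homeomorphism_cont1[OF g] homeomorphism_cont2[OF g])+
  qed (simp_all add: homeomorphism_apply1[OF g] homeomorphism_apply2[OF g])
  then show "\<exists>g. homeomorphism UNIV UNIV (\<lambda>y. \<chi> i. \<phi> i t (y $ i)) g" by blast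
qed

text \<open>The map is continuous on \<open>W\<close> and is the identity off the transported
  support; both are open sets, and together they cover the space.\<close>

lemma continuous_on_transport:
  fixes k :: "'x::topological_space \<Rightarrow> 'e::topological_space"
  assumes k: "homeomorphism W UNIV k k'" and W: "open W" and cl: "closed (k' ` K)"
    and cont: "continuous_on (UNIV \<times> T) (\<lambda>(y, t). \<phi> t y)"
    and fix': "\<And>t y. t \<in> T \<Longrightarrow> y \<notin> K \<Longrightarrow> \<phi> t y = y"
  shows "continuous_on (UNIV \<times> T) (\<lambda>(y, t). if y \<in> W then k' (\<phi> t (k y)) else y)"
    (is "continuous_on _ ?f")
proof -
  have ck: "continuous_on W k" and ck': "continuous_on UNIV k'" using k by (auto simp: homeomorphism_def)
  have kk: "k' (k y) = y" if "y \<in> W" for y using homeomorphism_apply1[OF k that] .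
  have sub: "k' ` K \<subseteq> W" using homeomorphism_image2[OF k] by blast
  have 1: "continuous_on (W \<times> T) ?f"
  proof -
    have "continuous_on (W \<times> T) (\<lambda>p. k' ((\<lambda>(y, t). \<phi> t y) (k (fst p), snd p)))"
    proof (rule continuous_on_compose2[OF ck'])
      show "continuous_on (W \<times> T) (\<lambda>p. (\<lambda>(y, t). \<phi> t y) (k (fst p), snd p))"
        by (rule continuous_on_compose2[OF cont])
           (auto intro!: continuous_on_Pair continuous_on_snd continuous_on_id
             continuous_on_compose2[OF ck continuous_on_fst[OF continuous_on_id]])
    qed simp
    then show ?thesis by (rule continuous_on_eq) auto
  qed
  have 2: "continuous_on ((- (k' ` K)) \<times> T) ?f"
  proof -
    have "continuous_on ((- (k' ` K)) \<times> T) fst" by (intro continuous_intros)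
    moreover have "fst p = ?f p" if p: "p \<in> (- (k' ` K)) \<times> T" for p
    proof (cases "fst p \<in> W")
      case True
      have "k (fst p) \<notin> K" using p kk[OF True] by force
      then have "\<phi> (snd p) (k (fst p)) = k (fst p)" using fix' p by auto
      then show ?thesis using True kk[OF True] by (simp add: case_prod_unfold)
    qed (simp add: case_prod_unfold)
    ultimately show ?thesis by (rule continuous_on_eq)
  qed
  have eq: "UNIV \<times> T = W \<times> T \<union> (- (k' ` K)) \<times> T" using sub by auto
  have o: "openin (top_of_set (UNIV \<times> T)) (S \<times> T)" if "open S" for S :: "'x set"
  proof -
    have "S \<times> T = (UNIV \<times> T) \<inter> (S \<times> UNIV)" by auto
    then show ?thesis using that by (metis open_Times open_UNIV openin_open_Int)
  qed
  have "continuous_on (W \<times> T \<union> (- (k' ` K)) \<times> T) ?f"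
    by (rule continuous_on_Un_local_open[OF _ _ 1 2]; unfold eq[symmetric]; rule o)
       (use W cl in auto)
  then show ?thesis using eq by simp
qed

text \<open>Extension by the identity needs the transported support to stay away from the frontier
  of \<open>W\<close>. As the surrounding space is an arbitrary topological space, closedness of
  transported compact sets is made a hypothesis.\<close>

lemma isotopy_transport:
  fixes k :: "'x::topological_space \<Rightarrow> 'e::euclidean_space"
  assumes k: "homeomorphism W UNIV k k'" and W: "open W"
    and cl: "\<And>C. compact C \<Longrightarrow> closed (k' ` C)" and \<phi>: "compact_isotopy \<phi>"
  shows "isotopy (\<lambda>t y. if y \<in> W then k' (\<phi> t (k y)) else y)"
    "(\<lambda>y. if y \<in> W then k' (\<phi> 0 (k y)) else y) = id"
proof -
  obtain K where K: "compact K" "\<And>t y. t \<in> {0..1} \<Longrightarrow> y \<notin> K \<Longrightarrow> \<phi> t y = y"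
    using \<phi> unfolding compact_isotopy_def by blast
  have kk: "k' (k y) = y" if "y \<in> W" for y using homeomorphism_apply1[OF k that] .
  have kk': "k (k' y) = y" "k' y \<in> W" for y
    using homeomorphism_apply2[OF k] homeomorphism_image2[OF k] by auto
  have single: "continuous_on UNIV (\<lambda>y. if y \<in> W then k' (f (k y)) else y)"
    if f: "continuous_on UNIV f" "\<And>y. y \<notin> K \<Longrightarrow> f y = y" for f
  proof -
    have "continuous_on (UNIV \<times> {0::real}) (\<lambda>(y, t). f y)"
      unfolding case_prod_unfold by (rule continuous_on_compose2[OF f(1)]) (auto intro!: continuous_intros)
    then have "continuous_on (UNIV \<times> {0::real}) (\<lambda>(y, t). if y \<in> W then k' (f (k y)) else y)"
      by (rule continuous_on_transport[OF k W cl[OF K(1)]]) (rule f(2))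
    then have "continuous_on UNIV (\<lambda>y. (\<lambda>(y, t). if y \<in> W then k' (f (k y)) else y) (y, 0::real))"
      by (rule continuous_on_compose2) (auto intro!: continuous_intros)
    then show ?thesis by simp
  qed
  show "isotopy (\<lambda>t y. if y \<in> W then k' (\<phi> t (k y)) else y)"
  proof (rule isotopyI)
    show "continuous_on (UNIV \<times> {0..1}) (\<lambda>(y, t). if y \<in> W then k' (\<phi> t (k y)) else y)"
      by (rule continuous_on_transport[OF k W cl[OF K(1)]]) (use \<phi> K(2) in \<open>simp_all add: compact_isotopy_def\<close>)
    fix t :: real assume t: "t \<in> {0..1}"
    obtain g where g: "homeomorphism UNIV UNIV (\<phi> t) g"
      using compact_isotopy_homeomorphism[OF \<phi> t] by blast
    note g12 = homeomorphism_apply1[OF g] homeomorphism_apply2[OF g]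
    have gK: "g y = y" if "y \<notin> K" for y using K(2)[OF t that] g12(1)[of y] by simp
    have "homeomorphism UNIV UNIV (\<lambda>y. if y \<in> W then k' (\<phi> t (k y)) else y)
        (\<lambda>y. if y \<in> W then k' (g (k y)) else y)"
    proof (rule homeomorphismI)
      show "continuous_on UNIV (\<lambda>y. if y \<in> W then k' (\<phi> t (k y)) else y)"
        by (rule single[OF homeomorphism_cont1[OF g] K(2)[OF t]])
      show "continuous_on UNIV (\<lambda>y. if y \<in> W then k' (g (k y)) else y)"
        by (rule single[OF homeomorphism_cont2[OF g] gK])
    qed (simp_all add: kk kk' g12)
    then show "\<exists>h. homeomorphism UNIV UNIV (\<lambda>y. if y \<in> W then k' (\<phi> t (k y)) else y) h" by blast
  qed
  have "\<phi> 0 = id" using \<phi> by (simp add: compact_isotopy_def)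
  then show "(\<lambda>y. if y \<in> W then k' (\<phi> 0 (k y)) else y) = id" using kk by auto
qed

section \<open>Isotopies of the extended ray\<close>

lemma closed_Inf_mem:
  fixes S :: "'a::wellorder ray set"
  assumes "closed S" "S \<noteq> {}" "bdd_below S"
  shows "Inf S \<in> S"
proof (rule ccontr)
  assume n: "Inf S \<notin> S"
  obtain z where z: "z \<in> S" using assms(2) by blast
  then have "Inf S < z" using n cInf_lower[OF z assms(3)] by (metis order.not_eq_order_implies_strict)
  then obtain u where u: "Inf S < u" "{Inf S..<u} \<subseteq> - S"
    using open_right[of "- S" "Inf S" z] assms(1) n by (auto simp: open_Compl)
  have "u \<le> x" if "x \<in> S" for x
    using u(2) that cInf_lower[OF that assms(3)] by (meson ComplD atLeastLessThan_iff not_le subsetD)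
  then have "u \<le> Inf S" by (rule cInf_greatest[OF assms(2)])
  then show False using u(1) by simp
qed

lemma closed_Sup_mem:
  fixes S :: "'a::wellorder ray set"
  assumes "closed S" "S \<noteq> {}" "bdd_above S"
  shows "Sup S \<in> S"
proof (rule ccontr)
  assume n: "Sup S \<notin> S"
  obtain z where z: "z \<in> S" using assms(2) by blast
  then have "z < Sup S" using n cSup_upper[OF z assms(3)] by (metis order.not_eq_order_implies_strict)
  then obtain u where u: "u < Sup S" "{u<..Sup S} \<subseteq> - S"
    using open_left[of "- S" "Sup S" z] assms(1) n by (auto simp: open_Compl)
  have "x \<le> u" if "x \<in> S" for x
    using u(2) that cSup_upper[OF that assms(3)] by (meson ComplD greaterThanAtMost_iff not_le subsetD)
  then have "Sup S \<le> u" by (rule cSup_least[OF assms(2)])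
  then show False using u(1) by simp
qed

text \<open>Supplies the line structure in which points are interpolated or translated; the lower
  half of the line comes from the collar.\<close>

lemma coordinate_above:
  assumes A: "maximal_smooth_atlas A"
  shows "\<exists>M K. c < M \<and> strict_mono_on {bottom<..<M} K \<and> K ` {bottom<..<M} = (UNIV :: real set)"
proof -
  obtain b where b: "c < extend b" "origin < b" using extend_cofinal by blast
  obtain k where k: "chart_coordinate A {..<b} k" "k ` {..<b} = {k origin..}"
    using unbounded_chart_coordinate[OF A b(2)] .
  obtain K where "strict_mono_on {bottom<..<extend b} K" "K ` {bottom<..<extend b} = (UNIV :: real set)"
    by (rule line_coordinate[OF k b(2)]) (rule that)
  then show ?thesis using b(1) by blast
qed

text \<open>On each component of the complement of the fixed point set, the isotopy interpolates
  linearly in a real coordinate; it is continuous at the fixed points because the values lie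
  between \<open>x\<close> and \<open>\<theta> x\<close>.\<close>

lemma increasing_isotopy:
  fixes \<theta> :: "extended_ray \<Rightarrow> extended_ray"
  assumes A: "maximal_smooth_atlas A" and mono: "strict_mono \<theta>" and surj: "surj \<theta>"
    and e: "bottom < e" and low: "\<And>y. y \<le> e \<Longrightarrow> \<theta> y = y" and unb: "unbounded {y. \<theta> y = y}"
  shows "\<exists>\<phi>. isotopy \<phi> \<and> \<phi> 0 = id \<and> \<phi> 1 = \<theta>"
proof -
  define Fix where "Fix = {y. \<theta> y = y}"
  have less_iff: "\<theta> x < \<theta> y \<longleftrightarrow> x < y" for x y using strict_mono_less[OF mono] .
  \<comment> \<open>An increasing map onto the whole ray has no jumps.\<close>
  have cont: "continuous_on UNIV \<theta>"
    by (rule continuous_onI_mono) (use surj less_iff in \<open>auto simp: not_less[symmetric]\<close>)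
  have clF: "closed Fix" unfolding Fix_def by (intro closed_Collect_eq cont continuous_on_id)
  have fixD: "\<theta> y = y" if "y \<in> Fix" for y using that by (simp add: Fix_def)
  \<comment> \<open>For a moving point \<open>x\<close>, \<open>lo x\<close> and \<open>up x\<close>
    are the end points of its component. They exist because the fixed points form a closed unbounded
    set containing \<open>bottom\<close>.\<close>
  define up where "up x = Inf {z \<in> Fix. x \<le> z}" for x
  define lo where "lo x = Sup {z \<in> Fix. z \<le> x}" for x
  have upne: "{z \<in> Fix. x \<le> z} \<noteq> {}" for x using unboundedD[OF unb, of x] by (auto simp: Fix_def less_imp_le)
  have lone: "{z \<in> Fix. z \<le> x} \<noteq> {}" for x using low[of bottom] e by (auto simp: Fix_def intro!: exI[of _ bottom])
  have upbdd: "bdd_below {z \<in> Fix. x \<le> z}" for x by (rule bdd_belowI[of _ x]) simp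
  have lobdd: "bdd_above {z \<in> Fix. z \<le> x}" for x by (rule bdd_aboveI[of _ x]) simp
  have clup: "closed {z \<in> Fix. x \<le> z}" and cllo: "closed {z \<in> Fix. z \<le> x}" for x
    using closed_Int[OF clF closed_atLeast[of x]] closed_Int[OF clF closed_atMost[of x]]
    by (simp_all add: Int_def)
  have up: "up x \<in> Fix" "x \<le> up x" for x
    using closed_Inf_mem[OF clup upne upbdd, of x] by (simp_all add: up_def)
  have lo: "lo x \<in> Fix" "lo x \<le> x" for x
    using closed_Sup_mem[OF cllo lone lobdd, of x] by (simp_all add: lo_def)
  have up_le: "up x \<le> z" if "z \<in> Fix" "x \<le> z" for x z
    unfolding up_def using cInf_lower[OF _ upbdd] that by simp
  have le_lo: "z \<le> lo x" if "z \<in> Fix" "z \<le> x" for x z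
    unfolding lo_def using cSup_upper[OF _ lobdd] that by simp
  have up_less: "x < up x" and lo_less: "lo x < x" if "x \<notin> Fix" for x
    using up[of x] lo[of x] that by (metis order.not_eq_order_implies_strict)+
  \<comment> \<open>That all points up to \<open>e > bottom\<close> are fixed keeps the moving
    components, with their lower end points, above \<open>bottom\<close> and so inside the domain of
    a real coordinate.\<close>
  have bot_lo: "bottom < lo x" if "x \<notin> Fix" for x
  proof -
    have "e \<in> Fix" using low by (simp add: Fix_def)
    moreover have "e < x" using that low[of x] by (cases "x \<le> e") (auto simp: Fix_def)
    ultimately have "e \<le> lo x" by (intro le_lo) simp_all
    then show ?thesis using e by simp
  qed
  have comp: "y \<notin> Fix" "up y = up x" if "x \<notin> Fix" "lo x < y" "y < up x" for x y
  proof -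
    show "y \<notin> Fix" using that up_le[of y x] le_lo[of y x] linear[of x y] by (auto dest: leD)
    show "up y = up x"
    proof (rule antisym)
      show "up y \<le> up x" using that by (intro up_le up) simp
      have "x \<le> up y"
      proof (rule ccontr)
        assume "\<not> x \<le> up y"
        then have "up y \<le> lo x" by (intro le_lo up) simp
        then show False using up(2)[of y] that(2) by simp
      qed
      then show "up x \<le> up y" by (intro up_le up)
    qed
  qed
  have \<theta>in: "lo x < \<theta> x" "\<theta> x < up x" if "x \<notin> Fix" for x
    using less_iff[of "lo x" x] less_iff[of x "up x"] up_less[OF that] lo_less[OF that]
      fixD[OF up(1)[of x]] fixD[OF lo(1)[of x]] by simp_all
  \<comment> \<open>Coordinates are indexed by the upper end point, so one and the same coordinate
    serves all points of a component.\<close>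
  obtain M K where MK: "\<And>c. c < M c" "\<And>c. strict_mono_on {bottom<..<M c} (K c)"
    "\<And>c. K c ` {bottom<..<M c} = (UNIV :: real set)"
    using coordinate_above[OF A] by metis
  define W where "W c = {bottom<..<M c}" for c
  define J where "J c = the_inv_into (W c) (K c)" for c
  have hom: "homeomorphism (W c) UNIV (K c) (J c)" for c
    using strict_mono_on_homeomorphism[OF MK(2)[of c]] MK(3)[of c] by (simp add: W_def J_def)
  have KJ: "K c (J c v) = v" "J c v \<in> W c" for c v
  proof -
    show "K c (J c v) = v" using homeomorphism_apply2[OF hom] by simp
    have "range (J c) = W c" using homeomorphism_image2[OF hom] .
    then show "J c v \<in> W c" by blast
  qed
  have JK: "J c (K c y) = y" if "y \<in> W c" for c y using homeomorphism_apply1[OF hom that] .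
  have K_less: "K c x < K c y \<longleftrightarrow> x < y" if "x \<in> W c" "y \<in> W c" for c x y
    using strict_mono_onD[OF MK(2)[of c], of x y] strict_mono_onD[OF MK(2)[of c], of y x] that
    unfolding W_def by (metis less_asym linorder_neqE)
  have inW: "y \<in> W (up x)" if "x \<notin> Fix" "lo x < y" "y < up x" for x y
    using that bot_lo[OF that(1)] MK(1)[of "up x"] unfolding W_def by (auto intro: less_trans)
  define v where "v t x = (1 - t) * K (up x) x + t * K (up x) (\<theta> x)" for t x
  define \<phi> where "\<phi> t x = (if x \<in> Fix then x else J (up x) (v t x))" for t x
  have xW: "x \<in> W (up x)" "\<theta> x \<in> W (up x)" if "x \<notin> Fix" for x
    using inW[OF that] lo_less[OF that] up_less[OF that] \<theta>in[OF that] by blast+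
  have vmin: "min (K (up x) x) (K (up x) (\<theta> x)) \<le> v t x" and vmax: "v t x \<le> max (K (up x) x) (K (up x) (\<theta> x))"
    if t: "t \<in> {0..1}" for t x
  proof -
    let ?a = "K (up x) x" and ?b = "K (up x) (\<theta> x)"
    have "(1 - t) * min ?a ?b + t * min ?a ?b \<le> v t x"
      unfolding v_def using t by (intro add_mono mult_left_mono) auto
    then show "min ?a ?b \<le> v t x" by (simp add: algebra_simps)
    have "v t x \<le> (1 - t) * max ?a ?b + t * max ?a ?b"
      unfolding v_def using t by (intro add_mono mult_left_mono) auto
    then show "v t x \<le> max ?a ?b" by (simp add: algebra_simps)
  qed
  have between: "min x (\<theta> x) \<le> \<phi> t x" "\<phi> t x \<le> max x (\<theta> x)" if t: "t \<in> {0..1}" for t x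
  proof -
    have "min x (\<theta> x) \<le> \<phi> t x \<and> \<phi> t x \<le> max x (\<theta> x)"
    proof (cases "x \<in> Fix")
      case True
      then show ?thesis using fixD by (simp add: \<phi>_def)
    next
      case False
      let ?c = "up x"
      have eq: "\<phi> t x = J ?c (v t x)" using False by (simp add: \<phi>_def)
      have "\<not> J ?c (v t x) < min x (\<theta> x)"
      proof
        assume "J ?c (v t x) < min x (\<theta> x)"
        then have "K ?c (J ?c (v t x)) < min (K ?c x) (K ?c (\<theta> x))"
          using K_less[OF KJ(2)] xW[OF False] by simp
        then show False using vmin[OF t, of x] unfolding KJ(1) by (meson leD)
      qed
      moreover have "\<not> max x (\<theta> x) < J ?c (v t x)"
      proof
        assume "max x (\<theta> x) < J ?c (v t x)"
        then have "max (K ?c x) (K ?c (\<theta> x)) < K ?c (J ?c (v t x))"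
          using K_less[OF _ KJ(2)] xW[OF False] by simp
        then show False using vmax[OF t, of x] unfolding KJ(1) by (meson leD)
      qed
      ultimately show ?thesis unfolding eq by (meson not_less)
    qed
    then show "min x (\<theta> x) \<le> \<phi> t x" "\<phi> t x \<le> max x (\<theta> x)" by simp_all
  qed
  have \<phi>fix: "\<phi> t x = x" if "x \<in> Fix" for t x using that by (simp add: \<phi>_def)
  have below: "\<phi> t x < z" if "t \<in> {0..1}" "x < z" "z \<in> Fix" for t x z
    using between(2)[OF that(1), of x] that(2) less_iff[of x z] fixD[OF that(3)] by (auto simp: max_def split: if_splits)
  have above: "z < \<phi> t x" if "t \<in> {0..1}" "z < x" "z \<in> Fix" for t x z
    using between(1)[OF that(1), of x] that(2) less_iff[of z x] fixD[OF that(3)] by (auto simp: min_def split: if_splits)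
  have smono: "strict_mono (\<phi> t)" if t: "t \<in> {0..1}" for t
  proof (rule strict_monoI)
    fix x y :: extended_ray assume xy: "x < y"
    show "\<phi> t x < \<phi> t y"
    \<comment> \<open>A fixed point between \<open>x\<close> and \<open>y\<close> separates their
      images; without one, both lie in the same component and are compared through its
      coordinate.\<close>
    proof (cases "\<exists>z\<in>Fix. x \<le> z \<and> z \<le> y")
      case True
      then obtain z where z: "z \<in> Fix" "x \<le> z" "z \<le> y" by blast
      show ?thesis
      proof (cases "x = z")
        case True
        then show ?thesis using above[OF t xy] z \<phi>fix by simp
      next
        case False
        then have "\<phi> t x < z" using below[OF t _ z(1)] z by simp
        moreover have "z \<le> \<phi> t y" using above[OF t _ z(1), of y] z \<phi>fix by (cases "z = y") (auto simp: less_imp_le)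
        ultimately show ?thesis by simp
      qed
    next
      case False
      then have n: "x \<notin> Fix" "y \<notin> Fix" using xy by auto
      have "y < up x" using False up[of x] by (meson not_le)
      then have u: "up y = up x" using comp(2)[OF n(1)] lo(2)[of x] xy by simp
      have yW: "y \<in> W (up x)" "\<theta> y \<in> W (up x)" using xW[OF n(2)] u by simp_all
      have k: "K (up x) x < K (up x) y" "K (up x) (\<theta> x) < K (up x) (\<theta> y)"
        using K_less xW[OF n(1)] yW xy less_iff by simp_all
      have "v t x < v t y"
      \<comment> \<open>At \<open>t = 0\<close> the second summand of \<open>v\<close> vanishes and
        strictness has to come from the first; otherwise the second provides it.\<close>
      proof (cases "t = 0")
        case True
        then show ?thesis using k u by (simp add: v_def)
      next
        case False
        then have "t * K (up x) (\<theta> x) < t * K (up x) (\<theta> y)" using k t by simp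
        moreover have "(1 - t) * K (up x) x \<le> (1 - t) * K (up x) y" using k t by (intro mult_left_mono) auto
        ultimately show ?thesis by (simp add: v_def u)
      qed
      then have "K (up x) (\<phi> t x) < K (up x) (\<phi> t y)" using n u KJ(1) by (simp add: \<phi>_def)
      then show ?thesis using K_less[of "\<phi> t x" "up x" "\<phi> t y"] KJ(2) n u by (simp add: \<phi>_def)
    qed
  qed
  have jcont: "continuous_on (UNIV \<times> {0..1}) (\<lambda>p. \<phi> (snd p) (fst p))"
    unfolding continuous_on_def
  proof
    fix p :: "extended_ray \<times> real" assume p: "p \<in> UNIV \<times> {0..1}"
    define S :: "(extended_ray \<times> real) set" where "S = UNIV \<times> {0..1}"
    have tt: "\<forall>\<^sub>F q in at p within S. snd q \<in> {0..1}"
      unfolding eventually_at_filter by (rule always_eventually) (auto simp: S_def)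
    show "((\<lambda>p. \<phi> (snd p) (fst p)) \<longlongrightarrow> \<phi> (snd p) (fst p)) (at p within UNIV \<times> {0..1})"
      unfolding S_def[symmetric]
    proof (cases "fst p \<in> Fix")
      case True
      have f: "(fst \<longlongrightarrow> fst p) (at p within S)" by (intro tendsto_intros)
      have "isCont \<theta> (fst p)" using cont continuous_on_eq_continuous_at by blast
      then have th: "((\<lambda>q. \<theta> (fst q)) \<longlongrightarrow> \<theta> (fst p)) (at p within S)"
        using f by (rule isCont_tendsto_compose)
      have eqs: "\<phi> (snd p) (fst p) = fst p" "\<theta> (fst p) = fst p" using True \<phi>fix fixD by auto
      show "((\<lambda>p. \<phi> (snd p) (fst p)) \<longlongrightarrow> \<phi> (snd p) (fst p)) (at p within S)"
        unfolding eqs(1)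
      proof (rule order_tendstoI)
        fix a assume a: "a < fst p"
        then have a': "a < \<theta> (fst p)" using eqs(2) by simp
        show "\<forall>\<^sub>F q in at p within S. a < \<phi> (snd q) (fst q)"
          using order_tendstoD(1)[OF f a] order_tendstoD(1)[OF th a'] tt
        proof eventually_elim
          case (elim q)
          then show ?case using between(1)[of "snd q" "fst q"] by (auto simp: min_def split: if_splits)
        qed
      next
        fix a assume a: "fst p < a"
        then have a': "\<theta> (fst p) < a" using eqs(2) by simp
        show "\<forall>\<^sub>F q in at p within S. \<phi> (snd q) (fst q) < a"
          using order_tendstoD(2)[OF f a] order_tendstoD(2)[OF th a'] tt
        proof eventually_elim
          case (elim q)
          then show ?case using between(2)[of "snd q" "fst q"] by (auto simp: max_def split: if_splits)
        qed
      qed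
    next
      case False
      define x where "x = fst p"
      define O' where "O' = {lo x<..<up x}"
      have xF: "x \<notin> Fix" using False by (simp add: x_def)
      have xO: "x \<in> O'" using up_less[OF xF] lo_less[OF xF] by (simp add: O'_def)
      have OW: "O' \<subseteq> W (up x)" using inW[OF xF] by (auto simp: O'_def)
      have \<theta>O: "\<theta> y \<in> W (up x)" if "y \<in> O'" for y
        using xW(2)[of y] comp[OF xF, of y] that by (simp add: O'_def)
      have cK: "continuous_on (W (up x)) (K (up x))" and cJ: "continuous_on UNIV (J (up x))"
        using hom by (auto simp: homeomorphism_def)
      have cf: "continuous_on (O' \<times> {0..1}) (\<lambda>q. K (up x) (fst q))"
        by (rule continuous_on_compose2[OF cK continuous_on_fst[OF continuous_on_id]]) (use OW in auto)
      have cth: "continuous_on (O' \<times> {0..1}) (\<lambda>q. K (up x) (\<theta> (fst q)))"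
        by (rule continuous_on_compose2[OF cK continuous_on_compose2[OF cont continuous_on_fst[OF continuous_on_id]]])
           (use \<theta>O in auto)
      have "continuous_on (O' \<times> {0..1}) (\<lambda>q. J (up x) ((1 - snd q) * K (up x) (fst q) + snd q * K (up x) (\<theta> (fst q))))"
        by (rule continuous_on_compose2[OF cJ]) (intro continuous_intros cf cth, simp)
      then have "continuous_on (O' \<times> {0..1}) (\<lambda>p. \<phi> (snd p) (fst p))"
      proof (rule continuous_on_eq)
        fix q :: "extended_ray \<times> real" assume "q \<in> O' \<times> {0..1}"
        then have "fst q \<notin> Fix" "up (fst q) = up x" using comp[OF xF, of "fst q"] by (auto simp: O'_def)
        then show "J (up x) ((1 - snd q) * K (up x) (fst q) + snd q * K (up x) (\<theta> (fst q))) = \<phi> (snd q) (fst q)"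
          by (simp add: \<phi>_def v_def)
      qed
      moreover have "p \<in> O' \<times> {0..1}" using p xO by (auto simp: x_def)
      ultimately have "((\<lambda>p. \<phi> (snd p) (fst p)) \<longlongrightarrow> \<phi> (snd p) (fst p)) (at p within O' \<times> {0..1})"
        unfolding continuous_on_def by blast
      moreover have "at p within O' \<times> {0..1} = at p within S"
      proof (rule at_within_nhd)
        show "p \<in> O' \<times> UNIV" using xO by (cases p) (simp add: x_def)
        show "open (O' \<times> (UNIV :: real set))" unfolding O'_def by (intro open_Times) auto
        show "O' \<times> {0..1} \<inter> O' \<times> UNIV - {p} = S \<inter> O' \<times> UNIV - {p}" by (auto simp: S_def)
      qed
      ultimately show "((\<lambda>p. \<phi> (snd p) (fst p)) \<longlongrightarrow> \<phi> (snd p) (fst p)) (at p within S)" by simp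
    qed
  qed
  have surj\<phi>: "\<phi> t ` UNIV = UNIV" if t: "t \<in> {0..1}" for t
  proof (intro equalityI subsetI UNIV_I)
    fix y :: extended_ray
    \<comment> \<open>Both \<open>bottom\<close> and the point \<open>u\<close> beyond
      \<open>y\<close> stay fixed, so the intermediate value theorem yields a preimage of
      \<open>y\<close>.\<close>
    obtain u where u: "y < u" "u \<in> Fix" using unboundedD[OF unb, of y] by (auto simp: Fix_def)
    have bF: "bottom \<in> Fix" using low e by (simp add: Fix_def)
    have "continuous_on {bottom..u} (\<lambda>x. (\<lambda>p. \<phi> (snd p) (fst p)) (x, t))"
      by (rule continuous_on_compose2[OF jcont]) (use t in \<open>auto intro!: continuous_intros\<close>)
    then have "continuous_on {bottom..u} (\<phi> t)" by simp
    then obtain x where "\<phi> t x = y"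
      using IVT'[of "\<phi> t" bottom y u] \<phi>fix[OF bF] \<phi>fix[OF u(2)] less_imp_le[OF u(1)] by auto
    then show "y \<in> range (\<phi> t)" by blast
  qed
  have "isotopy \<phi>"
  proof (rule isotopyI)
    show "continuous_on (UNIV \<times> {0..1}) (\<lambda>(y, t). \<phi> t y)" using jcont by (simp add: case_prod_unfold)
    fix t :: real assume t: "t \<in> {0..1}"
    show "\<exists>g. homeomorphism UNIV UNIV (\<phi> t) g"
      using strict_mono_on_homeomorphism[OF smono[OF t]] surj\<phi>[OF t] by auto
  qed
  moreover have "\<phi> 0 x = id x" for x using JK xW(1)[of x] by (simp add: \<phi>_def v_def)
  then have "\<phi> 0 = id" by blast
  moreover have "\<phi> 1 x = \<theta> x" for x using JK xW(2)[of x] fixD[of x] by (simp add: \<phi>_def v_def)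
  then have "\<phi> 1 = \<theta>" by blast
  ultimately show ?thesis by blast
qed

section \<open>Knot equivalence is an equivalence relation\<close>

lemma isotopy_id: "isotopy (\<lambda>t y. y)"
proof (rule isotopyI)
  show "continuous_on (UNIV \<times> {0..1::real}) (\<lambda>(y, t). y)"
    unfolding case_prod_unfold by (intro continuous_intros)
  show "\<exists>g. homeomorphism UNIV UNIV (\<lambda>y. y) g" using homeomorphism_ident by blast
qed

lemma knot_equiv_refl: "knot_equiv f f"
  unfolding knot_equiv_def using isotopy_id by (intro exI[of _ "\<lambda>t y. y"]) (auto simp: id_def)

lemma knot_equivI:
  assumes "isotopy \<phi>" "\<phi> 0 = id" "\<And>x. \<phi> 1 (extend_vec (f x)) = extend_vec (g x)"
  shows "knot_equiv f g"
  unfolding knot_equiv_def using assms by (intro exI[of _ \<phi>]) (auto simp: fun_eq_iff)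

lemma knot_equivE:
  fixes f g :: "long_ray \<Rightarrow> long_ray ^ 'n"
  assumes "knot_equiv f g"
  obtains \<phi> where "isotopy \<phi>" "\<phi> 0 = id" "\<And>x. \<phi> 1 (extend_vec (f x)) = extend_vec (g x)"
  using assms unfolding knot_equiv_def by (auto simp: fun_eq_iff)

lemma isotopy_continuous_reparam:
  assumes "isotopy \<phi>" "continuous_on S u" "continuous_on S w" "\<And>z. z \<in> S \<Longrightarrow> w z \<in> {0..1}"
  shows "continuous_on S (\<lambda>z. \<phi> (w z) (u z))"
proof -
  have "continuous_on (UNIV \<times> {0..1}) (\<lambda>(y, t). \<phi> t y)" using assms(1) by (simp add: isotopy_def)
  then have "continuous_on S (\<lambda>z. (\<lambda>(y, t). \<phi> t y) (u z, w z))"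
    by (rule continuous_on_compose2) (use assms in \<open>auto intro!: continuous_on_Pair\<close>)
  then show ?thesis by simp
qed

text \<open>The isotopy is run backwards after the inverse \<open>h\<close> of its end map, which is
  jointly continuous at once; inverting every stage would call for continuity of the inverses in
  time.\<close>

lemma knot_equiv_sym:
  assumes "knot_equiv f g"
  shows "knot_equiv g f"
proof -
  obtain \<phi> where \<phi>: "isotopy \<phi>" "\<phi> 0 = id" "\<And>x. \<phi> 1 (extend_vec (f x)) = extend_vec (g x)"
    by (rule knot_equivE[OF assms]) blast
  have "\<exists>h. homeomorphism UNIV UNIV (\<phi> 1) h" using \<phi>(1) by (simp add: isotopy_def)
  then obtain h where h: "homeomorphism UNIV UNIV (\<phi> 1) h" by blast
  show ?thesis
  proof (rule knot_equivI[of "\<lambda>t y. \<phi> (1 - t) (h y)"])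
    show "isotopy (\<lambda>t y. \<phi> (1 - t) (h y))"
    proof (rule isotopyI)
      show "continuous_on (UNIV \<times> {0..1}) (\<lambda>(y, t). \<phi> (1 - t) (h y))"
        unfolding case_prod_unfold
        by (rule isotopy_continuous_reparam[OF \<phi>(1)])
           (auto intro!: continuous_intros continuous_on_compose2[OF homeomorphism_cont2[OF h]])
      fix t :: real assume "t \<in> {0..1}"
      then have "1 - t \<in> {0..1}" by simp
      then obtain k where k: "homeomorphism UNIV UNIV (\<phi> (1 - t)) k" using \<phi>(1) unfolding isotopy_def by blast
      show "\<exists>g. homeomorphism UNIV UNIV (\<lambda>y. \<phi> (1 - t) (h y)) g"
        using homeomorphism_compose[OF homeomorphism_symD[OF h] k] by (auto simp: comp_def)
    qed
    show "(\<lambda>y. \<phi> (1 - 0) (h y)) = id" using homeomorphism_apply2[OF h] by auto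
    show "\<phi> (1 - 1) (h (extend_vec (g x))) = extend_vec (f x)" for x
      using \<phi>(2) homeomorphism_apply1[OF h, of "extend_vec (f x)"] \<phi>(3)[of x] by simp
  qed
qed

text \<open>Stages are composed at equal times, which avoids pasting two time intervals.\<close>

lemma knot_equiv_trans:
  assumes "knot_equiv f g" "knot_equiv g k"
  shows "knot_equiv f k"
proof -
  obtain \<phi> where \<phi>: "isotopy \<phi>" "\<phi> 0 = id" "\<And>x. \<phi> 1 (extend_vec (f x)) = extend_vec (g x)"
    by (rule knot_equivE[OF assms(1)]) blast
  obtain \<psi> where \<psi>: "isotopy \<psi>" "\<psi> 0 = id" "\<And>x. \<psi> 1 (extend_vec (g x)) = extend_vec (k x)"
    by (rule knot_equivE[OF assms(2)]) blast
  show ?thesis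
  proof (rule knot_equivI[of "\<lambda>t y. \<psi> t (\<phi> t y)"])
    show "isotopy (\<lambda>t y. \<psi> t (\<phi> t y))"
    proof (rule isotopyI)
      have "continuous_on (UNIV \<times> {0..1}) (\<lambda>z. \<phi> (snd z) (fst z))"
        by (rule isotopy_continuous_reparam[OF \<phi>(1)]) (auto intro!: continuous_intros)
      then show "continuous_on (UNIV \<times> {0..1}) (\<lambda>(y, t). \<psi> t (\<phi> t y))"
        unfolding case_prod_unfold
        by (rule isotopy_continuous_reparam[OF \<psi>(1)]) (auto intro!: continuous_intros)
      fix t :: real assume t: "t \<in> {0..1}"
      obtain a where a: "homeomorphism UNIV UNIV (\<phi> t) a" using \<phi>(1) t unfolding isotopy_def by blast
      obtain b where b: "homeomorphism UNIV UNIV (\<psi> t) b" using \<psi>(1) t unfolding isotopy_def by blast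
      show "\<exists>g. homeomorphism UNIV UNIV (\<lambda>y. \<psi> t (\<phi> t y)) g"
        using homeomorphism_compose[OF a b] by (auto simp: comp_def)
    qed
  qed (auto simp: \<phi> \<psi>)
qed

section \<open>Coordinates of knots\<close>

text \<open>The segment up to \<open>b\<close> is compact, so \<open>f\<close> is bounded there and
  large values have to occur later.\<close>

lemma unbounded_range_values:
  fixes f :: "long_ray \<Rightarrow> 'b::linorder_topology"
  assumes f: "continuous_on UNIV f" and u: "unbounded (range f)"
  shows "unbounded {x. c \<le> f x}"
proof (rule unboundedI)
  fix b :: long_ray
  obtain m where m: "\<forall>x\<in>{origin..b}. f x \<le> m"
    using continuous_bounded_segment[OF continuous_on_subset[OF f subset_UNIV]] by blast
  obtain x where x: "max m c < f x" using unboundedD[OF u, of "max m c"] by blast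
  have "\<not> x \<le> b"
  proof
    assume "x \<le> b"
    then have "f x \<le> m" using m origin_le by simp
    then show False using x by (auto dest: leD)
  qed
  then show "\<exists>x\<in>{x. c \<le> f x}. b < x" using x by (intro bexI[of _ x]) auto
qed

text \<open>For \<open>c < c'\<close> the closed sets of points with \<open>f x \<le> c\<close> and
  with \<open>c' \<le> f x\<close> are disjoint, so they cannot both be unbounded; the second one
  is.\<close>

lemma eventually_large:
  fixes f :: "long_ray \<Rightarrow> long_ray"
  assumes f: "continuous_on UNIV f" and u: "unbounded (range f)"
  shows "\<exists>d. \<forall>x\<ge>d. c < f x"
proof -
  obtain c' where c': "c < c'" using gt_ex by blast
  have "closed {x. f x \<le> c}" "closed {x. c' \<le> f x}"
    by (intro closed_Collect_le f continuous_on_const)+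
  then have "\<not> unbounded {x. f x \<le> c}"
    using club_Int[of "{x. f x \<le> c}" "{x. c' \<le> f x}"] unbounded_range_values[OF f u, of c'] c'
    by (force simp: unbounded_def)
  then obtain b where b: "\<forall>x\<in>{x. f x \<le> c}. x \<le> b" using not_unboundedD by blast
  obtain d where d: "b < d" using gt_ex by blast
  have "c < f x" if "d \<le> x" for x
  proof (rule ccontr)
    assume "\<not> c < f x"
    then have "x \<le> b" using b by simp
    then show False using d that by simp
  qed
  then show ?thesis by blast
qed

text \<open>A real coordinate \<open>h\<close> on the bounded range brings in the rationals. For
  \<open>p < q\<close> one of the closed sets given by \<open>h (f x) \<le> p\<close> and
  \<open>q \<le> h (f x)\<close> is bounded. The thresholds of the countably many rational pairs lie
  below one \<open>d\<close>, and beyond \<open>d\<close> two different values would be separated by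
  such a pair.\<close>

lemma eventually_constant:
  fixes f :: "long_ray \<Rightarrow> long_ray"
  assumes A: "maximal_smooth_atlas A"
    and f: "continuous_on UNIV f" and b: "\<not> unbounded (range f)"
  shows "\<exists>d p. \<forall>x\<ge>d. f x = p"
proof -
  obtain b where b: "\<And>x. f x \<le> b" using not_unboundedD[OF b] by auto
  obtain h where h: "chart_coordinate A {..b} h" using chart_coordinate_exists[OF A] by blast
  have mono: "strict_mono_on {..b} h" using h by (simp add: chart_coordinate_def)
  have hf: "continuous_on UNIV (\<lambda>x. h (f x))"
    by (rule continuous_on_compose2[OF chart_coordinate_continuous[OF A h] f]) (use b in auto)
  define B where "B p q c \<longleftrightarrow> (\<forall>x\<ge>c. p < h (f x)) \<or> (\<forall>x\<ge>c. h (f x) < q)" for p q :: real and c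
  have "\<exists>c. B p q c" if pq: "p < q" for p q
  proof -
    have "closed {x. h (f x) \<le> p}" "closed {x. q \<le> h (f x)}"
      by (intro closed_Collect_le hf continuous_on_const)+
    then have "\<not> unbounded {x. h (f x) \<le> p} \<or> \<not> unbounded {x. q \<le> h (f x)}"
      using club_Int[of "{x. h (f x) \<le> p}" "{x. q \<le> h (f x)}"] pq
      by (force simp: unbounded_def)
    then obtain c0 where c0: "(\<forall>x\<in>{x. h (f x) \<le> p}. x \<le> c0) \<or> (\<forall>x\<in>{x. q \<le> h (f x)}. x \<le> c0)"
      using not_unboundedD by blast
    obtain c where c: "c0 < c" using gt_ex by blast
    have "B p q c"
      using c0 c unfolding B_def by (meson leD leI le_less_trans mem_Collect_eq)
    then show ?thesis ..
  qed
  then obtain c where c: "\<And>p q. p < q \<Longrightarrow> B p q (c p q)" by metis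
  have "countable ((\<lambda>(p, q). c p q) ` (\<rat> \<times> \<rat>))"
    by (intro countable_image countable_SIGMA countable_rat)
  then obtain d where d: "\<forall>y\<in>(\<lambda>(p, q). c p q) ` (\<rat> \<times> \<rat>). y < d"
    using countable_strictly_bounded by blast
  have no: "\<not> h (f x) < h (f y)" if "d \<le> x" "d \<le> y" for x y
  proof
    assume l: "h (f x) < h (f y)"
    obtain q where q: "q \<in> \<rat>" "h (f x) < q" "q < h (f y)" using Rats_dense_in_real[OF l] by blast
    obtain p where p: "p \<in> \<rat>" "h (f x) < p" "p < q" using Rats_dense_in_real[OF q(2)] by blast
    have "c p q < d" using d p q by blast
    then have "c p q \<le> x" "c p q \<le> y" using that by auto
    then have "p < h (f x) \<or> h (f y) < q" using c[OF p(3)] unfolding B_def by blast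
    then show False using p q by auto
  qed
  have "f x = f d" if "d \<le> x" for x
  proof (rule ccontr)
    assume "f x \<noteq> f d"
    then have "f x < f d \<or> f d < f x" by auto
    then have "h (f x) < h (f d) \<or> h (f d) < h (f x)"
      using strict_mono_onD[OF mono, of "f x" "f d"] strict_mono_onD[OF mono, of "f d" "f x"] b by auto
    then show False using no[of x d] no[of d x] that by auto
  qed
  then show ?thesis by blast
qed

text \<open>A sequence with \<open>x n < f (x (Suc n)) \<le> x (Suc (Suc n))\<close> squeezes the
  values of \<open>f\<close> between its own terms; by continuity its limit is a fixed
  point.\<close>

lemma fixed_points_unbounded:
  fixes f :: "long_ray \<Rightarrow> long_ray"
  assumes f: "continuous_on UNIV f" and u: "unbounded (range f)"
  shows "unbounded {x. f x = x}"
proof (rule unboundedI)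
  fix b :: long_ray
  have "\<exists>y>x. (\<forall>z\<ge>y. x < f z) \<and> f x \<le> y" for x
  proof -
    obtain d where d: "\<forall>z\<ge>d. x < f z" using eventually_large[OF f u] by blast
    obtain y where "max x (max d (f x)) < y" using gt_ex by blast
    then show ?thesis using d by (intro exI[of _ y]) auto
  qed
  then obtain s where s: "\<And>x. x < s x" "\<And>x z. s x \<le> z \<Longrightarrow> x < f z" "\<And>x. f x \<le> s x" by metis
  define x where "x = rec_nat b (\<lambda>n. s)"
  have xS: "x (Suc n) = s (x n)" for n by (simp add: x_def)
  have "x n < x (Suc n)" for n using s(1) xS by simp
  then obtain l where l: "x \<longlonglongrightarrow> l" "\<And>n. x n < l" by (rule strict_seq_converges) blast
  have "isCont f l" using f continuous_on_eq_continuous_at by blast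
  then have "(\<lambda>n. f (x (Suc n))) \<longlonglongrightarrow> f l"
    using isCont_tendsto_compose[OF _ LIMSEQ_Suc[OF l(1)]] by blast
  moreover have "(\<lambda>n. f (x (Suc n))) \<longlonglongrightarrow> l"
  proof (rule order_tendstoI)
    fix a assume "a < l"
    then have "\<forall>\<^sub>F n in sequentially. a < x n" using order_tendstoD(1)[OF l(1)] by blast
    then show "\<forall>\<^sub>F n in sequentially. a < f (x (Suc n))"
    proof eventually_elim
      case (elim n)
      then show ?case using s(2)[of "x n" "x (Suc n)"] xS by simp
    qed
  next
    fix a assume a: "l < a"
    have "f (x (Suc n)) < a" for n
      using s(3)[of "x (Suc n)"] xS[of "Suc n"] l(2)[of "Suc (Suc n)"] a by simp
    then show "\<forall>\<^sub>F n in sequentially. f (x (Suc n)) < a" by simp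
  qed
  ultimately have "f l = l" using LIMSEQ_unique by blast
  moreover have "b < l" using l(2)[of 0] by (simp add: x_def)
  ultimately show "\<exists>x\<in>{x. f x = x}. b < x" by blast
qed

section \<open>Monotonicity of unbounded coordinates\<close>

lemma injective_interval_monotone:
  fixes \<psi> :: "'a::linear_continuum_topology \<Rightarrow> real"
  assumes cont: "continuous_on {a..b} \<psi>" and inj: "inj_on \<psi> {a..b}"
  shows "(\<forall>x y. a \<le> x \<longrightarrow> x < y \<longrightarrow> y \<le> b \<longrightarrow> \<psi> x < \<psi> y) \<or>
         (\<forall>x y. a \<le> x \<longrightarrow> x < y \<longrightarrow> y \<le> b \<longrightarrow> \<psi> y < \<psi> x)"
proof -
  have main: "\<psi> x < \<psi> y" if c: "continuous_on {a..b} \<psi>" "inj_on \<psi> {a..b}" and ab: "\<psi> a < \<psi> b"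
    and xy: "a \<le> x" "x < y" "y \<le> b" for \<psi> :: "'a \<Rightarrow> real" and x y
  proof -
    have ay: "a < y" using xy by simp
    have 1: "\<psi> a < \<psi> y"
    proof (cases "y = b")
      case False
      then have "y < b" using xy by simp
      then show ?thesis using continuous_inj_imp_mono[OF ay _ c] ab by force
    qed (use ab in simp)
    show ?thesis
    proof (cases "x = a")
      case False
      then have "a < x" using xy by simp
      moreover have "continuous_on {a..y} \<psi>" by (rule continuous_on_subset[OF c(1)]) (use xy in auto)
      moreover have "inj_on \<psi> {a..y}" by (rule inj_on_subset[OF c(2)]) (use xy in auto)
      ultimately show ?thesis using continuous_inj_imp_mono[of a x y \<psi>] xy 1 by force
    qed (use 1 in simp)
  qed
  show ?thesis
  proof (cases "a < b")
    case True
    then have "\<psi> a \<noteq> \<psi> b" using inj_onD[OF inj, of a b] by (auto simp: less_imp_le)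
    then consider "\<psi> a < \<psi> b" | "- \<psi> a < - \<psi> b" by linarith
    then show ?thesis
    proof cases
      case 1
      then show ?thesis using main[OF cont inj] by blast
    next
      case 2
      have "continuous_on {a..b} (\<lambda>x. - \<psi> x)" using cont by (intro continuous_intros)
      moreover have "inj_on (\<lambda>x. - \<psi> x) {a..b}" using inj by (simp add: inj_on_def)
      ultimately show ?thesis using main[of "\<lambda>x. - \<psi> x"] 2 by force
    qed
  qed force
qed

lemma smooth_knotD:
  assumes "smooth_knot A f"
  shows "continuous_on UNIV f" "inj f"
proof -
  obtain g where g: "homeomorphism UNIV (range f) f g" using assms unfolding smooth_knot_def by blast
  show "continuous_on UNIV f" using homeomorphism_cont1[OF g] .
  show "inj f" by (rule inj_on_inverseI) (rule homeomorphism_apply1[OF g])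
qed

text \<open>Unfolds smoothness of the knot once for both uses below; \<open>L\<close> is its
  expression in a source chart and a product chart of the target, and \<open>D\<close> lists the
  derivatives.\<close>

lemma knot_local_derivatives:
  fixes f :: "long_ray \<Rightarrow> long_ray ^ 'n"
  assumes A: "maximal_smooth_atlas A" and f: "smooth_knot A f"
    and U: "(U, \<psi>) \<in> A" and V: "(V, \<eta>) \<in> A" and N: "N = {x \<in> U. \<forall>j. f x $ j \<in> V}"
  obtains L D where "open N" "\<And>x j. x \<in> N \<Longrightarrow> L (\<psi> x) $ j = \<eta> (f x $ j)" "D 0 = L"
    "\<And>k s. s \<in> \<psi> ` N \<Longrightarrow> (D k has_vector_derivative D (Suc k) s) (at s within \<psi> ` N)"
proof -
  have chU: "is_chart (U, \<psi>)" and chV: "is_chart (V, \<eta>)" using atlas_chart[OF A] U V by auto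
  note cU = is_chartD[OF chU] and cV = is_chartD[OF chV]
  have "N = U \<inter> (\<Inter>j. (\<lambda>x. f x $ j) -` V)" by (auto simp: N)
  then have opN: "open N"
    using cU(1) cV(1) by (auto intro!: open_Int open_INT open_vimage continuous_on_component smooth_knotD[OF f])
  define L where "L = local_expr (U, \<psi>) (V, \<eta>) f"
  have dom: "local_dom (U, \<psi>) (V, \<eta>) f = \<psi> ` N" by (simp add: local_dom_def N)
  have L: "L (\<psi> x) $ j = \<eta> (f x $ j)" if "x \<in> N" for x j
    using that the_inv_into_f_f[OF cU(3)] by (auto simp: L_def local_expr_def N)
  have "smooth_on (\<psi> ` N) L" using f U V unfolding smooth_knot_def L_def dom[symmetric] by blast
  then obtain D where D: "D 0 = L"
    "\<And>k s. s \<in> \<psi> ` N \<Longrightarrow> (D k has_vector_derivative D (Suc k) s) (at s within \<psi> ` N)"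
    unfolding smooth_on_def by blast
  show ?thesis by (rule that[OF opN L D])
qed

text \<open>Since the \<open>i\<close>-th coordinate fixes a sequence converging to \<open>z\<close>, its derivative at \<open>z\<close> in
  a chart is 1.\<close>

lemma increasing_near_fixed_limit:
  fixes f :: "long_ray \<Rightarrow> long_ray ^ 'n"
  assumes A: "maximal_smooth_atlas A" and f: "smooth_knot A f"
    and c: "c \<longlonglongrightarrow> z" "\<And>n. c n < z" and fc: "\<And>n. f (c n) $ i = c n" and fl: "f z $ i = z"
  shows "\<exists>l<z. \<forall>x y. l \<le> x \<longrightarrow> x < y \<longrightarrow> y \<le> z \<longrightarrow> f x $ i < f y $ i"
proof -
  \<comment> \<open>One chart domain contains all coordinates of \<open>f z\<close>. Among them is
    \<open>z\<close> itself, so the same \<open>\<eta>\<close> can serve as source chart and as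
    target chart of coordinate \<open>i\<close>.\<close>
  obtain V \<eta> where V: "(V, \<eta>) \<in> A" "range (\<lambda>j. f z $ j) \<subseteq> V"
    using common_chart[OF A, of "range (\<lambda>j. f z $ j)"] by auto
  have lV: "z \<in> V" using V(2) fl by (metis rangeI subsetD)
  have ch: "is_chart (V, \<eta>)" using atlas_chart[OF A V(1)] .
  note cV = is_chartD[OF ch]
  have contj: "continuous_on UNIV (\<lambda>x. f x $ j)" for j
    by (intro continuous_on_component smooth_knotD[OF f])
  define N where "N = {x \<in> V. \<forall>j. f x $ j \<in> V}"
  obtain L D where opN: "open N" and L: "\<And>x j. x \<in> N \<Longrightarrow> L (\<eta> x) $ j = \<eta> (f x $ j)" and D: "D 0 = L"
    "\<And>k s. s \<in> \<eta> ` N \<Longrightarrow> (D k has_vector_derivative D (Suc k) s) (at s within \<eta> ` N)"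
    by (rule knot_local_derivatives[OF A f V(1) V(1) N_def]) blast
  have lN: "z \<in> N" using lV V(2) by (auto simp: N_def)
  have NV: "N \<subseteq> V" by (auto simp: N_def)
  have Di: "((\<lambda>s. D k s $ i) has_real_derivative D (Suc k) s $ i) (at s within \<eta> ` N)"
    if "s \<in> \<eta> ` N" for k s
    using bounded_linear.has_vector_derivative[OF bounded_linear_vec_nth[of i] D(2)[OF that]]
    by (simp add: has_real_derivative_iff_has_vector_derivative)
  define g where "g s = L s $ i" for s
  define g' where "g' s = D 1 s $ i" for s
  have gd: "(g has_real_derivative g' s) (at s within \<eta> ` N)" if "s \<in> \<eta> ` N" for s
    using Di[OF that, of 0] D(1) by (simp add: g_def[abs_def] g'_def)
  have l\<eta>: "\<eta> z \<in> \<eta> ` N" using lN by blast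
  have fil: "filterlim \<eta> (at (\<eta> z) within \<eta> ` N) (at z)" by (rule filterlim_chart[OF ch opN NV lN])
  have cat: "filterlim c (at z) sequentially"
    using c by (simp add: filterlim_at less_imp_neq)
  have g'1: "g' (\<eta> z) = 1"
  proof -
    have "((\<lambda>s. (g s - g (\<eta> z)) / (s - \<eta> z)) \<longlongrightarrow> g' (\<eta> z)) (at (\<eta> z) within \<eta> ` N)"
      using gd[OF l\<eta>] by (simp add: has_field_derivative_iff)
    then have "(\<lambda>n. (g (\<eta> (c n)) - g (\<eta> z)) / (\<eta> (c n) - \<eta> z)) \<longlonglongrightarrow> g' (\<eta> z)"
      by (rule filterlim_compose[OF _ filterlim_compose[OF fil cat]])
    moreover have "\<forall>\<^sub>F n in sequentially. c n \<in> N" using topological_tendstoD[OF c(1) opN lN] .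
    then have "\<forall>\<^sub>F n in sequentially. (g (\<eta> (c n)) - g (\<eta> z)) / (\<eta> (c n) - \<eta> z) = 1"
    proof eventually_elim
      case (elim n)
      have "\<eta> (c n) \<noteq> \<eta> z" using inj_onD[OF cV(3), of "c n" z] c(2)[of n] elim NV lV by auto
      then show ?case using L[OF elim] L[OF lN] fc fl by (simp add: g_def)
    qed
    then have "(\<lambda>n. (g (\<eta> (c n)) - g (\<eta> z)) / (\<eta> (c n) - \<eta> z)) \<longlonglongrightarrow> 1"
      by (rule tendsto_eventually)
    ultimately show ?thesis using LIMSEQ_unique by blast
  qed
  \<comment> \<open>The second derivative exists, so the first is continuous and its positivity
    spreads from \<open>z\<close> to a neighbourhood.\<close>
  have "continuous (at (\<eta> z) within \<eta> ` N) g'"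
    using Di[OF l\<eta>, of 1] unfolding g'_def by (rule DERIV_continuous)
  then have "(g' \<longlongrightarrow> 1) (at (\<eta> z) within \<eta> ` N)" using g'1 by (simp add: continuous_within)
  then have "\<forall>\<^sub>F s in at (\<eta> z) within \<eta> ` N. 0 < g' s" by (rule order_tendstoD) simp
  then have pos: "\<forall>\<^sub>F x in at z. 0 < g' (\<eta> x)" by (rule eventually_compose_filterlim[OF _ fil])
  obtain l0 where l0: "l0 < z" "{l0<..z} \<subseteq> V" using open_left[OF cV(1) lV c(2)[of 0]] by blast
  obtain u' where "z < u'" using gt_ex by blast
  then obtain u0 where u0: "z < u0" "{z..<u0} \<subseteq> V" using open_right[OF cV(1) lV] by blast
  obtain l1 where l1: "l0 < l1" "l1 < z" using dense[OF l0(1)] by blast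
  obtain u1 where u1: "z < u1" "u1 < u0" using dense[OF u0(1)] by blast
  have "{l1..u1} \<subseteq> {l0<..z} \<union> {z..<u0}" using l1 u1 by auto
  then have seg: "{l1..u1} \<subseteq> V" using l0 u0 by blast
  have ft: "((\<lambda>x. f x $ i) \<longlongrightarrow> z) (at z)"
    using contj[of i] fl continuous_on_eq_continuous_at[of UNIV] by (metis UNIV_I isCont_def open_UNIV)
  \<comment> \<open>Collects what a point near \<open>z\<close> has to satisfy: the derivative is
    positive, and both the point and its coordinate \<open>i\<close> lie where \<open>\<eta>\<close>
    is known to be monotone.\<close>
  define P where "P x \<longleftrightarrow> x \<in> N \<and> 0 < g' (\<eta> x) \<and> l1 < f x $ i \<and> f x $ i < u1 \<and> l1 < x" for x
  have "\<forall>\<^sub>F x in at z. x \<in> N" using opN lN by (intro eventually_at_in_open')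
  moreover have "\<forall>\<^sub>F x in at z. l1 < x" using order_tendstoD(1)[OF tendsto_ident_at l1(2)] .
  ultimately have "\<forall>\<^sub>F x in at z. P x"
    using pos order_tendstoD(1)[OF ft l1(2)] order_tendstoD(2)[OF ft u1(1)]
    by eventually_elim (simp add: P_def)
  then obtain T where T: "open T" "z \<in> T" "\<And>x. x \<in> T \<Longrightarrow> x \<noteq> z \<Longrightarrow> P x"
    unfolding eventually_at_topological by blast
  have "P z" using lN g'1 fl l1 u1 by (simp add: P_def)
  then have TP: "P x" if "x \<in> T" for x using T(3) that by blast
  obtain l2 where l2: "l2 < z" "{l2<..z} \<subseteq> T" using open_left[OF T(1,2) c(2)[of 0]] by blast
  obtain l where l: "l2 < l" "l < z" using dense[OF l2(1)] by blast
  have Pl: "P x" if "l \<le> x" "x \<le> z" for x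
  proof -
    have "x \<in> {l2<..z}" using that l by auto
    then show ?thesis using TP l2(2) by blast
  qed
  have incr: "g a < g b" if ab: "a < b" and J: "{a..b} \<subseteq> \<eta> ` {x. P x}" for a b
  proof (rule DERIV_pos_imp_increasing_open[OF ab])
    have J': "{a..b} \<subseteq> \<eta> ` N" using J by (auto simp: P_def)
    have gab: "(g has_real_derivative g' s) (at s within {a..b})" if "s \<in> {a..b}" for s
      using has_field_derivative_subset[OF gd J'] J' that by blast
    show "continuous_on {a..b} g" by (rule DERIV_continuous_on[OF gab])
    fix s assume s: "a < s" "s < b"
    have "at s within {a..b} = at s" using s by (simp add: at_within_Icc_at)
    then have "(g has_real_derivative g' s) (at s)" using gab[of s] s by simp
    moreover have "s \<in> \<eta> ` {x. P x}" using J s by auto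
    then have "0 < g' s" by (auto simp: P_def)
    ultimately show "\<exists>y. (g has_real_derivative y) (at s) \<and> 0 < y" by blast
  qed
  \<comment> \<open>By connectedness every real between two chart values is the chart value of a
    point in between, so the mean value argument never leaves the chart image.\<close>
  have img: "{min (\<eta> x) (\<eta> y)..max (\<eta> x) (\<eta> y)} \<subseteq> \<eta> ` {x. P x}" if xy: "l \<le> x" "x < y" "y \<le> z" for x y
  proof -
    have Pxy: "{x..y} \<subseteq> {x. P x}" using Pl xy by auto
    then have "{x..y} \<subseteq> V" using NV by (auto simp: P_def)
    then have "connected (\<eta> ` {x..y})"
      by (intro connected_continuous_image continuous_on_subset[OF cV(4)]) auto
    moreover have "min (\<eta> x) (\<eta> y) \<in> \<eta> ` {x..y}" "max (\<eta> x) (\<eta> y) \<in> \<eta> ` {x..y}"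
      using xy by (auto simp: min_def max_def)
    ultimately have "{min (\<eta> x) (\<eta> y)..max (\<eta> x) (\<eta> y)} \<subseteq> \<eta> ` {x..y}"
      by (rule connected_contains_Icc)
    then show ?thesis using Pxy by blast
  qed
  \<comment> \<open>The orientation of \<open>\<eta>\<close> is unknown, but source and target are
    read through the same chart, so a reversal occurs twice and cancels.\<close>
  have mono\<eta>: "(\<forall>x y. l1 \<le> x \<longrightarrow> x < y \<longrightarrow> y \<le> u1 \<longrightarrow> \<eta> x < \<eta> y) \<or>
         (\<forall>x y. l1 \<le> x \<longrightarrow> x < y \<longrightarrow> y \<le> u1 \<longrightarrow> \<eta> y < \<eta> x)"
    by (rule injective_interval_monotone[OF continuous_on_subset[OF cV(4) seg] inj_on_subset[OF cV(3) seg]])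
  have "f x $ i < f y $ i" if xy: "l \<le> x" "x < y" "y \<le> z" for x y
  proof -
    have P: "P x" "P y" using Pl[of x] Pl[of y] xy by auto
    have g: "g (\<eta> x) = \<eta> (f x $ i)" "g (\<eta> y) = \<eta> (f y $ i)" using L P by (auto simp: g_def P_def)
    have r: "l1 \<le> x" "y \<le> u1" "l1 \<le> f x $ i" "f x $ i \<le> u1" "l1 \<le> f y $ i" "f y $ i \<le> u1"
      using P xy u1 by (auto simp: P_def)
    show ?thesis
    proof (rule ccontr)
      assume "\<not> f x $ i < f y $ i"
      then have le: "f y $ i = f x $ i \<or> f y $ i < f x $ i" by auto
      from mono\<eta> show False
      proof
        assume m: "\<forall>x y. l1 \<le> x \<longrightarrow> x < y \<longrightarrow> y \<le> u1 \<longrightarrow> \<eta> x < \<eta> y"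
        then have "\<eta> x < \<eta> y" using r xy by blast
        then have "g (\<eta> x) < g (\<eta> y)" using incr[of "\<eta> x" "\<eta> y"] img[OF xy] by simp
        moreover have "\<eta> (f y $ i) \<le> \<eta> (f x $ i)" using le m r by (auto simp: less_imp_le)
        ultimately show False using g by simp
      next
        assume m: "\<forall>x y. l1 \<le> x \<longrightarrow> x < y \<longrightarrow> y \<le> u1 \<longrightarrow> \<eta> y < \<eta> x"
        then have "\<eta> y < \<eta> x" using r xy by blast
        then have "g (\<eta> y) < g (\<eta> x)" using incr[of "\<eta> y" "\<eta> x"] img[OF xy] by simp
        moreover have "\<eta> (f x $ i) \<le> \<eta> (f y $ i)" using le m r by (auto simp: less_imp_le)
        ultimately show False using g by simp
      qed
    qed
  qed
  then show ?thesis using l(2) by blast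
qed

lemma eventually_increasing:
  fixes f :: "long_ray \<Rightarrow> long_ray ^ 'n"
  assumes A: "maximal_smooth_atlas A" and f: "smooth_knot A f" and u: "unbounded (range (\<lambda>x. f x $ i))"
  shows "\<exists>d. \<forall>x y. d \<le> x \<longrightarrow> x < y \<longrightarrow> f x $ i < f y $ i"
proof (rule ccontr)
  assume "\<not> ?thesis"
  then have bad: "\<exists>x y. d \<le> x \<and> x < y \<and> \<not> f x $ i < f y $ i" for d by blast
  have cont: "continuous_on UNIV (\<lambda>x. f x $ i)" by (intro continuous_on_component smooth_knotD[OF f])
  have unb: "unbounded {x. f x $ i = x}" by (rule fixed_points_unbounded[OF cont u])
  have "\<exists>c' x y. c \<le> x \<and> x < y \<and> y < c' \<and> f c' $ i = c' \<and> \<not> f x $ i < f y $ i" for c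
  proof -
    obtain x y where xy: "c \<le> x" "x < y" "\<not> f x $ i < f y $ i" using bad by blast
    obtain c' where "y < c'" "f c' $ i = c'" using unboundedD[OF unb, of y] by blast
    then show ?thesis using xy by blast
  qed
  \<comment> \<open>A violating pair \<open>X c < Y c\<close> sits between \<open>c\<close> and the
    fixed point \<open>s c\<close>. Iterating \<open>s\<close> traps these pairs below the limit,
    and one of them enters the interval of monotonicity that ends there.\<close>
  then obtain s X Y where s: "\<And>c. c \<le> X c" "\<And>c. X c < Y c" "\<And>c. Y c < s c" "\<And>c. f (s c) $ i = s c"
    "\<And>c. \<not> f (X c) $ i < f (Y c) $ i" by metis
  define c where "c = rec_nat (s origin) (\<lambda>n. s)"
  have cS: "c (Suc n) = s (c n)" for n by (simp add: c_def)
  have sless: "x < s x" for x using s(1-3) by (meson le_less_trans less_trans)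
  then have "c n < c (Suc n)" for n using cS by simp
  then obtain l where l: "c \<longlonglongrightarrow> l" "\<And>n. c n < l" by (rule strict_seq_converges) blast
  have fc: "f (c n) $ i = c n" for n by (cases n) (simp_all add: c_def s)
  have "closed {x. f x $ i = x}" by (intro closed_Collect_eq cont continuous_on_id)
  then have "l \<in> {x. f x $ i = x}" by (rule closed_sequentially[OF _ _ l(1)]) (simp add: fc)
  then have "\<exists>m<l. \<forall>x y. m \<le> x \<longrightarrow> x < y \<longrightarrow> y \<le> l \<longrightarrow> f x $ i < f y $ i"
    using increasing_near_fixed_limit[OF A f l fc] by simp
  then obtain m where m: "m < l" "\<And>x y. m \<le> x \<Longrightarrow> x < y \<Longrightarrow> y \<le> l \<Longrightarrow> f x $ i < f y $ i" by blast
  have "\<forall>\<^sub>F n in sequentially. m < c n" using order_tendstoD(1)[OF l(1) m(1)] .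
  then obtain n where n: "m < c n" by (auto simp: eventually_sequentially)
  have "Y (c n) < c (Suc n)" using s(3) cS by simp
  then have "Y (c n) \<le> l" using l(2)[of "Suc n"] by simp
  moreover have "m \<le> X (c n)" using s(1)[of "c n"] n by simp
  ultimately show False using m(2) s(2,5) by blast
qed

definition unbounded_coordinates :: "(long_ray \<Rightarrow> long_ray ^ 'n) \<Rightarrow> 'n set" where
  "unbounded_coordinates f = {i. unbounded (range (\<lambda>x. f x $ i))}"

text \<open>Otherwise all of the finitely many coordinates would be constant from some point on,
  against injectivity.\<close>

lemma unbounded_coordinates_nonempty:
  assumes A: "maximal_smooth_atlas A" and f: "smooth_knot A f"
  shows "unbounded_coordinates f \<noteq> {}"
proof
  assume e: "unbounded_coordinates f = {}"
  have "\<exists>d p. \<forall>x\<ge>d. f x $ i = p" for i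
    by (rule eventually_constant[OF A])
       (use e in \<open>auto simp: unbounded_coordinates_def intro!: continuous_on_component smooth_knotD[OF f]\<close>)
  then obtain d p where d: "\<And>i x. d i \<le> x \<Longrightarrow> f x $ i = p i" by metis
  have "countable (range d)" by (intro countable_finite) simp
  then obtain b where b: "\<forall>y\<in>range d. y < b" using countable_strictly_bounded by blast
  obtain b' where b': "b < b'" using gt_ex by blast
  have "f b $ i = f b' $ i" for i
  proof -
    have "d i \<le> b" "d i \<le> b'" using b b' by (auto intro: less_imp_le less_trans)
    then show ?thesis using d by metis
  qed
  then have "f b = f b'" by (simp add: vec_eq_iff)
  then show False using smooth_knotD(2)[OF f] b' by (auto simp: inj_def)
qed

section \<open>Straightening knots\<close>

text \<open>The normal form of a knot, diagonal in the coordinates of \<open>I\<close>. The base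
  point is a parameter because straightening leaves whatever constants the bounded coordinates end
  with.\<close>

definition standard_ray :: "'n set \<Rightarrow> long_ray ^ 'n \<Rightarrow> long_ray \<Rightarrow> long_ray ^ 'n" where
  "standard_ray I p x = (\<chi> i. if i \<in> I then x else p $ i)"

lemma extend_vec_nth [simp]: "extend_vec x $ i = extend (x $ i)"
  by (simp add: extend_vec_def)

lemma knot_equiv_coordinatewise:
  fixes f g :: "long_ray \<Rightarrow> long_ray ^ 'n"
  assumes "\<And>i. \<exists>\<phi>. isotopy \<phi> \<and> \<phi> 0 = id \<and> (\<forall>x. \<phi> 1 (extend (f x $ i)) = extend (g x $ i))"
  shows "knot_equiv f g"
proof -
  obtain \<phi> where \<phi>: "\<And>i. isotopy (\<phi> i)" "\<And>i. \<phi> i 0 = id"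
    "\<And>i x. \<phi> i 1 (extend (f x $ i)) = extend (g x $ i)"
    using assms by metis
  show ?thesis
  proof (rule knot_equivI[of "\<lambda>t y. \<chi> i. \<phi> i t (y $ i)"])
    show "isotopy (\<lambda>t y. \<chi> i. \<phi> i t (y $ i))" by (rule isotopy_pi[OF \<phi>(1)])
  qed (simp_all add: \<phi> fun_eq_iff vec_eq_iff)
qed

text \<open>In a real coordinate this is a translation, obtained from \<open>shear_isotopy\<close>
  with zero \<open>Q\<close> and constant displacement.\<close>

lemma move_point:
  assumes A: "maximal_smooth_atlas A"
  shows "\<exists>\<phi>. isotopy \<phi> \<and> \<phi> 0 = id \<and> \<phi> 1 (extend p) = extend q"
proof -
  obtain M and K :: "extended_ray \<Rightarrow> real" where M: "max (extend p) (extend q) < M"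
    and K: "strict_mono_on {bottom<..<M} K" "K ` {bottom<..<M} = UNIV"
    using coordinate_above[OF A] by blast
  define W where "W = {bottom<..<M}"
  define J where "J = the_inv_into W K"
  have hom: "homeomorphism W UNIV K J"
    using strict_mono_on_homeomorphism[OF K(1)] K(2) by (simp add: W_def J_def)
  have pW: "extend p \<in> W" "extend q \<in> W" using M by (auto simp: W_def)
  obtain \<phi> :: "real \<Rightarrow> real \<Rightarrow> real" where \<phi>: "compact_isotopy \<phi>"
    "\<And>x. norm x \<le> \<bar>K (extend p)\<bar> \<Longrightarrow> \<phi> 1 x = x + (K (extend q) - K (extend p))"
    by (rule shear_isotopy[of "\<lambda>_. 0 :: real" "\<lambda>_. K (extend q) - K (extend p)"
          "\<bar>K (extend q) - K (extend p)\<bar>" "\<bar>K (extend p)\<bar>"]) auto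
  have opW: "open W" by (simp add: W_def)
  have clJ: "closed (J ` C)" if "compact C" for C
    using compact_continuous_image[OF continuous_on_subset[OF homeomorphism_cont2[OF hom]] that]
    by (intro compact_imp_closed) simp
  let ?\<Phi> = "\<lambda>t y. if y \<in> W then J (\<phi> t (K y)) else y"
  have "\<phi> 1 (K (extend p)) = K (extend q)" using \<phi>(2)[of "K (extend p)"] by simp
  then have "?\<Phi> 1 (extend p) = extend q" using pW homeomorphism_apply1[OF hom pW(2)] by simp
  then show ?thesis using isotopy_transport[OF hom opW clJ \<phi>(1)] by blast
qed

lemma standard_ray_equiv:
  assumes A: "maximal_smooth_atlas A"
  shows "knot_equiv (standard_ray I p) (standard_ray I q)"
proof (rule knot_equiv_coordinatewise)
  fix i
  show "\<exists>\<phi>. isotopy \<phi> \<and> \<phi> 0 = id \<and>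
      (\<forall>x. \<phi> 1 (extend (standard_ray I p x $ i)) = extend (standard_ray I q x $ i))"
  proof (cases "i \<in> I")
    case True
    then show ?thesis using isotopy_id by (intro exI[of _ "\<lambda>t y. y"]) (auto simp: standard_ray_def)
  next
    case False
    then show ?thesis using move_point[OF A, of "p $ i" "q $ i"] by (simp add: standard_ray_def)
  qed
qed

text \<open>The isotopy acts on the straightened curve. In each coordinate of \<open>I\<close> it
  ends at the map \<theta> that is the identity up to \<open>d\<close> and follows the coordinate of
  \<open>f\<close> beyond. Since the head stays at or below \<open>d\<close> in these coordinates,
  \<theta> does not disturb it.\<close>

lemma straighten_tail:
  fixes f :: "long_ray \<Rightarrow> long_ray ^ 'n"
  assumes A: "maximal_smooth_atlas A" and f: "continuous_on UNIV f"
    and d: "\<And>i. i \<in> I \<Longrightarrow> f d $ i = d" "\<And>i x. i \<in> I \<Longrightarrow> x \<le> d \<Longrightarrow> f x $ i \<le> d"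
    and incr: "\<And>i x y. i \<in> I \<Longrightarrow> d \<le> x \<Longrightarrow> x < y \<Longrightarrow> f x $ i < f y $ i"
    and unb: "\<And>i. i \<in> I \<Longrightarrow> unbounded (range (\<lambda>x. f x $ i))"
  shows "knot_equiv (\<lambda>x. \<chi> i. if i \<in> I \<and> d \<le> x then x else f x $ i) f"
proof (rule knot_equiv_coordinatewise)
  fix i
  let ?g = "\<lambda>x. \<chi> i. if i \<in> I \<and> d \<le> x then x else f x $ i"
  show "\<exists>\<phi>. isotopy \<phi> \<and> \<phi> 0 = id \<and> (\<forall>x. \<phi> 1 (extend (?g x $ i)) = extend (f x $ i))"
  proof (cases "i \<in> I")
    case False
    then show ?thesis using isotopy_id by (intro exI[of _ "\<lambda>t y. y"]) auto
  next
    case True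
    define h where "h x = f x $ i" for x
    have hd: "h d = d" using d(1)[OF True] by (simp add: h_def)
    have hincr: "h x < h y" if "d \<le> x" "x < y" for x y using incr[OF True that] by (simp add: h_def)
    have hcont: "continuous_on UNIV h" unfolding h_def by (intro continuous_on_component f)
    have hunb: "unbounded (range h)" using unb[OF True] by (simp add: h_def[abs_def])
    define \<rho> where "\<rho> = inv extend"
    have \<rho>: "\<rho> (extend x) = x" for x unfolding \<rho>_def by (rule inv_f_f) (simp add: inj_def)
    define \<theta> where "\<theta> y = (if y \<le> extend d then y else extend (h (\<rho> y)))" for y
    have \<theta>lo: "\<theta> y = y" if "y \<le> extend d" for y using that by (simp add: \<theta>_def)
    have \<theta>hi: "\<theta> (extend x) = extend (h x)" if "d \<le> x" for x
      using that hd by (cases "x = d") (auto simp: \<theta>_def \<rho>)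
    have above: "\<exists>x. y = extend x \<and> d < x" if y: "\<not> y \<le> extend d" for y
    proof (cases y rule: extended_ray_cases)
      case (Extend x)
      then show ?thesis using y by auto
    next
      case (Collar r)
      then show ?thesis using y collar_less_extend[of r d] by (simp add: less_imp_le)
    qed
    have "\<theta> x < \<theta> y" if xy: "x < y" for x y
    proof (cases "y \<le> extend d")
      case True
      then have "x \<le> extend d" using xy by simp
      then show ?thesis using True xy \<theta>lo by simp
    next
      case False
      then obtain y' where y': "y = extend y'" "d < y'" using above by blast
      show ?thesis
      proof (cases "x \<le> extend d")
        case True
        have "extend d < extend (h y')" using hincr[of d y'] hd y' by simp
        then have "x < extend (h y')" using True by (rule le_less_trans[rotated])
        then show ?thesis using True y' \<theta>lo \<theta>hi by simp
      next
        case False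
        then obtain x' where x': "x = extend x'" "d < x'" using above by blast
        then show ?thesis using hincr[of x' y'] xy y' \<theta>hi by simp
      qed
    qed
    then have mono: "strict_mono \<theta>" by (rule strict_monoI)
    have surj: "surj \<theta>"
      unfolding surj_def
    proof
      fix y
      have "\<exists>x. \<theta> x = y"
      proof (cases "y \<le> extend d")
        case True
        then show ?thesis using \<theta>lo by blast
      next
        case False
        then obtain y' where y': "y = extend y'" "d < y'" using above by blast
        obtain u where u: "\<forall>x\<ge>u. y' < h x" using eventually_large[OF hcont hunb] by blast
        have "h d \<le> y'" "y' \<le> h (max u d)" using hd y' u by (auto simp: less_imp_le)
        then obtain x where "d \<le> x" "h x = y'"
          using IVT'[of h d y' "max u d"] continuous_on_subset[OF hcont] by auto
        then have "\<theta> (extend x) = y" using \<theta>hi y' by simp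
        then show ?thesis by blast
      qed
      then show "\<exists>x. y = \<theta> x" by blast
    qed
    have "unbounded {y. \<theta> y = y}"
    proof (rule unboundedI)
      fix b :: extended_ray
      obtain b' where b': "b < extend b'" using extend_cofinal by blast
      obtain x where x: "h x = x" "max b' d < x"
        using unboundedD[OF fixed_points_unbounded[OF hcont hunb], of "max b' d"] by auto
      have "\<theta> (extend x) = extend x" using x \<theta>hi by (simp add: less_imp_le)
      moreover have "b < extend x" using b' x by (meson extend_less_iff less_trans max_less_iff_conj)
      ultimately show "\<exists>y\<in>{y. \<theta> y = y}. b < y" by blast
    qed
    then obtain \<phi> where \<phi>: "isotopy \<phi>" "\<phi> 0 = id" "\<phi> 1 = \<theta>"
      using increasing_isotopy[OF A mono surj bottom_less_extend[of d] \<theta>lo] by blast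
    have "\<theta> (extend (?g x $ i)) = extend (f x $ i)" for x
    proof (cases "d \<le> x")
      case dx: True
      then show ?thesis using True \<theta>hi by (simp add: h_def)
    next
      case False
      then have "f x $ i \<le> d" using d(2)[OF True, of x] by simp
      then show ?thesis using False \<theta>lo by simp
    qed
    then show ?thesis using \<phi> by blast
  qed
qed

text \<open>A chain of three comparisons: \<open>k\<close> against the target chart at the value of
  the knot, the knot in charts against the source chart, and the source chart against
  \<open>k\<close>.\<close>

lemma knot_coordinate_lip_at:
  fixes f :: "long_ray \<Rightarrow> long_ray ^ 'n"
  assumes A: "maximal_smooth_atlas A" and f: "smooth_knot A f"
    and k: "chart_coordinate A {..<b} k" and fb: "\<And>x. x \<in> S \<Longrightarrow> f x $ j < b"
    and x: "x \<in> S" "S \<subseteq> {..<b}"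
  shows "lip_at S (\<lambda>y. k (f y $ j)) k x"
proof -
  obtain U \<psi> where U: "(U, \<psi>) \<in> A" "x \<in> U" using common_chart[OF A, of "{x}"] by auto
  obtain V \<eta> where V: "(V, \<eta>) \<in> A" "range (\<lambda>j. f x $ j) \<subseteq> V"
    using common_chart[OF A, of "range (\<lambda>j. f x $ j)"] by auto
  have chU: "is_chart (U, \<psi>)" and chV: "is_chart (V, \<eta>)" using atlas_chart[OF A] U V by auto
  note cU = is_chartD[OF chU] and cV = is_chartD[OF chV]
  define N where "N = {x \<in> U. \<forall>j. f x $ j \<in> V}"
  obtain L D where opN: "open N" and L: "\<And>x j. x \<in> N \<Longrightarrow> L (\<psi> x) $ j = \<eta> (f x $ j)" and D: "D 0 = L"
    "\<And>k s. s \<in> \<psi> ` N \<Longrightarrow> (D k has_vector_derivative D (Suc k) s) (at s within \<psi> ` N)"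
    by (rule knot_local_derivatives[OF A f U(1) V(1) N_def]) blast
  have xN: "x \<in> N" using U V(2) by (auto simp: N_def)
  have NU: "N \<subseteq> U" by (auto simp: N_def)
  have "(L has_vector_derivative D (Suc 0) (\<psi> x)) (at (\<psi> x) within \<psi> ` N)"
    using D(2)[of "\<psi> x" 0] D(1) xN by simp
  from has_vector_derivative_lipschitz[OF this] obtain B where B: "B \<ge> 0"
    "\<forall>\<^sub>F s in at (\<psi> x) within \<psi> ` N. norm (L s - L (\<psi> x)) \<le> B * \<bar>s - \<psi> x\<bar>" by blast
  have "\<forall>\<^sub>F y in at x. norm (L (\<psi> y) - L (\<psi> x)) \<le> B * \<bar>\<psi> y - \<psi> x\<bar>"
    by (rule eventually_compose_filterlim[OF B(2) filterlim_chart[OF chU opN NU xN]])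
  moreover have "\<forall>\<^sub>F y in at x. y \<in> N" using opN xN by (intro eventually_at_in_open')
  ultimately have "\<forall>\<^sub>F y in at x. \<bar>\<eta> (f y $ j) - \<eta> (f x $ j)\<bar> \<le> B * \<bar>\<psi> y - \<psi> x\<bar>"
  proof eventually_elim
    case (elim y)
    have "\<bar>(L (\<psi> y) - L (\<psi> x)) $ j\<bar> \<le> norm (L (\<psi> y) - L (\<psi> x))" by (rule component_le_norm_cart)
    then show ?case using elim L xN by simp
  qed
  then have "lip_at UNIV (\<lambda>y. \<eta> (f y $ j)) \<psi> x" by (rule lip_atI[OF B(1)])
  then have 2: "lip_at S (\<lambda>y. \<eta> (f y $ j)) \<psi> x" by (rule lip_at_subset) simp
  have "x \<in> {..<b}" using x by blast
  then have "lip_at {..<b} \<psi> k x" using k U unfolding chart_coordinate_def by blast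
  then have 3: "lip_at S \<psi> k x" by (rule lip_at_subset[OF _ x(2)])
  have "f x $ j \<in> {..<b}" "f x $ j \<in> V" using fb[OF x(1)] V(2) by auto
  then have "lip_at {..<b} k \<eta> (f x $ j)" using k V(1) unfolding chart_coordinate_def by blast
  then obtain C where C: "C \<ge> 0"
    "\<forall>\<^sub>F z in at (f x $ j) within {..<b}. \<bar>k z - k (f x $ j)\<bar> \<le> C * \<bar>\<eta> z - \<eta> (f x $ j)\<bar>"
    unfolding lip_at_def by blast
  \<comment> \<open>Nearby points may have the same coordinate \<open>f x $ j\<close>, so the
    punctured filter is traded for the full one; at the value itself the estimate is
    trivial.\<close>
  have "\<forall>\<^sub>F z in nhds (f x $ j). z \<in> {..<b} \<longrightarrow> \<bar>k z - k (f x $ j)\<bar> \<le> C * \<bar>\<eta> z - \<eta> (f x $ j)\<bar>"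
    using C(2) unfolding eventually_at_filter by (rule eventually_mono) auto
  moreover have "isCont (\<lambda>y. f y $ j) x"
    using continuous_on_component[OF smooth_knotD(1)[OF f]] continuous_on_eq_continuous_at[of UNIV] by blast
  then have "filterlim (\<lambda>y. f y $ j) (nhds (f x $ j)) (at x within S)"
    using isCont_def tendsto_within_subset by blast
  ultimately have "\<forall>\<^sub>F y in at x within S. f y $ j \<in> {..<b} \<longrightarrow>
      \<bar>k (f y $ j) - k (f x $ j)\<bar> \<le> C * \<bar>\<eta> (f y $ j) - \<eta> (f x $ j)\<bar>"
    by (rule eventually_compose_filterlim)
  moreover have "\<forall>\<^sub>F y in at x within S. y \<in> S" by (simp add: eventually_at_filter)
  ultimately have "\<forall>\<^sub>F y in at x within S. \<bar>k (f y $ j) - k (f x $ j)\<bar> \<le> C * \<bar>\<eta> (f y $ j) - \<eta> (f x $ j)\<bar>"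
    by eventually_elim (use fb in simp)
  then have 1: "lip_at S (\<lambda>y. k (f y $ j)) (\<lambda>y. \<eta> (f y $ j)) x" by (rule lip_atI[OF C(1)])
  show ?thesis by (rule lip_at_trans[OF 1 lip_at_trans[OF 2 3]])
qed

text \<open>In real coordinates on the box below \<open>b\<close> the tail is a piece of a straight
  ray and the head a compact arc ending on it. The strict bound on the coordinates in
  \<open>I\<close> keeps the head off the ray.\<close>

lemma straighten_head:
  fixes f :: "long_ray \<Rightarrow> long_ray ^ 'n"
  assumes A: "maximal_smooth_atlas A" and f: "smooth_knot A f" and n: "CARD('n) \<ge> 4"
    and I: "I \<noteq> {}" and d: "\<And>i. i \<in> I \<Longrightarrow> f d $ i = d" "\<And>i x. i \<in> I \<Longrightarrow> x < d \<Longrightarrow> f x $ i < d"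
    and p: "\<And>i x. i \<notin> I \<Longrightarrow> d \<le> x \<Longrightarrow> f x $ i = p $ i"
  shows "knot_equiv (\<lambda>x. \<chi> i. if i \<in> I \<and> d \<le> x then x else f x $ i) (standard_ray I p)"
proof -
  have "\<exists>m. \<forall>x\<in>{origin..d}. f x $ i \<le> m" for i
    by (rule continuous_bounded_segment[OF continuous_on_component[OF
          continuous_on_subset[OF smooth_knotD(1)[OF f] subset_UNIV]]])
  then obtain m where m: "\<And>i x. x \<in> {origin..d} \<Longrightarrow> f x $ i \<le> m i" by metis
  have "countable (insert d (range m))" by (intro countable_finite) simp
  \<comment> \<open>Above \<open>d\<close> and above all coordinates of the head, which are bounded
    because \<open>{origin..d}\<close> is compact.\<close>
  then obtain b where b: "\<forall>y\<in>insert d (range m). y < b" using countable_strictly_bounded by blast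
  have db: "d < b" using b by simp
  have fb: "f x $ i < b" if "x \<le> d" for x i
  proof -
    have "f x $ i \<le> m i" using m that origin_le by simp
    also have "m i < b" using b by simp
    finally show ?thesis .
  qed
  have ob: "origin < b" using origin_le[of d] db by simp
  obtain k where k: "chart_coordinate A {..<b} k" "k ` {..<b} = {k origin..}"
    using unbounded_chart_coordinate[OF A ob] .
  obtain K where K: "strict_mono_on {bottom<..<extend b} K" "K ` {bottom<..<extend b} = UNIV"
    "\<And>x. x < b \<Longrightarrow> K (extend x) = k x"
    by (rule line_coordinate[OF k ob]) blast
  define W where "W = {bottom<..<extend b}"
  define J where "J = the_inv_into W K"
  have hom: "homeomorphism W UNIV K J"
    using strict_mono_on_homeomorphism[OF K(1)] K(2) by (simp add: W_def J_def)
  have xW: "extend x \<in> W \<longleftrightarrow> x < b" for x by (simp add: W_def)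
  have Jk: "J (k x) = extend x" if "x < b" for x
    using homeomorphism_apply1[OF hom, of "extend x"] K(3)[OF that] xW that by simp
  have kmono: "strict_mono_on {..<b} k" using k(1) by (simp add: chart_coordinate_def)
  have kless: "k x < k y \<longleftrightarrow> x < y" if "x < b" "y < b" for x y
    using strict_mono_onD[OF kmono, of x y] strict_mono_onD[OF kmono, of y x] that
    by (metis lessThan_iff less_asym linorder_neqE)
  have kinj: "k x = k y \<longleftrightarrow> x = y" if "x < b" "y < b" for x y
    using kless[OF that] kless[OF that(2,1)] by (metis less_irrefl linorder_neqE)
  have kle: "k x \<le> k y \<longleftrightarrow> x \<le> y" if "x < b" "y < b" for x y
    using kless[OF that(2,1)] by (simp add: not_less[symmetric])
  define Wn :: "(extended_ray ^ 'n) set" where "Wn = {y. \<forall>i. y $ i \<in> W}"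
  define kn :: "extended_ray ^ 'n \<Rightarrow> real ^ 'n" where "kn y = (\<chi> i. K (y $ i))" for y
  define jn :: "real ^ 'n \<Rightarrow> extended_ray ^ 'n" where "jn v = (\<chi> i. J (v $ i))" for v
  have opW: "open W" by (simp add: W_def)
  have "Wn = (\<Inter>i. (\<lambda>y. y $ i) -` W)" by (auto simp: Wn_def)
  then have opWn: "open Wn"
    by (auto intro!: open_INT open_vimage opW continuous_on_component continuous_on_id)
  have homn: "homeomorphism Wn UNIV kn jn"
  proof (rule homeomorphismI)
    show "continuous_on Wn kn" unfolding kn_def
      by (intro continuous_on_vec_lambda continuous_on_compose2[OF homeomorphism_cont1[OF hom]]
          continuous_on_component continuous_on_id) (auto simp: Wn_def)
    show "continuous_on UNIV jn" unfolding jn_def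
      by (intro continuous_on_vec_lambda continuous_on_compose2[OF homeomorphism_cont2[OF hom]]
          continuous_on_component continuous_on_id) auto
    have "J r \<in> W" for r using homeomorphism_image2[OF hom] by blast
    then show "jn ` UNIV \<subseteq> Wn" by (auto simp: Wn_def jn_def)
    show "jn (kn y) = y" if "y \<in> Wn" for y
      using that homeomorphism_apply1[OF hom] by (simp add: Wn_def jn_def kn_def vec_eq_iff)
    show "kn (jn v) = v" for v
      using homeomorphism_apply2[OF hom] by (simp add: jn_def kn_def vec_eq_iff)
  qed simp
  \<comment> \<open>The image is cut out as the preimage of \<open>C\<close> inside a product
    \<open>B\<close> of compact sets; \<open>B\<close> is closed and contained in \<open>Wn\<close>,
    where \<open>kn\<close> is continuous.\<close>
  have cljn: "closed (jn ` C)" if C: "compact C" for C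
  proof -
    define B where "B = (\<Inter>i. (\<lambda>y. y $ i) -` (\<lambda>v. J (v $ i)) ` C)"
    have "compact ((\<lambda>v. J (v $ i)) ` C)" for i
      by (intro compact_continuous_image[OF _ C] continuous_on_compose2[OF homeomorphism_cont2[OF hom]]
          continuous_on_component continuous_on_id) auto
    then have clB: "closed B" unfolding B_def
      by (auto intro!: closed_INT closed_vimage compact_imp_closed continuous_on_component continuous_on_id)
    have "(\<lambda>v. J (v $ i)) ` C \<subseteq> W" for i using homeomorphism_image2[OF hom] by blast
    then have BW: "B \<subseteq> Wn" unfolding B_def Wn_def by blast
    have "closed (B \<inter> kn -` C)"
      by (rule continuous_closed_preimage[OF continuous_on_subset[OF homeomorphism_cont1[OF homn] BW] clB
            compact_imp_closed[OF C]])
    moreover have "jn ` C = B \<inter> kn -` C"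
    proof (intro equalityI subsetI)
      fix y assume "y \<in> jn ` C"
      then obtain v where v: "v \<in> C" "y = jn v" by blast
      have "y $ i \<in> (\<lambda>v. J (v $ i)) ` C" for i using v by (simp add: jn_def)
      then show "y \<in> B \<inter> kn -` C" using v homeomorphism_apply2[OF homn] by (simp add: B_def)
    next
      fix y assume "y \<in> B \<inter> kn -` C"
      then have "kn y \<in> C" "y = jn (kn y)" using BW homeomorphism_apply1[OF homn, of y] by auto
      then show "y \<in> jn ` C" by blast
    qed
    ultimately show ?thesis by simp
  qed
  \<comment> \<open>Reparametrisation by the value \<open>s = k x\<close> gives the standard ray
    constant velocity: in the box it becomes \<open>q + s *\<^sub>R e\<close>.\<close>
  define \<xi> where "\<xi> = the_inv_into {..<b} k"
  have kin: "inj_on k {..<b}" by (rule strict_mono_on_imp_inj_on[OF kmono])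
  have \<xi>k: "\<xi> (k x) = x" if "x < b" for x unfolding \<xi>_def using the_inv_into_f_f[OF kin] that by simp
  have k\<xi>: "k (\<xi> s) = s" "\<xi> s < b" if "k origin \<le> s" for s
  proof -
    have "s \<in> k ` {..<b}" using k(2) that by simp
    then obtain x where "x < b" "s = k x" by blast
    then show "k (\<xi> s) = s" "\<xi> s < b" using \<xi>k by auto
  qed
  have \<xi>cont: "continuous_on {k origin..} \<xi>"
  proof (rule continuous_onI_mono)
    have "\<xi> ` {k origin..} = {..<b}" unfolding k(2)[symmetric] using \<xi>k by (auto simp: image_iff)
    then show "open (\<xi> ` {k origin..})" by simp
    show "\<xi> s \<le> \<xi> t" if "s \<in> {k origin..}" "t \<in> {k origin..}" "s \<le> t" for s t
      using kle[of "\<xi> s" "\<xi> t"] k\<xi>[of s] k\<xi>[of t] that by simp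
  qed
  define F where "F s = (\<chi> i. k (f (\<xi> s) $ i))" for s
  define e :: "real ^ 'n" where "e = (\<chi> i. if i \<in> I then 1 else 0)"
  define q :: "real ^ 'n" where "q = (\<chi> i. if i \<in> I then 0 else k (p $ i))"
  have qe: "(q + s *\<^sub>R e) $ i = (if i \<in> I then s else k (p $ i))" for s i by (simp add: q_def e_def)
  have pb: "p $ i < b" if "i \<notin> I" for i using p[OF that, of d] fb[of d i] by simp
  have \<xi>d: "\<xi> s \<le> d" if "s \<in> {k origin..k d}" for s
    using kle[of "\<xi> s" d] k\<xi>[of s] that db by simp
  obtain i0 where i0: "i0 \<in> I" using I by blast
  obtain \<phi> where \<phi>: "compact_isotopy \<phi>" "\<And>s. s \<in> {k origin..k d} \<Longrightarrow> \<phi> 1 (F s) = q + s *\<^sub>R e"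
    "\<And>s. k d \<le> s \<Longrightarrow> \<phi> 1 (q + s *\<^sub>R e) = q + s *\<^sub>R e"
  proof (rule straighten_arc[of "k origin" "k d" e F q])
    show "DIM(real ^ 'n) \<ge> 4" using n by simp
    show "k origin \<le> k d" using kle[OF ob db] origin_le by simp
    have "e $ i0 = 1" using i0 by (simp add: e_def)
    then show "e \<noteq> 0" by auto
    show "inj_on F {k origin..k d}"
    proof (rule inj_onI)
      fix s t assume s: "s \<in> {k origin..k d}" and t: "t \<in> {k origin..k d}" and "F s = F t"
      then have "k (f (\<xi> s) $ i) = k (f (\<xi> t) $ i)" for i by (simp add: F_def vec_eq_iff)
      then have "f (\<xi> s) = f (\<xi> t)" using kinj fb \<xi>d[OF s] \<xi>d[OF t] by (simp add: vec_eq_iff)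
      then have "\<xi> s = \<xi> t" by (rule injD[OF smooth_knotD(2)[OF f]])
      moreover have "k (\<xi> s) = s" "k (\<xi> t) = t" using k\<xi>(1) s t by simp_all
      ultimately show "s = t" by metis
    qed
    show "F (k d) = q + k d *\<^sub>R e"
      unfolding vec_eq_iff qe using \<xi>k[OF db] d(1) p[of _ d] by (simp add: F_def)
    \<comment> \<open>Coordinate \<open>i0\<close> is at least \<open>k d\<close> on the ray from
      parameter \<open>k d\<close> on, and smaller than \<open>k d\<close> on the head before
      \<open>d\<close>.\<close>
    show "F s \<noteq> q + s' *\<^sub>R e" if "k origin \<le> s" "s < k d" "k d \<le> s'" for s s'
    proof
      assume eq: "F s = q + s' *\<^sub>R e"
      have "F s $ i0 = s'" unfolding eq qe using i0 by simp
      then have "k (f (\<xi> s) $ i0) = s'" by (simp add: F_def)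
      moreover have "\<xi> s < d" using kless[of "\<xi> s" d] k\<xi>[OF that(1)] db that by simp
      then have "f (\<xi> s) $ i0 < d" using d(2)[OF i0] by simp
      then have "k (f (\<xi> s) $ i0) < k d" using kless[of "f (\<xi> s) $ i0" d] db by simp
      ultimately show False using that by simp
    qed
    show "\<exists>B. \<exists>\<delta>>0. \<forall>s'\<in>{k origin..k d}. \<bar>s' - s\<bar> < \<delta> \<longrightarrow> norm (F s' - F s) \<le> B * \<bar>s' - s\<bar>"
      if s: "s \<in> {k origin..k d}" for s
    proof -
      have \<xi>s: "\<xi> s \<in> {..d}" using \<xi>d[OF s] by simp
      have fil: "filterlim \<xi> (at (\<xi> s) within {..d}) (at s within {k origin..k d})"
        unfolding filterlim_at
      proof
        have "continuous_on {k origin..k d} \<xi>" by (rule continuous_on_subset[OF \<xi>cont]) auto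
        then show "(\<xi> \<longlongrightarrow> \<xi> s) (at s within {k origin..k d})" using s by (simp add: continuous_on_def)
        show "\<forall>\<^sub>F t in at s within {k origin..k d}. \<xi> t \<in> {..d} \<and> \<xi> t \<noteq> \<xi> s"
          unfolding eventually_at_filter
        proof (rule always_eventually, intro allI impI conjI)
          fix t assume t: "t \<noteq> s" "t \<in> {k origin..k d}"
          show "\<xi> t \<in> {..d}" using \<xi>d[OF t(2)] by simp
          have "k (\<xi> s) = s" "k (\<xi> t) = t" using k\<xi>(1) s t(2) by simp_all
          then show "\<xi> t \<noteq> \<xi> s" using t(1) by metis
        qed
      qed
      have "\<exists>L\<ge>0. \<forall>\<^sub>F t in at s within {k origin..k d}. \<bar>F t $ i - F s $ i\<bar> \<le> L * \<bar>t - s\<bar>" for i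
      proof -
        have "lip_at {..d} (\<lambda>y. k (f y $ i)) k (\<xi> s)"
          by (rule knot_coordinate_lip_at[OF A f k(1)]) (use fb \<xi>s db in auto)
        then obtain L where L: "L \<ge> 0"
          "\<forall>\<^sub>F y in at (\<xi> s) within {..d}. \<bar>k (f y $ i) - k (f (\<xi> s) $ i)\<bar> \<le> L * \<bar>k y - k (\<xi> s)\<bar>"
          unfolding lip_at_def by blast
        have "\<forall>\<^sub>F t in at s within {k origin..k d}. t \<in> {k origin..k d}"
          unfolding eventually_at_filter by (rule always_eventually) simp
        with eventually_compose_filterlim[OF L(2) fil]
        have "\<forall>\<^sub>F t in at s within {k origin..k d}. \<bar>F t $ i - F s $ i\<bar> \<le> L * \<bar>t - s\<bar>"
        proof eventually_elim
          case (elim t)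
          then show ?case using k\<xi>(1)[of t] k\<xi>(1)[of s] s by (simp add: F_def)
        qed
        then show ?thesis using L(1) by blast
      qed
      then obtain L where L: "\<And>i. L i \<ge> 0"
        "\<And>i. \<forall>\<^sub>F t in at s within {k origin..k d}. \<bar>F t $ i - F s $ i\<bar> \<le> L i * \<bar>t - s\<bar>" by metis
      have "\<forall>\<^sub>F t in at s within {k origin..k d}. \<forall>i. \<bar>F t $ i - F s $ i\<bar> \<le> L i * \<bar>t - s\<bar>"
        by (rule eventually_all_finite[OF L(2)])
      then have "\<forall>\<^sub>F t in at s within {k origin..k d}. norm (F t - F s) \<le> (\<Sum>i\<in>UNIV. L i) * \<bar>t - s\<bar>"
      proof eventually_elim
        case (elim t)
        have "norm (F t - F s) \<le> (\<Sum>i\<in>UNIV. \<bar>(F t - F s) $ i\<bar>)" by (rule norm_le_l1_cart)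
        also have "\<dots> \<le> (\<Sum>i\<in>UNIV. L i * \<bar>t - s\<bar>)" using elim by (intro sum_mono) simp
        finally show ?case by (simp add: sum_distrib_right)
      qed
      then obtain \<delta> where \<delta>: "\<delta> > 0" "\<And>t. t \<in> {k origin..k d} \<Longrightarrow> t \<noteq> s \<Longrightarrow> \<bar>t - s\<bar> < \<delta> \<Longrightarrow>
          norm (F t - F s) \<le> (\<Sum>i\<in>UNIV. L i) * \<bar>t - s\<bar>"
        unfolding eventually_at dist_real_def by blast
      have "norm (F t - F s) \<le> (\<Sum>i\<in>UNIV. L i) * \<bar>t - s\<bar>" if "t \<in> {k origin..k d}" "\<bar>t - s\<bar> < \<delta>" for t
        using \<delta>(2)[OF that(1) _ that(2)] by (cases "t = s") auto
      then show ?thesis using \<delta>(1) by blast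
    qed
  qed (rule that)
  let ?g = "\<lambda>x. \<chi> i. if i \<in> I \<and> d \<le> x then x else f x $ i"
  let ?\<Phi> = "\<lambda>t y. if y \<in> Wn then jn (\<phi> t (kn y)) else y"
  show ?thesis
  proof (rule knot_equivI[of ?\<Phi>])
    show "isotopy ?\<Phi>" "?\<Phi> 0 = id" by (rule isotopy_transport[OF homn opWn cljn \<phi>(1)]; assumption)+
    fix x
    have target: "jn (q + k x *\<^sub>R e) = extend_vec (standard_ray I p x)" if "x < b"
      unfolding vec_eq_iff using Jk[OF that] Jk[OF pb] by (simp add: jn_def qe standard_ray_def del: vector_add_component)
    \<comment> \<open>Points up to \<open>d\<close> are straightened; those between \<open>d\<close>
      and \<open>b\<close> already lie on the ray and stay fixed; from \<open>b\<close> on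
      coordinate \<open>i0\<close> is outside the box, where the isotopy is the identity.\<close>
    consider "x \<le> d" | "d < x" "x < b" | "b \<le> x" by (meson not_le)
    then show "?\<Phi> 1 (extend_vec (?g x)) = extend_vec (standard_ray I p x)"
    proof cases
      case 1
      then have xb: "x < b" using db by simp
      have gx: "?g x = f x" unfolding vec_eq_iff using 1 d(1) by (auto dest: antisym)
      have "extend_vec (f x) \<in> Wn" using fb[OF 1] xW by (simp add: Wn_def)
      moreover have "kn (extend_vec (f x)) = F (k x)"
        unfolding vec_eq_iff using \<xi>k[OF xb] K(3) fb[OF 1] by (simp add: kn_def F_def)
      moreover have "k x \<in> {k origin..k d}" using kle[OF ob xb] kle[OF xb db] origin_le 1 by simp
      ultimately show ?thesis unfolding gx using \<phi>(2) target[OF xb] by simp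
    next
      case 2
      have gx: "?g x = standard_ray I p x"
        unfolding vec_eq_iff using 2 p[of _ x] by (simp add: standard_ray_def less_imp_le)
      have "extend_vec (standard_ray I p x) \<in> Wn" using 2 pb xW by (simp add: Wn_def standard_ray_def)
      moreover have "kn (extend_vec (standard_ray I p x)) = q + k x *\<^sub>R e"
        unfolding vec_eq_iff qe using K(3) 2(2) pb by (simp add: kn_def standard_ray_def)
      moreover have "k d \<le> k x" using kle[OF db 2(2)] 2 by simp
      ultimately show ?thesis unfolding gx using \<phi>(3) target[OF 2(2)] by simp
    next
      case 3
      then have dx: "d \<le> x" using db by simp
      have gx: "?g x = standard_ray I p x"
        unfolding vec_eq_iff using dx p[of _ x] by (simp add: standard_ray_def)
      have "extend_vec (standard_ray I p x) $ i0 \<notin> W" using 3 xW[of x] i0 by (simp add: standard_ray_def)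
      then have "extend_vec (standard_ray I p x) \<notin> Wn" unfolding Wn_def by blast
      then show ?thesis unfolding gx by simp
    qed
  qed
qed

lemma knot_equiv_standard:
  fixes f :: "long_ray \<Rightarrow> long_ray ^ 'n"
  assumes A: "maximal_smooth_atlas A" and f: "smooth_knot A f" and n: "CARD('n) \<ge> 4"
  shows "knot_equiv f (standard_ray (unbounded_coordinates f) q)"
proof -
  define I where "I = unbounded_coordinates f"
  have Iu: "unbounded (range (\<lambda>x. f x $ i))" if "i \<in> I" for i using that by (simp add: I_def unbounded_coordinates_def)
  have cont: "continuous_on UNIV (\<lambda>x. f x $ i)" for i by (intro continuous_on_component smooth_knotD[OF f])
  have "\<exists>d. \<forall>x y. d \<le> x \<longrightarrow> x < y \<longrightarrow> f x $ i < f y $ i" if "i \<in> I" for i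
    by (rule eventually_increasing[OF A f Iu[OF that]])
  then obtain u where u: "\<And>i x y. i \<in> I \<Longrightarrow> u i \<le> x \<Longrightarrow> x < y \<Longrightarrow> f x $ i < f y $ i" by metis
  have "\<exists>d p. \<forall>x\<ge>d. f x $ i = p" if "i \<notin> I" for i
    by (rule eventually_constant[OF A cont]) (use that in \<open>simp add: I_def unbounded_coordinates_def\<close>)
  then obtain v p where v: "\<And>i x. i \<notin> I \<Longrightarrow> v i \<le> x \<Longrightarrow> f x $ i = p i" by metis
  have "countable (range u \<union> range v)" by (intro countable_finite) simp
  \<comment> \<open>From \<open>a\<close> on, the coordinates in \<open>I\<close> increase and the
    others are constant.\<close>
  then obtain a where a: "\<forall>y\<in>range u \<union> range v. y < a" using countable_strictly_bounded by blast
  have "\<exists>m. \<forall>x\<in>{origin..a}. f x $ i \<le> m" for i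
    by (rule continuous_bounded_segment[OF continuous_on_subset[OF cont subset_UNIV]])
  then obtain m where m: "\<And>i x. x \<in> {origin..a} \<Longrightarrow> f x $ i \<le> m i" by metis
  have "\<exists>d. \<forall>x\<ge>d. m i < f x $ i" if "i \<in> I" for i by (rule eventually_large[OF cont Iu[OF that]])
  then obtain w where w: "\<And>i x. i \<in> I \<Longrightarrow> w i \<le> x \<Longrightarrow> m i < f x $ i" by metis
  \<comment> \<open>From \<open>c\<close> on, each coordinate in \<open>I\<close> exceeds its bound
    \<open>m i\<close> on the segment up to \<open>a\<close>.\<close>
  have "countable (insert a (range w))" by (intro countable_finite) simp
  then obtain c where c: "\<forall>y\<in>insert a (range w). y < c" using countable_strictly_bounded by blast
  \<comment> \<open>At a common fixed point \<open>d\<close> of these coordinates the curve meets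
    the standard ray, so the tail can be replaced there continuously.\<close>
  have "unbounded (\<Inter>i\<in>I. {x. f x $ i = x})"
    by (rule club_INT_finite) (use fixed_points_unbounded[OF cont Iu] in
        \<open>auto intro!: closed_Collect_eq cont continuous_on_id\<close>)
  then obtain d where d: "d \<in> (\<Inter>i\<in>I. {x. f x $ i = x})" "c < d" using unboundedD by blast
  have ad: "a < d" using c d(2) by (meson insertI1 less_trans)
  have fd: "f d $ i = d" if "i \<in> I" for i using d(1) that by blast
  \<comment> \<open>Up to \<open>a\<close> the bound is \<open>m i < d\<close>; between
    \<open>a\<close> and \<open>d\<close> it is monotonicity.\<close>
  have below: "f x $ i < d" if i: "i \<in> I" and x: "x < d" for i x
  proof (cases "x \<le> a")
    case True
    have "w i < d" using c d(2) by (meson insertI2 less_trans rangeI)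
    then have "m i < f d $ i" using w[OF i, of d] by simp
    moreover have "f x $ i \<le> m i" using m[of x i] True origin_le by simp
    ultimately show ?thesis using fd[OF i] by simp
  next
    case False
    have "u i \<le> x" using a False by (meson UnI1 less_imp_le less_trans not_le rangeI)
    then show ?thesis using u[OF i _ x] fd[OF i] by simp
  qed
  have incr: "f x $ i < f y $ i" if "i \<in> I" "d \<le> x" "x < y" for i x y
  proof -
    have "u i \<le> x" using a ad that(2) by (meson UnI1 less_imp_le less_le_trans less_trans rangeI)
    then show ?thesis by (rule u[OF that(1) _ that(3)])
  qed
  have const: "f x $ i = (\<chi> i. p i) $ i" if "i \<notin> I" "d \<le> x" for i x
  proof -
    have "v i \<le> x" using a ad that(2) by (meson UnI2 less_imp_le less_le_trans less_trans rangeI)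
    then show ?thesis using v[OF that(1)] by simp
  qed
  have le: "f x $ i \<le> d" if "i \<in> I" "x \<le> d" for i x
    using below[OF that(1), of x] fd[OF that(1)] that(2) by (cases "x = d") (auto simp: less_imp_le)
  have Ine: "I \<noteq> {}" unfolding I_def by (rule unbounded_coordinates_nonempty[OF A f])
  let ?g = "\<lambda>x. \<chi> i. if i \<in> I \<and> d \<le> x then x else f x $ i"
  have 1: "knot_equiv ?g f" by (rule straighten_tail[OF A smooth_knotD(1)[OF f] fd le incr Iu])
  have 2: "knot_equiv ?g (standard_ray I (\<chi> i. p i))"
    by (rule straighten_head[OF A f n Ine fd below const])
  have 3: "knot_equiv (standard_ray I (\<chi> i. p i)) (standard_ray I q)" by (rule standard_ray_equiv[OF A])
  show ?thesis unfolding I_def[symmetric]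
    by (rule knot_equiv_trans[OF knot_equiv_sym[OF 1] knot_equiv_trans[OF 2 3]])
qed

section \<open>Counting the classes\<close>

lemma closed_in_interval_seqI:
  fixes S :: "real set"
  assumes "S \<subseteq> {a..b}"
    and "\<And>t l. (\<And>n::nat. t n \<in> S) \<Longrightarrow> t \<longlonglongrightarrow> l \<Longrightarrow> l \<in> {a..b} \<Longrightarrow> l \<in> S"
  shows "closed S"
  unfolding closed_sequential_limits
proof (intro allI impI)
  fix t l assume tl: "(\<forall>n. t n \<in> S) \<and> t \<longlonglongrightarrow> l"
  then have "\<forall>n. t n \<in> {a..b}" using assms(1) by blast
  then have "l \<in> {a..b}" using closed_sequentially[of "{a..b}" t l] tl by simp
  then show "l \<in> S" using assms(2)[of t l] tl by blast
qed

text \<open>During an isotopy, the times at which the \<open>i\<close>-th coordinate is bounded form a set that is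
  both open and closed in the unit interval.\<close>

lemma unbounded_coordinates_subset:
  fixes f g :: "long_ray \<Rightarrow> long_ray ^ 'n"
  assumes f: "continuous_on UNIV f" and fg: "knot_equiv f g"
  shows "unbounded_coordinates g \<subseteq> unbounded_coordinates f"
proof
  fix i assume i: "i \<in> unbounded_coordinates g"
  obtain \<phi> where \<phi>: "isotopy \<phi>" "\<phi> 0 = id" "\<And>x. \<phi> 1 (extend_vec (f x)) = extend_vec (g x)"
    by (rule knot_equivE[OF fg]) blast
  define H where "H t x = \<phi> t (extend_vec (f x)) $ i" for t x
  have cf: "continuous_on UNIV (\<lambda>x. extend_vec (f x))"
    unfolding extend_vec_def
    by (intro continuous_on_vec_lambda continuous_on_compose2[OF continuous_extend] continuous_on_component f) auto
  have cx: "continuous_on UNIV (H t)" if "t \<in> {0..1}" for t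
    unfolding H_def
    by (intro continuous_on_component isotopy_continuous_reparam[OF \<phi>(1) cf]) (use that in auto)
  have ct: "continuous_on {0..1} (\<lambda>t. H t x)" for x
    unfolding H_def
    by (intro continuous_on_component isotopy_continuous_reparam[OF \<phi>(1)]) (auto intro: continuous_intros)
  have lim: "(\<lambda>n. H (t n) x) \<longlonglongrightarrow> H l x" if "\<And>n. t n \<in> {0..1}" "t \<longlonglongrightarrow> l" "l \<in> {0..1}" for t l x
    using continuous_on_tendsto_compose[OF ct that(2,3)] that(1) by simp
  define B where "B = {t \<in> {0..1}. \<exists>b. \<forall>x. H t x \<le> b}"
  define U where "U = {0..1} - B"
  have "closed B"
  proof (rule closed_in_interval_seqI)
    show "B \<subseteq> {0..1}" by (auto simp: B_def)
    fix t l assume t: "\<And>n::nat. t n \<in> B" "t \<longlonglongrightarrow> l" and l: "l \<in> {0..1}"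
    have "\<forall>n. \<exists>b. \<forall>x. H (t n) x \<le> b" using t(1) by (simp add: B_def)
    then obtain b where b: "\<And>n x. H (t n) x \<le> b n" by metis
    \<comment> \<open>Bounds at countably many times have a common bound \<open>c\<close>, and a
      non-strict bound passes to the limit time.\<close>
    obtain c where c: "\<forall>y\<in>range b. y < c" using countable_strictly_bounded[of "range b"] by auto
    have "H l x \<le> c" for x
    proof (rule LIMSEQ_le_const2[OF lim[OF _ t(2) l]])
      show "t n \<in> {0..1}" for n using t(1)[of n] by (simp add: B_def)
      have "H (t n) x \<le> c" for n using b[of n x] c by (meson less_imp_le order_trans rangeI)
      then show "\<exists>N. \<forall>n\<ge>N. H (t n) x \<le> c" by blast
    qed
    then show "l \<in> B" using l by (auto simp: B_def)
  qed
  moreover have "closed U"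
  proof (rule closed_in_interval_seqI)
    show "U \<subseteq> {0..1}" by (auto simp: U_def)
    fix t l assume t: "\<And>n::nat. t n \<in> U" "t \<longlonglongrightarrow> l" and l: "l \<in> {0..1}"
    have t01: "t n \<in> {0..1}" for n using t(1)[of n] by (simp add: U_def)
    show "l \<in> U"
    proof (rule ccontr)
      assume "l \<notin> U"
      then obtain b where b: "\<And>x. H l x \<le> b" using l by (auto simp: U_def B_def)
      obtain c where c: "b < c" using gt_ex by blast
      have "unbounded (range (H (t n)))" for n
      proof (rule ccontr)
        assume "\<not> unbounded (range (H (t n)))"
        then have "t n \<in> B" using not_unboundedD[of "range (H (t n))"] t01[of n] by (auto simp: B_def)
        then show False using t(1)[of n] by (simp add: U_def)
      qed
      then have "unbounded {x. c \<le> H (t n) x}" for n by (rule unbounded_range_values[OF cx[OF t01]])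
      moreover have "closed {x. c \<le> H (t n) x}" for n
        by (intro closed_Collect_le cx[OF t01] continuous_on_const)
      \<comment> \<open>The closed unbounded sets for all times \<open>t n\<close> have a common
        point \<open>x\<close>. At this one parameter the inequality
        \<open>c \<le> H (t n) x\<close> passes to the limit time and exceeds the bound
        \<open>b\<close>.\<close>
      ultimately have "unbounded (\<Inter>n. {x. c \<le> H (t n) x})" by (intro club_Inter)
      then obtain x where x: "\<And>n. c \<le> H (t n) x" using unboundedD[of _ origin] by blast
      have "c \<le> H l x" by (rule LIMSEQ_le_const[OF lim[OF t01 t(2) l]]) (use x in blast)
      then show False using b[of x] c by (meson leD le_less_trans)
    qed
  qed
  moreover have "B \<inter> U \<inter> {0..1} = {}" "{0..1} \<subseteq> B \<union> U" by (auto simp: U_def)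
  ultimately have BU: "B \<inter> {0..1} = {} \<or> U \<inter> {0..1} = {}"
    using connected_closedD[of "{0..1::real}" B U] by simp
  have "1 \<notin> B"
  proof
    assume "1 \<in> B"
    then obtain b where b: "\<And>x. extend (g x $ i) \<le> b" using \<phi>(3) by (auto simp: B_def H_def)
    obtain b' where b': "b < extend b'" using extend_cofinal by blast
    obtain x where "b' < g x $ i" using i unboundedD[of _ b'] unfolding unbounded_coordinates_def by blast
    then have "extend b' < extend (g x $ i)" by simp
    then show False using b[of x] b' by (meson leD less_le_trans less_imp_le)
  qed
  then have "1 \<in> U \<inter> {0..1}" by (simp add: U_def)
  then have "B \<inter> {0..1} = {}" using BU by blast
  then have "0 \<notin> B" by auto
  then have nb: "\<not> (\<forall>x. extend (f x $ i) \<le> b)" for b using \<phi>(2) by (auto simp: B_def H_def)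
  have "unbounded (range (\<lambda>x. f x $ i))"
  proof (rule unboundedI)
    fix b
    obtain x where "\<not> extend (f x $ i) \<le> extend b" using nb[of "extend b"] by blast
    then have "b < f x $ i" by simp
    then show "\<exists>y\<in>range (\<lambda>x. f x $ i). b < y" by blast
  qed
  then show "i \<in> unbounded_coordinates f" by (simp add: unbounded_coordinates_def)
qed

section \<open>Standard rays as representatives of the classes\<close>

lemma continuous_standard_ray: "continuous_on UNIV (standard_ray I p)"
  unfolding standard_ray_def
proof (rule continuous_on_vec_lambda)
  show "continuous_on UNIV (\<lambda>x. if i \<in> I then x else p $ i)" for i
    by (cases "i \<in> I") (auto intro: continuous_intros)
qed

lemma unbounded_coordinates_standard_ray: "unbounded_coordinates (standard_ray I p) = I"
proof -
  have "unbounded (range (\<lambda>x. standard_ray I p x $ i)) \<longleftrightarrow> i \<in> I" for i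
  proof (cases "i \<in> I")
    case True
    have "unbounded (UNIV :: long_ray set)" by (rule unboundedI) (use gt_ex in blast)
    then show ?thesis using True by (simp add: standard_ray_def)
  next
    case False
    then show ?thesis by (auto simp: standard_ray_def unbounded_def)
  qed
  then show ?thesis by (simp add: unbounded_coordinates_def)
qed

lemma knot_equiv_unbounded_coordinates:
  assumes "continuous_on UNIV f" "continuous_on UNIV g" "knot_equiv f g"
  shows "unbounded_coordinates f = unbounded_coordinates g"
  using unbounded_coordinates_subset[OF assms(1,3)] unbounded_coordinates_subset[OF assms(2) knot_equiv_sym[OF assms(3)]]
  by blast

text \<open>In charts the curve is an affine function of the transition map \<tau> with direction
  \<open>e\<close>. The derivative of \<tau> vanishes nowhere, by the chain rule for \<tau> followed
  by the reverse transition \<sigma>.\<close>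

lemma smooth_knot_standard_ray:
  fixes I :: "'n::finite set"
  assumes A: "maximal_smooth_atlas A" and I: "I \<noteq> {}"
  shows "smooth_knot A (standard_ray I (\<chi> i. origin))"
proof -
  let ?f = "standard_ray I (\<chi> i. origin)"
  obtain i where i: "i \<in> I" using I by blast
  have nth_i: "?f x $ i = x" for x using i by (simp add: standard_ray_def)
  have "homeomorphism UNIV (range ?f) ?f (\<lambda>y. y $ i)"
  proof (rule homeomorphismI)
    show "continuous_on UNIV ?f" by (rule continuous_standard_ray)
    show "continuous_on (range ?f) (\<lambda>y. y $ i)" by (intro continuous_on_component continuous_on_id)
  qed (auto simp: nth_i)
  moreover have "smooth_on (local_dom c d ?f) (local_expr c d ?f) \<and>
        (\<forall>s\<in>local_dom c d ?f. vector_derivative (local_expr c d ?f) (at s within local_dom c d ?f) \<noteq> 0)"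
    if cd: "c \<in> A" "d \<in> A" for c d
  proof -
    obtain U \<psi> V \<eta> where c: "c = (U, \<psi>)" and d: "d = (V, \<eta>)" by (cases c; cases d) blast
    have chU: "is_chart (U, \<psi>)" and chV: "is_chart (V, \<eta>)" using atlas_chart[OF A] cd c d by auto
    note cU = is_chartD[OF chU] and cV = is_chartD[OF chV]
    define S where "S = \<psi> ` (U \<inter> V)"
    define \<tau> where "\<tau> = \<eta> \<circ> the_inv_into U \<psi>"
    define \<sigma> where "\<sigma> = \<psi> \<circ> the_inv_into V \<eta>"
    have comp: "compatible (U, \<psi>) (V, \<eta>)" using A cd c d by (auto simp: maximal_smooth_atlas_def smooth_atlas_def)
    then have s\<tau>: "smooth_on S \<tau>" and s\<sigma>: "smooth_on (\<eta> ` (U \<inter> V)) \<sigma>"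
      by (auto simp: compatible_def S_def \<tau>_def \<sigma>_def Int_commute)
    \<comment> \<open>The constant coordinates equal \<open>origin\<close>, which lies in every
      chart domain, so they impose no condition on \<open>x\<close>.\<close>
    have "(\<forall>j. ?f x $ j \<in> V) \<longleftrightarrow> x \<in> V" for x
      using i cV(2) by (auto simp: standard_ray_def)
    then have "{x \<in> U. \<forall>j. ?f x $ j \<in> V} = U \<inter> V" by auto
    then have dom: "local_dom c d ?f = S" by (simp add: local_dom_def c d S_def)
    define e :: "real ^ 'n" where "e = (\<chi> j. if j \<in> I then 1 else 0)"
    define q :: "real ^ 'n" where "q = (\<chi> j. if j \<in> I then 0 else \<eta> origin)"
    have expr: "local_expr c d ?f = (\<lambda>s. \<tau> s *\<^sub>R e + q)"
      by (auto simp: local_expr_def c d vec_eq_iff e_def q_def \<tau>_def standard_ray_def)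
    have "e $ i = 1" using i by (simp add: e_def)
    then have e0: "e \<noteq> 0" by auto
    obtain D where D: "D 0 = \<tau>"
      "\<And>k s. s \<in> S \<Longrightarrow> (D k has_vector_derivative D (Suc k) s) (at s within S)"
      using s\<tau> unfolding smooth_on_def by blast
    obtain E where E: "E 0 = \<sigma>"
      "\<And>k s. s \<in> \<eta> ` (U \<inter> V) \<Longrightarrow> (E k has_vector_derivative E (Suc k) s) (at s within \<eta> ` (U \<inter> V))"
      using s\<sigma> unfolding smooth_on_def by blast
    have inv: "\<tau> (\<psi> x) = \<eta> x" "\<sigma> (\<eta> x) = \<psi> x" if "x \<in> U \<inter> V" for x
      using that the_inv_into_f_f[OF cU(3), of x] the_inv_into_f_f[OF cV(3), of x] by (auto simp: \<tau>_def \<sigma>_def)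
    have \<tau>S: "\<tau> ` S = \<eta> ` (U \<inter> V)" unfolding S_def image_image using inv(1) by (rule image_cong[OF refl])
    have "vector_derivative (local_expr c d ?f) (at s within S) \<noteq> 0" if s: "s \<in> S" for s
    proof -
      obtain x where x: "x \<in> U \<inter> V" "s = \<psi> x" using s by (auto simp: S_def)
      have fil: "filterlim \<psi> (at (\<psi> x) within S) (at x)"
        unfolding S_def by (rule filterlim_chart[OF chU]) (use cU(1) cV(1) x in auto)
      \<comment> \<open>\<open>vector_derivative\<close> is determined only at limit points of
        \<open>S\<close>. Now \<open>s\<close> is one, since the long ray has no isolated points and
        \<open>\<psi>\<close> carries punctured neighbourhoods of \<open>x\<close> into
        \<open>S\<close> without \<open>s\<close>.\<close>
      have nt: "at s within S \<noteq> bot"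
      proof
        assume "at s within S = bot"
        then have "eventually (\<lambda>_. False) (at (\<psi> x) within S)" using x(2) by simp
        then have "eventually (\<lambda>_. False) (at x)" by (rule eventually_compose_filterlim[OF _ fil])
        then show False by (simp add: eventually_False)
      qed
      have d\<tau>: "(\<tau> has_vector_derivative D 1 s) (at s within S)" using D(2)[OF s, of 0] D(1) by simp
      have "\<tau> s \<in> \<eta> ` (U \<inter> V)" using \<tau>S s by blast
      then have "(\<sigma> has_vector_derivative E 1 (\<tau> s)) (at (\<tau> s) within \<tau> ` S)"
        using E(2)[of "\<tau> s" 0] E(1) \<tau>S by simp
      from vector_diff_chain_within[OF d\<tau> this]
      have "(\<sigma> \<circ> \<tau> has_vector_derivative D 1 s *\<^sub>R E 1 (\<tau> s)) (at s within S)" .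
      then have "((\<lambda>r. r) has_vector_derivative D 1 s *\<^sub>R E 1 (\<tau> s)) (at s within S)"
        by (rule has_vector_derivative_transform[OF s, rotated]) (auto simp: S_def inv)
      moreover have "((\<lambda>r. r) has_vector_derivative 1) (at s within S)"
        by (rule has_vector_derivative_id[unfolded id_def])
      ultimately have "D 1 s *\<^sub>R E 1 (\<tau> s) = 1"
        by (rule vector_derivative_unique_within[OF nt])
      then have D0: "D 1 s \<noteq> 0" by auto
      have "((\<lambda>s. \<tau> s *\<^sub>R e) has_vector_derivative D 1 s *\<^sub>R e) (at s within S)"
        by (rule bounded_linear.has_vector_derivative[OF bounded_linear_scaleR_left d\<tau>])
      from has_vector_derivative_add[OF this has_vector_derivative_const]
      have "(local_expr c d ?f has_vector_derivative D 1 s *\<^sub>R e) (at s within S)"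
        unfolding expr by simp
      then have "vector_derivative (local_expr c d ?f) (at s within S) = D 1 s *\<^sub>R e"
        by (rule vector_derivative_within[OF nt])
      then show ?thesis using D0 e0 by simp
    qed
    moreover have "smooth_on S (local_expr c d ?f)" unfolding expr by (rule smooth_on_affine[OF s\<tau>])
    ultimately show ?thesis unfolding dom by blast
  qed
  ultimately show ?thesis unfolding smooth_knot_def by blast
qed

theorem theorem3p6:
  fixes A :: "chart set"
  assumes "maximal_smooth_atlas A"
    and "CARD('n::finite) \<ge> 4"
  shows "card ({f :: long_ray \<Rightarrow> long_ray ^ 'n. smooth_knot A f} //
           {(f, g). smooth_knot A f \<and> smooth_knot A g \<and> knot_equiv f g}) = 2 ^ CARD('n) - 1"
proof -
  let ?X = "{f :: long_ray \<Rightarrow> long_ray ^ 'n. smooth_knot A f}"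
  let ?r = "{(f :: long_ray \<Rightarrow> long_ray ^ 'n, g). smooth_knot A f \<and> smooth_knot A g \<and> knot_equiv f g}"
  \<comment> \<open>Representatives have base point \<open>origin\<close>, since smoothness was
    established for it; \<open>knot_equiv_standard\<close> admits every base point.\<close>
  define std :: "'n set \<Rightarrow> long_ray \<Rightarrow> long_ray ^ 'n" where "std I = standard_ray I (\<chi> i. origin)" for I
  have knot: "smooth_knot A (std I)" if "I \<noteq> {}" for I
    unfolding std_def by (rule smooth_knot_standard_ray[OF assms(1) that])
  have cls: "?r `` {f} = {g. smooth_knot A g \<and> knot_equiv f g}" if "smooth_knot A f" for f
    using that by auto
  have eq: "?r `` {f} = ?r `` {g}" if "smooth_knot A f" "smooth_knot A g" "knot_equiv f g" for f g
    unfolding cls[OF that(1)] cls[OF that(2)]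
    using that(3) knot_equiv_sym[OF that(3)] knot_equiv_trans by blast
  have "bij_betw (\<lambda>I. ?r `` {std I}) (Pow UNIV - {{}}) (?X // ?r)"
    unfolding bij_betw_def
  proof
    show "inj_on (\<lambda>I. ?r `` {std I}) (Pow UNIV - {{}})"
    proof (rule inj_onI)
      fix I J :: "'n set"
      assume IJ: "I \<in> Pow UNIV - {{}}" "J \<in> Pow UNIV - {{}}" and eq: "?r `` {std I} = ?r `` {std J}"
      have "std J \<in> ?r `` {std J}" using knot[of J] IJ knot_equiv_refl by auto
      then have "knot_equiv (std I) (std J)" using eq by blast
      then have "unbounded_coordinates (std I) = unbounded_coordinates (std J)"
        unfolding std_def by (rule knot_equiv_unbounded_coordinates[OF continuous_standard_ray continuous_standard_ray])
      then show "I = J" by (simp add: std_def unbounded_coordinates_standard_ray)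
    qed
    show "(\<lambda>I. ?r `` {std I}) ` (Pow UNIV - {{}}) = ?X // ?r"
    proof (intro equalityI subsetI)
      fix C assume "C \<in> (\<lambda>I. ?r `` {std I}) ` (Pow UNIV - {{}})"
      then obtain I where I: "I \<noteq> {}" "C = ?r `` {std I}" by blast
      have "std I \<in> ?X" using knot[OF I(1)] by simp
      then show "C \<in> ?X // ?r" unfolding I(2) by (rule quotientI)
    next
      fix C assume "C \<in> ?X // ?r"
      then obtain f where f: "smooth_knot A f" "C = ?r `` {f}" by (auto elim: quotientE)
      let ?I = "unbounded_coordinates f"
      have I: "?I \<noteq> {}" by (rule unbounded_coordinates_nonempty[OF assms(1) f(1)])
      have "knot_equiv f (std ?I)" unfolding std_def by (rule knot_equiv_standard[OF assms(1) f(1) assms(2)])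
      then have "C = ?r `` {std ?I}" unfolding f(2) by (rule eq[OF f(1) knot[OF I]])
      then show "C \<in> (\<lambda>I. ?r `` {std I}) ` (Pow UNIV - {{}})" using I by blast
    qed
  qed
  then have "card (?X // ?r) = card (Pow (UNIV :: 'n set) - {{}})" by (rule bij_betw_same_card[symmetric])
  also have "\<dots> = 2 ^ CARD('n) - 1" by (simp add: card_Diff_singleton card_Pow)
  finally show ?thesis .
qed

end
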